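(* Let $X$ be a real Lévy process with Lévy measure $\pi$, and let $\zeta$ be the absorption time at $0$ of the Lévy process $X$ resurrected in the positive half-line. Assume that (i) $0$ is regular for $(-\infty,0)$; (ii) $X$ drifts towards $-\infty$; (iii) $\displaystyle \sup_{y>0}U^{*}(y)\,\overline{\pi}^{-}(-y)<\kappa$, where $U^*$ is the renewal function of the downward ladder height process of $X$ and $\kappa$ is the killing rate of the upward ladder process of $X$. Then $E_x(\zeta)<\infty$, and in particular $P_x(\zeta<\infty)=1$, for all $x\ge0$.
   Context: Let $X=(X_t)_{t\ge0}$ be a real-valued Lévy process (with infinite lifetime). $\mathbb{P}_x$ denotes the law under which $X$ is this Lévy process started from $X_0=x$, $\mathbb{P}=\mathbb{P}_0$, and $\tau=\inf\{t\ge0:X_t\le0\}$ (with $\inf\emptyset=\infty$). $\pi$ is the Lévy measure of $X$ and $\bar{\pi}^{-}(x)=\pi((-\infty,x])$. The point $0$ is regular for $(-\infty,0)$ if $\inf\{t>0:X_t<0\}=0$ $\mathbb{P}$-a.s. $X$ drifts towards $-\infty$ if $\lim_{t\to\infty}X_t=-\infty$ a.s. Ladder processes. $U(ds,dv)$ and $U^*(ds,d\ell)$ denote the renewal (potential) measures on $[0,\infty)\times[0,\infty)$ of the bivariate ascending, respectively descending, ladder time and height processes of $X$ (the descending one being the ascending one of $-X$), i.e. $U(ds,dv)=\int_0^\infty \mathbb{P}(L^{-1}_t\in ds,\,H_t\in dv)\,dt$ with $(L^{-1},H)$ the possibly killed bivariate ascending ladder process, and similarly for $U^*$. If $X$ (respectively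 $-X$) is a subordinator, then $U^*(ds,d\ell)=\delta_{(0,0)}(ds,d\ell)$ (respectively $U(ds,dv)=\delta_{(0,0)}(ds,dv)$). Local times at the supremum and infimum are normalized so that the Wiener–Hopf factorization holds in the form: for every nonnegative measurable $h$ and $x>0$, $$\mathbb{E}_x\left(\int_0^{\tau}h(s,X_s)\,ds\right)=\int_{[0,\infty)\times[0,x)}U^{*}(ds,d\ell)\int_{[0,\infty)\times[0,\infty)}U(du,dv)\,h(s+u,x-\ell+v)\,\mathbf 1_{\{x-\ell+v>0\}}.$$ The renewal function of the downward ladder height process is $U^*(x)=U^{*}([0,\infty)\times[0,x])$, $x\ge 0$. The killing rate $\kappa$ of the upward ladder process satisfies $U([0,\infty)\times[0,\infty))=\kappa^{-1}$; $\kappa>0$ when $X$ drifts towards $-\infty$. Resurrected process. Fix $x\ge0$ and let $X^{(1)}$ be the Lévy process started from $x$. For $n\ge1$ let $\tau_n=\inf\{t\ge0:X^{(n)}_t\le0\}$. If $\tau_n=\infty$ set $X^{(n+1)}=X^{(n)}$. If $\tau_n<\infty$ set $X^{(n+1)}_t=X^{(n)}_t$ for $t<\tau_n$ and $X^{(n+1)}_t=X^{(n)}_t-(X^{(n)}_{\tau_n}-X^{(n)}_{\tau_n-})$ for $t\ge\tau_n$ (the jump at $\tau_n$ is removed; there is no jump at time $0$). The sequence $(\tau_n)$ is nondecreasing. The resurrected process is $Z_t=\lim_{n\to\infty}X^{(n)}_t\mathbf 1_{\{t<\tau_n\}}$, $t\ge0$; it is a nonnegative process started from $x$ and absorbed at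 $0$. Its absorption time is $\zeta=\inf\{t:Z_t=0\}=\lim_{n\to\infty}\tau_n\in[0,\infty]$. $P_x$ denotes the law of $Z$ started from $x$, with expectation $E_x$. *)

theory Defs
  imports "HOL-Probability.Probability"
begin

section \<open>Levy processes\<close>

definition cadlag :: "(real \<Rightarrow> real) \<Rightarrow> bool" where
  "cadlag f \<longleftrightarrow> (\<forall>t\<ge>0. continuous (at_right t) f) \<and> (\<forall>t>0. \<exists>l. (f \<longlongrightarrow> l) (at_left t))"

text \<open>Time runs through \<open>{0..}\<close>; the values of a process at negative times play no role.
  The Levy process started from \<open>x\<close> is \<open>\<lambda>t \<omega>. x + X t \<omega>\<close>.\<close>

definition levy_process :: "'a measure \<Rightarrow> (real \<Rightarrow> 'a \<Rightarrow> real) \<Rightarrow> bool" where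
  "levy_process M X \<longleftrightarrow>
     prob_space M \<and>
     (\<forall>t\<ge>0. X t \<in> borel_measurable M) \<and>
     (\<forall>\<omega>\<in>space M. cadlag (\<lambda>t. X t \<omega>)) \<and>
     (AE \<omega> in M. X 0 \<omega> = 0) \<and>
     (\<forall>t :: nat \<Rightarrow> real. 0 \<le> t 0 \<and> incseq t \<longrightarrow>
        prob_space.indep_vars M (\<lambda>_. borel) (\<lambda>i \<omega>. X (t (Suc i)) \<omega> - X (t i) \<omega>) UNIV) \<and>
     (\<forall>s\<ge>0. \<forall>t\<ge>0. distr M borel (\<lambda>\<omega>. X (s + t) \<omega> - X s \<omega>) = distr M borel (X t))"

text \<open>By convention there is no jump at time 0.\<close>

definition jump :: "(real \<Rightarrow> real) \<Rightarrow> real \<Rightarrow> real" where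
  "jump f t = (if t > 0 then f t - Lim (at_left t) f else 0)"

text \<open>The Levy measure is the expected number of jumps per unit of time.\<close>

definition is_levy_measure ::
  "'a measure \<Rightarrow> (real \<Rightarrow> 'a \<Rightarrow> real) \<Rightarrow> real measure \<Rightarrow> bool" where
  "is_levy_measure M X \<pi> \<longleftrightarrow>
     sets \<pi> = sets borel \<and>
     (\<forall>A\<in>sets borel. emeasure \<pi> A =
        (\<integral>\<^sup>+\<omega>. emeasure (count_space UNIV) {s\<in>{0<..1}. jump (\<lambda>t. X t \<omega>) s \<in> A - {0}} \<partial>M))"

definition regular_for :: "'a measure \<Rightarrow> (real \<Rightarrow> 'a \<Rightarrow> real) \<Rightarrow> real set \<Rightarrow> bool" where
  "regular_for M X B \<longleftrightarrow> (AE \<omega> in M. (INF t\<in>{t. 0 < t \<and> X t \<omega> \<in> B}. ennreal t) = 0)"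

definition drifts_to_minus_infinity :: "'a measure \<Rightarrow> (real \<Rightarrow> 'a \<Rightarrow> real) \<Rightarrow> bool" where
  "drifts_to_minus_infinity M X \<longleftrightarrow> (AE \<omega> in M. filterlim (\<lambda>t. X t \<omega>) at_bot at_top)"


section \<open>Local time at the supremum and ladder processes\<close>

definition running_sup :: "(real \<Rightarrow> 'a \<Rightarrow> real) \<Rightarrow> real \<Rightarrow> 'a \<Rightarrow> real" where
  "running_sup X t \<omega> = (SUP s\<in>{0..t}. X s \<omega>)"

text \<open>The natural filtration, completed by the null sets and made right-continuous.
  The index \<open>\<top>\<close> (infinite time) is included so that stopping times may be infinite.\<close>

definition history :: "'a measure \<Rightarrow> (real \<Rightarrow> 'a \<Rightarrow> real) \<Rightarrow> ennreal \<Rightarrow> 'a set set" where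
  "history M X u = sigma_sets (space M)
     ({X s -` B \<inter> space M | s B. 0 \<le> s \<and> ennreal s \<le> u \<and> B \<in> sets borel} \<union> null_sets M)"

definition aug_filtration :: "'a measure \<Rightarrow> (real \<Rightarrow> 'a \<Rightarrow> real) \<Rightarrow> ennreal \<Rightarrow> 'a measure" where
  "aug_filtration M X t = sigma (space M) (\<Inter>u\<in>insert \<top> {t<..}. history M X u)"

lemma filtration_aug_filtration:
  assumes "\<And>t. t \<ge> 0 \<Longrightarrow> X t \<in> borel_measurable M"
  shows "filtration (space M) (aug_filtration M X)"
    and "sets (aug_filtration M X t) = (\<Inter>u\<in>insert \<top> {t<..}. history M X u)"
proof -
  have sa: "sigma_algebra (space M) (history M X u)" for u
    unfolding history_def
    by (rule sigma_algebra_sigma_sets) (auto dest: sets.sets_into_space)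
  have alg: "sigma_algebra (space M) (\<Inter>u\<in>insert \<top> {t<..}. history M X u)" for t
    using sa unfolding sigma_algebra_iff2 by (auto simp: subset_iff)
  have eq: "sets (aug_filtration M X t) = (\<Inter>u\<in>insert \<top> {t<..}. history M X u)" for t
    unfolding aug_filtration_def
    by (rule sigma_algebra.sets_measure_of_eq[OF alg])
  show "sets (aug_filtration M X t) = (\<Inter>u\<in>insert \<top> {t<..}. history M X u)"
    by (rule eq)
  show "filtration (space M) (aug_filtration M X)"
  proof
    show "space (aug_filtration M X i) = space M" for i
      using sigma_algebra.space_measure_of_eq[OF alg] by (simp add: aug_filtration_def)
    show "sets (aug_filtration M X i) \<subseteq> sets (aug_filtration M X j)" if "i \<le> j" for i j
      unfolding eq using that by (intro INF_superset_mono) auto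
  qed
qed

text \<open>Support of the Stieltjes measure \<open>dF\<close> on \<open>{0..}\<close>, for continuous nondecreasing \<open>F\<close>.\<close>

definition stieltjes_support :: "(real \<Rightarrow> real) \<Rightarrow> real set" where
  "stieltjes_support F = {t. 0 \<le> t \<and> (\<forall>\<epsilon>>0. F (max 0 (t - \<epsilon>)) < F (t + \<epsilon>))}"

text \<open>The standard definition of a (continuous) local time at the maximum. The last
  clause says that, on the event that a stopping time \<open>T\<close> with values in the set of times at the
  maximum is finite, the shifted trivariate process is independent of the past up to \<open>T\<close> and has
  the law of the original one.\<close>

definition local_time_at_max ::
  "'a measure \<Rightarrow> (real \<Rightarrow> 'a \<Rightarrow> real) \<Rightarrow> (real \<Rightarrow> 'a \<Rightarrow> real) \<Rightarrow> bool" where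
  "local_time_at_max M X L \<longleftrightarrow>
     (\<forall>\<omega>\<in>space M. continuous_on {0..} (\<lambda>t. L t \<omega>) \<and> mono_on {0..} (\<lambda>t. L t \<omega>) \<and>
        (\<forall>t\<ge>0. 0 \<le> L t \<omega>)) \<and>
     (\<forall>t\<ge>0. L t \<in> borel_measurable (aug_filtration M X (ennreal t))) \<and>
     (AE \<omega> in M. stieltjes_support (\<lambda>t. L t \<omega>) = closure {t. 0 \<le> t \<and> running_sup X t \<omega> = X t \<omega>}) \<and>
     (\<forall>T. stopping_time (aug_filtration M X) T \<longrightarrow>
        (AE \<omega> in M. T \<omega> < \<top> \<longrightarrow> running_sup X (enn2real (T \<omega>)) \<omega> = X (enn2real (T \<omega>)) \<omega>) \<longrightarrow>
        (\<forall>A\<in>sets (filtration.pre_sigma (space M) (aug_filtration M X) T).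
         \<forall>B\<in>sets (PiM {0..} (\<lambda>_. borel :: (real \<times> real \<times> real) measure)).
           measure M {\<omega>\<in>A. T \<omega> < \<top> \<and>
             (let r = enn2real (T \<omega>) in
                (\<lambda>t\<in>{0..}. (X (r + t) \<omega> - X r \<omega>, running_sup X (r + t) \<omega> - X (r + t) \<omega>,
                            L (r + t) \<omega> - L r \<omega>))) \<in> B} =
           measure M {\<omega>\<in>A. T \<omega> < \<top>} *
           measure M {\<omega>\<in>space M. (\<lambda>t\<in>{0..}. (X t \<omega>, running_sup X t \<omega> - X t \<omega>, L t \<omega>)) \<in> B}))"

text \<open>If 0 is irregular for \<open>{0..}\<close>, the times at the maximum are discrete, and the local time is
  \<open>e\<^sub>0 + \<dots> + e\<^sub>n\<close> where \<open>n\<close> is the number of such times in \<open>{0<..t}\<close> and the \<open>e\<^sub>i\<close> are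
  exponential with rate \<open>c\<close>, independent of each other and of \<open>X\<close>. They are the coordinates of the
  second factor of the following extension of the probability space.\<close>

definition exp_extension :: "real \<Rightarrow> 'a measure \<Rightarrow> ('a \<times> (nat \<Rightarrow> real)) measure" where
  "exp_extension c M = M \<Otimes>\<^sub>M PiM UNIV (\<lambda>_. density lborel (\<lambda>x. ennreal (exponential_density c x)))"

definition discrete_local_time ::
  "(real \<Rightarrow> 'a \<Rightarrow> real) \<Rightarrow> real \<Rightarrow> 'a \<times> (nat \<Rightarrow> real) \<Rightarrow> real" where
  "discrete_local_time X t = (\<lambda>(\<omega>, e). \<Sum>i\<le>card {s\<in>{0<..t}. running_sup X s \<omega> = X s \<omega>}. e i)"

definition inverse_local_time :: "(real \<Rightarrow> 'a \<Rightarrow> real) \<Rightarrow> real \<Rightarrow> 'a \<Rightarrow> ennreal" where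
  "inverse_local_time L t \<omega> = (INF s\<in>{s. 0 \<le> s \<and> t < L s \<omega>}. ennreal s)"

text \<open>\<open>U\<close> and \<open>\<kappa>\<close> are the potential measure and the killing rate of the ladder process
  \<open>t \<mapsto> (T\<^sub>t, X(T\<^sub>t))\<close>, killed when \<open>T\<^sub>t = \<infinity>\<close>, where \<open>T\<close> is the right-continuous inverse of \<open>L\<close>.
  The completion only serves to make the events measurable: hitting times of closed sets by cadlag
  processes need not be Borel functions on the original space.\<close>

definition ladder_potential ::
  "'a measure \<Rightarrow> (real \<Rightarrow> 'a \<Rightarrow> real) \<Rightarrow> (real \<Rightarrow> 'a \<Rightarrow> real) \<Rightarrow> (real \<times> real) measure \<Rightarrow> real \<Rightarrow> bool"
  where
  "ladder_potential N X L U \<kappa> \<longleftrightarrow>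
     sets U = sets borel \<and>
     (\<forall>A\<in>sets borel. emeasure U A =
        (\<integral>\<^sup>+t\<in>{0..}. emeasure (completion N)
           {\<omega>\<in>space N. inverse_local_time L t \<omega> < \<top> \<and>
              (enn2real (inverse_local_time L t \<omega>), X (enn2real (inverse_local_time L t \<omega>)) \<omega>) \<in> A}
         \<partial>lborel)) \<and>
     (\<forall>t\<ge>0. measure (completion N) {\<omega>\<in>space N. inverse_local_time L t \<omega> < \<top>} = exp (- \<kappa> * t))"

text \<open>\<open>U\<close> is the renewal measure and \<open>\<kappa>\<close> the killing rate of the bivariate ascending ladder process
  of \<open>X\<close>, for some normalisation of the local time; if \<open>-X\<close> is a subordinator, \<open>U\<close> is
  \<open>\<delta>\<^bsub>(0,0)\<^esub>\<close> by convention, which corresponds to the killing rate 1. The descending ladder process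
  is the ascending one of \<open>-X\<close>.\<close>

definition ascending_ladder ::
  "'a measure \<Rightarrow> (real \<Rightarrow> 'a \<Rightarrow> real) \<Rightarrow> (real \<times> real) measure \<Rightarrow> real \<Rightarrow> bool" where
  "ascending_ladder M X U \<kappa> \<longleftrightarrow>
     (if AE \<omega> in M. antimono_on {0..} (\<lambda>t. X t \<omega>)
      then U = return borel (0, 0) \<and> \<kappa> = 1
      else if regular_for M X {0..}
      then \<exists>L. local_time_at_max M X L \<and> ladder_potential M X L U \<kappa>
      else \<exists>c>0. ladder_potential (exp_extension c M) (\<lambda>t (\<omega>, e). X t \<omega>)
                   (discrete_local_time X) U \<kappa>)"

definition first_passage :: "(real \<Rightarrow> real) \<Rightarrow> ennreal" where
  "first_passage f = (INF t\<in>{t. 0 \<le> t \<and> f t \<le> 0}. ennreal t)"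

text \<open>The normalisation of the two local times: the Wiener--Hopf factorisation holds with
  constant 1.\<close>

definition wiener_hopf_normalized ::
  "'a measure \<Rightarrow> (real \<Rightarrow> 'a \<Rightarrow> real) \<Rightarrow> (real \<times> real) measure \<Rightarrow> (real \<times> real) measure \<Rightarrow> bool"
  where
  "wiener_hopf_normalized M X U Ustar \<longleftrightarrow>
     (\<forall>h :: real \<times> real \<Rightarrow> ennreal. \<forall>x>0. h \<in> borel_measurable borel \<longrightarrow>
        (\<integral>\<^sup>+\<omega>. (\<integral>\<^sup>+s\<in>{s. 0 \<le> s \<and> ennreal s < first_passage (\<lambda>t. x + X t \<omega>)}.
                  h (s, x + X s \<omega>) \<partial>lborel) \<partial>M) =
        (\<integral>\<^sup>+p\<in>{0..} \<times> {0..<x}.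
           (\<integral>\<^sup>+q\<in>{0..} \<times> {0..}.
              h (fst p + fst q, x - snd p + snd q) * indicator {0<..} (x - snd p + snd q) \<partial>U) \<partial>Ustar))"


section \<open>The process resurrected in the positive half-line\<close>

definition remove_passage_jump :: "(real \<Rightarrow> real) \<Rightarrow> real \<Rightarrow> real" where
  "remove_passage_jump f =
     (if first_passage f = \<top> then f
      else (\<lambda>t. if ennreal t < first_passage f then f t
                 else f t - jump f (enn2real (first_passage f))))"

text \<open>The indices \<open>n\<close> below start from 0.\<close>

definition resurrection_step :: "(real \<Rightarrow> real) \<Rightarrow> nat \<Rightarrow> real \<Rightarrow> real" where
  "resurrection_step f n = (remove_passage_jump ^^ n) f"

definition resurrected :: "(real \<Rightarrow> real) \<Rightarrow> real \<Rightarrow> real" where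
  "resurrected f t =
     lim (\<lambda>n. if ennreal t < first_passage (resurrection_step f n) then resurrection_step f n t else 0)"

definition absorption_time :: "(real \<Rightarrow> real) \<Rightarrow> ennreal" where
  "absorption_time f = (INF t\<in>{t. 0 \<le> t \<and> resurrected f t = 0}. ennreal t)"

end

theory Submission
  imports Defs
begin

text \<open>Let \<open>m y\<close> be the mean passage time of \<open>X\<close> below \<open>-y\<close>. It is finite because \<open>X\<close> drifts to
  \<open>-\<infinity>\<close>, subadditive by the strong Markov property, and \<open>m 0 = 0\<close> by regularity, so it is
  left-continuous; hence the first passage into the closed half-line almost surely agrees with the
  passage strictly below. The Wiener--Hopf identity with \<open>h = 1\<close> gives \<open>m y \<le> U\<^sup>*(y) / \<kappa>\<close>, so
  assumption (iii) says that \<open>m y * \<pi> {..-y} \<le> q\<close> with \<open>q < 1\<close>. If \<open>Y\<close> is the level just before the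
  passage from \<open>y\<close>, a jump from \<open>Y\<close> must be larger than \<open>Y\<close>, and the compensation formula yields
  \<open>E (m Y) \<le> q * m y\<close>. The mean durations between successive resurrections therefore decay
  geometrically, and the mean absorption time is at most \<open>m y / (1 - q)\<close>.\<close>

section \<open>Passage times of resurrected functions\<close>

text \<open>The obstacle is measurability: in the product \<sigma>-algebra of path space neither
  evaluation at a random time nor first passage into a closed set is measurable. All probability is
  therefore done with \<open>hit\<close>, the strict passage along rational times, and with limits
  along dyadic times; the pathwise resurrection is identified with these objects on an almost sure
  event. \<open>hit\<close> is only an optional time, which fixes the form of the strong Markov
  property. Drift to minus infinity gives no first moment of \<open>X\<close>, so finiteness of
  \<open>m\<close> comes from reversing the walk at integer times. The constant
  \<open>1 / \<kappa>\<close> is the total mass of \<open>U\<close>: for a ladder process, the mean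
  of its exponential lifetime. The compensation formula appears as a discrete inequality: the
  \<open>N\<close> blocks of the unit time interval contain on average at most
  \<open>\<pi> {..-a}\<close> jumps of at most \<open>-a\<close>, so each has one with probability
  at most \<open>\<pi> {..-a} / N\<close>, independently of the past. Rounding the jump size down
  costs a margin \<open>e\<close>, which disappears by left-continuity of \<open>m\<close>.\<close>

lemma first_passage_less_iff:
  "first_passage f < c \<longleftrightarrow> (\<exists>t\<ge>0. f t \<le> 0 \<and> ennreal t < c)"
  unfolding first_passage_def by (auto simp: INF_less_iff)

lemma first_passage_pos: "0 \<le> t \<Longrightarrow> ennreal t < first_passage f \<Longrightarrow> f t > 0"
  unfolding first_passage_def
  by (metis (mono_tags, lifting) INF_lower leD linorder_not_le mem_Collect_eq)

lemma first_passage_geI: "(\<And>t. 0 \<le> t \<Longrightarrow> ennreal t < c \<Longrightarrow> f t > 0) \<Longrightarrow> c \<le> first_passage f"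
  unfolding first_passage_def by (rule INF_greatest) (force simp: not_less[symmetric])

lemma first_passage_le: "0 \<le> t \<Longrightarrow> f t \<le> 0 \<Longrightarrow> first_passage f \<le> ennreal t"
  unfolding first_passage_def by (rule INF_lower) simp

lemma first_passage_cong: "(\<And>t. 0 \<le> t \<Longrightarrow> f t = g t) \<Longrightarrow> first_passage f = first_passage g"
  unfolding first_passage_def by (rule arg_cong[where f=Inf]) auto

lemma remove_passage_jump_before:
  "ennreal t < first_passage f \<Longrightarrow> remove_passage_jump f t = f t"
  unfolding remove_passage_jump_def by simp

lemma first_passage_remove_ge: "first_passage f \<le> first_passage (remove_passage_jump f)"
  by (rule first_passage_geI) (simp add: remove_passage_jump_before first_passage_pos)

lemma resurrection_step_Suc: "resurrection_step f (Suc n) = remove_passage_jump (resurrection_step f n)"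
  by (simp add: resurrection_step_def)

lemma resurrection_step_Suc': "resurrection_step f (Suc n) = resurrection_step (remove_passage_jump f) n"
  by (simp add: resurrection_step_def funpow_swap1)

lemma resurrection_step_0 [simp]: "resurrection_step f 0 = f"
  by (simp add: resurrection_step_def)

lemma incseq_first_passage_resurrection_step:
  "incseq (\<lambda>n. first_passage (resurrection_step f n))"
  by (rule incseq_SucI) (simp add: resurrection_step_Suc first_passage_remove_ge)

lemma resurrection_step_before:
  assumes "ennreal t < first_passage (resurrection_step f n)" "n \<le> m"
  shows "resurrection_step f m t = resurrection_step f n t"
  using assms(2)
proof (induction m rule: dec_induct)
  case (step m)
  have "ennreal t < first_passage (resurrection_step f m)"
    using assms(1) incseqD[OF incseq_first_passage_resurrection_step step.hyps(1)] by (rule less_le_trans)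
  then show ?case
    using step by (simp add: resurrection_step_Suc remove_passage_jump_before)
qed simp

text \<open>Before the supremum of the passage times the sequence defining
  \<open>resurrected\<close> is eventually constant, with a positive value; from the supremum on,
  all its terms are 0.\<close>

lemma absorption_time_eq:
  "absorption_time f = (SUP n. first_passage (resurrection_step f n))" (is "_ = ?S")
proof -
  let ?h = "\<lambda>t n. if ennreal t < first_passage (resurrection_step f n) then resurrection_step f n t else 0"
  have pos: "resurrected f t > 0" if t: "0 \<le> t" "ennreal t < ?S" for t
  proof -
    obtain n where n: "ennreal t < first_passage (resurrection_step f n)"
      using t by (auto simp: less_SUP_iff)
    have "?h t m = resurrection_step f n t" if "n \<le> m" for m
      using less_le_trans[OF n incseqD[OF incseq_first_passage_resurrection_step that]]
        resurrection_step_before[OF n that] by simp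
    then have "?h t \<longlonglongrightarrow> resurrection_step f n t"
      by (intro tendsto_eventually eventually_sequentiallyI[of n]) blast
    then have "resurrected f t = resurrection_step f n t"
      unfolding resurrected_def by (rule limI)
    then show ?thesis using first_passage_pos[OF t(1) n] by simp
  qed
  have zero: "resurrected f t = 0" if t: "?S \<le> ennreal t" for t
  proof -
    have "\<not> ennreal t < first_passage (resurrection_step f n)" for n
      using order_trans[OF SUP_upper[of n UNIV] t] by (simp add: not_less)
    then have "?h t = (\<lambda>_. 0)" by auto
    then show ?thesis unfolding resurrected_def by (metis limI tendsto_const)
  qed
  show ?thesis
  proof (rule antisym)
    show "?S \<le> absorption_time f"
      unfolding absorption_time_def using pos by (intro INF_greatest) (force simp: not_less[symmetric])
    show "absorption_time f \<le> ?S"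
    proof (cases "?S = \<top>")
      case False
      then have S: "?S = ennreal (enn2real ?S)" by (metis ennreal_enn2real top.not_eq_extremum)
      then have "resurrected f (enn2real ?S) = 0" by (intro zero) simp
      then have "absorption_time f \<le> ennreal (enn2real ?S)"
        unfolding absorption_time_def by (intro INF_lower) simp
      then show ?thesis using S by simp
    qed (metis top_greatest)
  qed
qed

section \<open>Left limits, jumps and restarts at a fixed time\<close>

lemma tendsto_at_left_cong:
  assumes "\<And>t. 0 \<le> t \<Longrightarrow> f t = g t" "0 < d"
  shows "(f \<longlongrightarrow> l) (at_left d) \<longleftrightarrow> (g \<longlongrightarrow> l) (at_left (d::real))"
proof (rule tendsto_cong)
  have "eventually (\<lambda>t. t \<in> {0<..<d}) (at_left d)"
    by (rule eventually_at_left_real[OF assms(2)])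
  then show "\<forall>\<^sub>F t in at_left d. f t = g t"
    by eventually_elim (simp add: assms)
qed

text \<open>\<open>Lim\<close> is a definite description, so it suffices that both functions have
  the same left limits, whether or not one exists. At \<open>d = 0\<close> both jumps are 0 by
  convention.\<close>

lemma jump_cong:
  assumes "\<And>t. 0 \<le> t \<Longrightarrow> f t = g t" "0 \<le> d"
  shows "jump f d = jump g d"
  using assms tendsto_at_left_cong[OF assms(1), where d=d] by (simp add: jump_def t2_space_class.Lim_def)

lemma jump_eq: "0 < d \<Longrightarrow> (f \<longlongrightarrow> l) (at_left d) \<Longrightarrow> jump f d = f d - l"
  unfolding jump_def by (simp add: tendsto_Lim)

lemma jump_shift:
  assumes "0 < d" "0 \<le> T"
  shows "jump (\<lambda>t. f (T + t)) d = jump f (T + d)"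
proof -
  have "filtermap (\<lambda>t. T + t) (at_left d) = at_left (T + d)"
  proof (rule filter_eqI)
    fix P
    have "(\<exists>b<d. \<forall>y>b. y < d \<longrightarrow> P (T + y)) \<longleftrightarrow> (\<exists>b<T + d. \<forall>y>b. y < T + d \<longrightarrow> P y)" (is "?l = ?r")
    proof
      assume ?l
      then obtain b where b: "b < d" "\<forall>y>b. y < d \<longrightarrow> P (T + y)" by auto
      have "P y" if "T + b < y" "y < T + d" for y
        using b(2)[rule_format, of "y - T"] that by simp
      with b(1) show ?r by (intro exI[of _ "T + b"]) auto
    next
      assume ?r
      then obtain b where "b < T + d" "\<forall>y>b. y < T + d \<longrightarrow> P y" by auto
      then show ?l by (intro exI[of _ "b - T"]) auto
    qed
    then show "eventually P (filtermap (\<lambda>t. T + t) (at_left d)) \<longleftrightarrow> eventually P (at_left (T + d))"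
      by (simp add: eventually_filtermap eventually_at_left_field)
  qed
  then have "((\<lambda>t. f (T + t)) \<longlongrightarrow> l) (at_left d) \<longleftrightarrow> (f \<longlongrightarrow> l) (at_left (T + d))" for l
    by (metis filterlim_filtermap)
  then show ?thesis using assms by (simp add: jump_def t2_space_class.Lim_def)
qed

text \<open>\<open>f\<close> is \<open>g\<close> delayed by \<open>T\<close>. The condition
  \<open>first_passage g > 0\<close> excludes a passage exactly at \<open>T\<close>: there
  \<open>jump f T\<close> would look at values before \<open>T\<close>, whereas
  \<open>jump g 0\<close> is 0 by convention.\<close>

lemma
  assumes T: "0 \<le> T" and before: "\<And>t. 0 \<le> t \<Longrightarrow> t < T \<Longrightarrow> f t > 0"
    and eq: "\<And>t. 0 \<le> t \<Longrightarrow> f (T + t) = g t"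
  shows first_passage_restart: "first_passage f = ennreal T + first_passage g"
    and remove_passage_jump_restart:
      "first_passage g > 0 \<Longrightarrow> 0 \<le> t \<Longrightarrow> remove_passage_jump f (T + t) = remove_passage_jump g t"
proof -
  show fp: "first_passage f = ennreal T + first_passage g"
  proof (rule antisym)
    show "first_passage f \<le> ennreal T + first_passage g"
    proof (cases "first_passage g = \<top>")
      case False
      show ?thesis
      \<comment> \<open>The infimum in \<open>first_passage g\<close> need not be attained,
        \<open>g\<close> being arbitrary; hence the margin \<open>e\<close>.\<close>
      proof (rule ennreal_le_epsilon)
        fix e :: real assume e: "0 < e"
        have "first_passage g < first_passage g + ennreal e"
        proof (cases "first_passage g")
          case (real r)
          then show ?thesis
            using e by (simp add: ennreal_less_iff flip: ennreal_plus)
        qed (use False in simp)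
        then obtain t where t: "0 \<le> t" "g t \<le> 0" "ennreal t < first_passage g + ennreal e"
          by (auto simp: first_passage_less_iff)
        have "first_passage f \<le> ennreal (T + t)"
          using t T by (intro first_passage_le) (auto simp: eq)
        also have "\<dots> = ennreal T + ennreal t" using t T by simp
        also have "\<dots> \<le> ennreal T + (first_passage g + ennreal e)"
          using t by (intro add_left_mono) simp
        finally show "first_passage f \<le> ennreal T + first_passage g + ennreal e"
          by (simp add: add.assoc)
      qed
    qed simp
    show "ennreal T + first_passage g \<le> first_passage f"
    proof (rule first_passage_geI)
      fix t assume t: "0 \<le> t" "ennreal t < ennreal T + first_passage g"
      show "f t > 0"
      proof (cases "t < T")
        case False
        then have "ennreal t = ennreal T + ennreal (t - T)"
          using T ennreal_plus[of T "t - T"] by simp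
        with t have "ennreal (t - T) < first_passage g" by simp
        from first_passage_pos[OF _ this] False show ?thesis
          using eq[of "t - T"] by simp
      qed (use t before in auto)
    qed
  qed
  assume g: "first_passage g > 0" and t: "0 \<le> t"
  have lt: "ennreal (T + t) < first_passage f \<longleftrightarrow> ennreal t < first_passage g"
    using T t by (simp add: fp)
  show "remove_passage_jump f (T + t) = remove_passage_jump g t"
  proof (cases "first_passage g = \<top>")
    case False
    define d where "d = enn2real (first_passage g)"
    have d: "first_passage g = ennreal d" "d > 0"
      using False g by (auto simp: d_def enn2real_positive_iff less_top)
    have d': "first_passage f = ennreal (T + d)" using T d by (simp add: fp)
    have "jump f (T + d) = jump (\<lambda>t. f (T + t)) d"
      using d T by (simp add: jump_shift)
    also have "\<dots> = jump g d" by (rule jump_cong) (use eq d in auto)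
    finally have "jump f (T + d) = jump g d" .
    moreover have "enn2real (first_passage f) = T + d" "enn2real (first_passage g) = d"
      "first_passage f \<noteq> \<top>" "first_passage g \<noteq> \<top>"
      using d d' T by simp_all
    ultimately show ?thesis
      using lt t by (simp add: remove_passage_jump_def eq del: ennreal_plus)
  qed (use t in \<open>simp_all add: remove_passage_jump_def fp eq\<close>)
qed

text \<open>Removing a passage jump preserves all four hypotheses: nothing changes before
  \<open>T\<close>, and a positive passage time of \<open>g\<close> can only grow. Both functions
  are modified, hence the induction over arbitrary \<open>f\<close> and \<open>g\<close>.\<close>

lemma first_passage_resurrection_step_restart:
  assumes "0 \<le> T" and "\<And>t. 0 \<le> t \<Longrightarrow> t < T \<Longrightarrow> f t > 0"
    and "\<And>t. 0 \<le> t \<Longrightarrow> f (T + t) = g t" and "first_passage g > 0"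
  shows "first_passage (resurrection_step f n) = ennreal T + first_passage (resurrection_step g n)"
  using assms
proof (induction n arbitrary: f g)
  case 0
  then show ?case by (simp add: first_passage_restart)
next
  case (Suc n)
  have fp: "first_passage f = ennreal T + first_passage g"
    using Suc.prems by (intro first_passage_restart)
  show ?case unfolding resurrection_step_Suc'
  proof (rule Suc.IH)
    show "remove_passage_jump f t > 0" if "0 \<le> t" "t < T" for t
    proof -
      have "ennreal t < ennreal T" using that by (simp add: ennreal_less_iff)
      also have "\<dots> \<le> first_passage f" by (simp add: fp)
      finally show ?thesis using that Suc.prems by (simp add: remove_passage_jump_before)
    qed
    show "remove_passage_jump f (T + t) = remove_passage_jump g t" if "0 \<le> t" for t
      using Suc.prems that by (intro remove_passage_jump_restart)
    show "0 < first_passage (remove_passage_jump g)"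
      using Suc.prems first_passage_remove_ge[of g] by (metis less_le_trans)
  qed (use Suc.prems in auto)
qed

text \<open>This is absorption: a passage without a jump leaves nothing to remove, so the iteration
  is stuck. It covers continuous arrival at 0 and, by the convention at time 0, a start at
  0.\<close>

lemma first_passage_resurrection_step_stationary:
  assumes T: "first_passage f = ennreal T" "0 \<le> T" and j: "jump f T = 0"
  shows "first_passage (resurrection_step f n) = ennreal T"
proof -
  have "remove_passage_jump f = f"
    using T j by (auto simp: remove_passage_jump_def fun_eq_iff)
  then have "resurrection_step f n = f"
    by (induction n) (simp_all add: resurrection_step_Suc)
  then show ?thesis using T by simp
qed

section \<open>Path space\<close>

text \<open>The index set is all of the reals for convenience; \<open>post\<close>,
  \<open>stopped\<close> and \<open>path\<close> freeze negative times with
  \<open>max 0\<close>.\<close>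

abbreviation paths :: "(real \<Rightarrow> real) measure" where
  "paths \<equiv> PiM UNIV (\<lambda>_. borel)"

definition post :: "real \<Rightarrow> (real \<Rightarrow> real) \<Rightarrow> real \<Rightarrow> real" where
  "post t w = (\<lambda>s. w (t + max 0 s) - w t)"

definition stopped :: "real \<Rightarrow> (real \<Rightarrow> real) \<Rightarrow> real \<Rightarrow> real" where
  "stopped t w = (\<lambda>s. w (min (max 0 s) t))"

text \<open>Right and left limits along dyadic times; unlike evaluation at \<open>r\<close> these are jointly
  measurable in \<open>(r, w)\<close> for the product \<open>\<sigma>\<close>-algebra.\<close>

definition rval :: "real \<Rightarrow> (real \<Rightarrow> real) \<Rightarrow> real" where
  "rval r w = lim (\<lambda>k. w ((of_int \<lfloor>r * 2 ^ k\<rfloor> + 1) / 2 ^ k))"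

definition lval :: "real \<Rightarrow> (real \<Rightarrow> real) \<Rightarrow> real" where
  "lval r w = lim (\<lambda>k. w ((of_int \<lceil>r * 2 ^ k\<rceil> - 1) / 2 ^ k))"

lemma measurable_coord [measurable]: "(\<lambda>w. w t) \<in> borel_measurable paths"
  by simp

lemma measurable_pathsI: "(\<And>t. (\<lambda>x. f x t) \<in> borel_measurable N) \<Longrightarrow> f \<in> N \<rightarrow>\<^sub>M paths"
  by (rule measurable_PiM_single') auto

lemma measurable_post [measurable]: "post t \<in> paths \<rightarrow>\<^sub>M paths"
  unfolding post_def by (rule measurable_pathsI) measurable

lemma measurable_stopped [measurable]: "stopped t \<in> paths \<rightarrow>\<^sub>M paths"
  unfolding stopped_def by (rule measurable_pathsI) measurable

text \<open>A random time with countably many values, coded by the integer \<open>g x\<close>, can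
  be inserted into a path by a countable case distinction.\<close>

lemma measurable_eval_countable:
  assumes [measurable]: "g \<in> N \<rightarrow>\<^sub>M count_space UNIV" "f \<in> N \<rightarrow>\<^sub>M paths"
  shows "(\<lambda>x. f x (h (g x :: int))) \<in> borel_measurable N"
proof (rule measurable_compose_countable[where f="\<lambda>i x. f x (h i)"])
  show "(\<lambda>x. f x (h i)) \<in> borel_measurable N" for i
    by (rule measurable_compose[OF assms(2) measurable_coord])
qed simp

lemma measurable_rval [measurable]:
  assumes [measurable]: "r \<in> borel_measurable N" "f \<in> N \<rightarrow>\<^sub>M paths"
  shows "(\<lambda>x. rval (r x) (f x)) \<in> borel_measurable N"
  unfolding rval_def
  by (intro borel_measurable_lim_metric measurable_eval_countable[where h="\<lambda>i. (of_int i + 1) / 2 ^ k" for k]) measurable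

lemma measurable_lval [measurable]:
  assumes [measurable]: "r \<in> borel_measurable N" "f \<in> N \<rightarrow>\<^sub>M paths"
  shows "(\<lambda>x. lval (r x) (f x)) \<in> borel_measurable N"
  unfolding lval_def
  by (intro borel_measurable_lim_metric measurable_eval_countable[where h="\<lambda>i. (of_int i - 1) / 2 ^ k" for k]) measurable

section \<open>Dyadic approximation of cadlag functions\<close>

lemma floor_dyadic_bounds:
  "r < (of_int \<lfloor>r * 2 ^ k\<rfloor> + 1) / 2 ^ k" "(of_int \<lfloor>r * 2 ^ k\<rfloor> + 1) / 2 ^ k \<le> r + 1 / 2 ^ k" for r :: real
  by (simp_all add: field_simps) linarith

lemma ceiling_dyadic_bounds:
  "(of_int \<lceil>r * 2 ^ k\<rceil> - 1) / 2 ^ k < r" "r - 1 / 2 ^ k \<le> (of_int \<lceil>r * 2 ^ k\<rceil> - 1) / 2 ^ k" for r :: real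
  by (simp_all add: field_simps) linarith+

lemma tendsto_dyadic_0: "(\<lambda>k. 1 / 2 ^ k :: real) \<longlonglongrightarrow> 0"
  using LIMSEQ_power_zero[of "1/2 :: real"] by (simp add: power_one_over)

text \<open>The \<open>+ 1\<close> after the floor keeps the grid point strictly to the right of
  \<open>r\<close> even if \<open>r\<close> is dyadic, as \<open>at_right\<close> demands; the
  \<open>- 1\<close> after the ceiling does the same on the left.\<close>

lemma filterlim_floor_dyadic:
  "filterlim (\<lambda>k. (of_int \<lfloor>r * 2 ^ k\<rfloor> + 1) / 2 ^ k) (at_right r) sequentially" (is "filterlim ?g _ _")
  for r :: real
proof -
  have *: "r < ?g k \<and> ?g k \<noteq> r \<and> ?g k \<le> r + 1 / 2 ^ k" for k
    using floor_dyadic_bounds[of r k] by simp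
  have "?g \<longlonglongrightarrow> r"
  proof (rule tendsto_sandwich[where f="\<lambda>_. r"])
    show "(\<lambda>k. r + 1 / 2 ^ k) \<longlonglongrightarrow> r"
      using tendsto_add[OF tendsto_const[of r] tendsto_dyadic_0] by simp
  qed (use * in \<open>simp_all add: less_imp_le\<close>)
  with * show ?thesis
    by (simp add: filterlim_at)
qed

lemma filterlim_ceiling_dyadic:
  "filterlim (\<lambda>k. (of_int \<lceil>r * 2 ^ k\<rceil> - 1) / 2 ^ k) (at_left r) sequentially" (is "filterlim ?g _ _")
  for r :: real
proof -
  have *: "?g k < r \<and> ?g k \<noteq> r \<and> r - 1 / 2 ^ k \<le> ?g k" for k
    using ceiling_dyadic_bounds[of r k] by simp
  have "?g \<longlonglongrightarrow> r"
  proof (rule tendsto_sandwich[where h="\<lambda>_. r"])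
    show "(\<lambda>k. r - 1 / 2 ^ k) \<longlonglongrightarrow> r"
      using tendsto_diff[OF tendsto_const[of r] tendsto_dyadic_0] by simp
  qed (use * in \<open>simp_all add: less_imp_le\<close>)
  with * show ?thesis
    by (simp add: filterlim_at)
qed

lemma cadlag_tendsto_right: "cadlag w \<Longrightarrow> 0 \<le> r \<Longrightarrow> (w \<longlongrightarrow> w r) (at_right r)"
  unfolding cadlag_def by (simp add: continuous_within)

lemma cadlag_rval: "cadlag w \<Longrightarrow> 0 \<le> r \<Longrightarrow> rval r w = w r"
  unfolding rval_def
  by (rule limI) (rule filterlim_compose[OF cadlag_tendsto_right filterlim_floor_dyadic])

lemma cadlag_tendsto_lval: "cadlag w \<Longrightarrow> 0 < r \<Longrightarrow> (w \<longlongrightarrow> lval r w) (at_left r)"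
proof -
  assume w: "cadlag w" and "0 < r"
  then obtain l where l: "(w \<longlongrightarrow> l) (at_left r)" unfolding cadlag_def by auto
  then have "lval r w = l"
    unfolding lval_def by (intro limI filterlim_compose[OF l filterlim_ceiling_dyadic])
  then show ?thesis using l by simp
qed

lemma cadlag_post: "cadlag w \<Longrightarrow> 0 \<le> t \<Longrightarrow> cadlag (post t w)"
  unfolding cadlag_def
proof (intro conjI allI impI)
  assume w: "(\<forall>t\<ge>0. continuous (at_right t) w) \<and> (\<forall>t>0. \<exists>l. (w \<longlongrightarrow> l) (at_left t))" and t: "0 \<le> t"
  fix s :: real
  have lim: "((\<lambda>s. t + max 0 s) \<longlongrightarrow> t + s) (at s within A)" if "0 \<le> s" for A
  proof -
    have "continuous (at s within A) (\<lambda>s. t + max 0 s)" by (intro continuous_intros)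
    then show ?thesis using that by (simp add: continuous_within)
  qed
  have sh: "filterlim (\<lambda>s. t + max 0 s) (at_right (t + s)) (at_right s)" if "0 \<le> s"
    unfolding filterlim_at using that lim by (auto simp: eventually_at_filter)
  have shl: "filterlim (\<lambda>s. t + max 0 s) (at_left (t + s)) (at_left s)" if "0 < s"
    unfolding filterlim_at using that lim by (auto simp: eventually_at_filter max_def)
  show "continuous (at_right s) (post t w)" if "0 \<le> s"
  proof -
    have "(w \<longlongrightarrow> w (t + s)) (at_right (t + s))"
      using w t that by (simp add: continuous_within)
    from tendsto_diff[OF filterlim_compose[OF this sh[OF that]] tendsto_const[of "w t"]]
    show ?thesis using that by (simp add: continuous_within post_def)
  qed
  show "\<exists>l. (post t w \<longlongrightarrow> l) (at_left s)" if s: "0 < s"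
  proof -
    obtain l where "(w \<longlongrightarrow> l) (at_left (t + s))"
      using w add_nonneg_pos[OF t s] by blast
    from tendsto_diff[OF filterlim_compose[OF this shl[OF s]] tendsto_const[of "w t"]]
    show ?thesis unfolding post_def by blast
  qed
qed

section \<open>Path laws determined by cylinders\<close>

lemma cylinder_in_sets: "finite J \<Longrightarrow> {w. \<forall>j\<in>J. w j < (b j :: real)} \<in> sets paths"
proof -
  assume "finite J"
  then have "{w \<in> space paths. \<forall>j\<in>J. w j < b j} \<in> sets paths"
    by measurable
  then show ?thesis by (simp add: space_PiM)
qed

text \<open>Finite-dimensional lower orthants form a \<pi>-system generating the product
  \<sigma>-algebra. Strict inequalities make them open for pointwise convergence, which the strong
  Markov property exploits.\<close>

lemma paths_measure_eqI:
  assumes sets: "sets N1 = sets paths" "sets N2 = sets paths" and fin: "finite_measure N1"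
    and eq: "\<And>J b. finite J \<Longrightarrow>
      emeasure N1 {w. \<forall>j\<in>J. w j < (b j :: real)} = emeasure N2 {w. \<forall>j\<in>J. w j < b j}"
  shows "N1 = N2"
proof (rule measure_eqI_generator_eq)
  let ?E = "{{w :: real \<Rightarrow> real. \<forall>j\<in>J. w j < b j} | J b. finite J}"
  show "Int_stable ?E"
  proof (rule Int_stableI, elim CollectE exE conjE)
    fix A B and J J' :: "real set" and b b' :: "real \<Rightarrow> real"
    assume *: "A = {w. \<forall>j\<in>J. w j < b j}" "B = {w. \<forall>j\<in>J'. w j < b' j}" "finite J" "finite J'"
    \<comment> \<open>On common coordinates the sharper of the two bounds is taken.\<close>
    let ?b = "\<lambda>j. if j \<in> J then if j \<in> J' then min (b j) (b' j) else b j else b' j"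
    have "A \<inter> B = {w. \<forall>j\<in>J \<union> J'. w j < ?b j}"
      unfolding * by (auto split: if_splits)
    moreover have "finite (J \<union> J')" using * by simp
    ultimately show "A \<inter> B \<in> ?E" by (intro CollectI exI[of _ "J \<union> J'"] exI[of _ ?b]) simp
  qed
  show "?E \<subseteq> Pow UNIV" by simp
  show "emeasure N1 A = emeasure N2 A" if "A \<in> ?E" for A
    using that eq by auto
  have "sigma_sets UNIV ?E = sets paths"
  proof (rule antisym)
    have "?E \<subseteq> sets paths" by (auto intro: cylinder_in_sets)
    then show "sigma_sets UNIV ?E \<subseteq> sets paths"
      using sets.sigma_sets_subset[of ?E paths] by (simp add: space_PiM)
    have "(\<lambda>w. w) \<in> sigma UNIV ?E \<rightarrow>\<^sub>M paths"
    proof (rule measurable_pathsI, rule borel_measurableI_less)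
      fix t a :: real
      have "{w. w t < a} \<in> ?E" by (intro CollectI exI[of _ "{t}"] exI[of _ "\<lambda>_. a"]) auto
      then show "{w \<in> space (sigma UNIV ?E). w t < a} \<in> sets (sigma UNIV ?E)"
        by (simp add: sigma_sets.Basic)
    qed
    then have "(\<lambda>w. w) -` A \<inter> space (sigma UNIV ?E) \<in> sets (sigma UNIV ?E)" if "A \<in> sets paths" for A
      using that by (rule measurable_sets)
    then show "sets paths \<subseteq> sigma_sets UNIV ?E"
      by (auto simp: space_measure_of_conv)
  qed
  then show "sets N1 = sigma_sets UNIV ?E" "sets N2 = sigma_sets UNIV ?E"
    by (simp_all add: sets)
  show "range (\<lambda>_::nat. UNIV) \<subseteq> ?E" by (auto intro!: exI[of _ "{}"])
  show "emeasure N1 UNIV \<noteq> \<infinity>"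
    using fin finite_measure.emeasure_finite[of N1 UNIV] by simp
qed simp

text \<open>The law of \<open>V\<close> restricted to \<open>E\<close> and the law of
  \<open>V'\<close> scaled by the probability of \<open>E\<close> are finite measures that agree on
  cylinders. This lifts independence and equality in law from cylinders to all path events.\<close>

lemma (in prob_space) indep_paths_eqI:
  assumes E [measurable]: "E \<in> events" and V [measurable]: "V \<in> M \<rightarrow>\<^sub>M paths" "V' \<in> M \<rightarrow>\<^sub>M paths"
    and eq: "\<And>J b. finite J \<Longrightarrow> prob (E \<inter> {\<omega>\<in>space M. \<forall>j\<in>J. V \<omega> j < b j}) =
      prob E * prob {\<omega>\<in>space M. \<forall>j\<in>J. V' \<omega> j < (b j :: real)}"
    and D [measurable]: "D \<in> sets paths"
  shows "prob (E \<inter> {\<omega>\<in>space M. V \<omega> \<in> D}) = prob E * prob {\<omega>\<in>space M. V' \<omega> \<in> D}"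
proof -
  let ?N1 = "distr (density M (indicator E)) paths V"
  let ?N2 = "scale_measure (emeasure M E) (distr M paths V')"
  have em1: "emeasure ?N1 D = ennreal (prob (E \<inter> {\<omega>\<in>space M. V \<omega> \<in> D}))" if [measurable]: "D \<in> sets paths" for D
  proof -
    have "emeasure ?N1 D = emeasure (density M (indicator E)) (V -` D \<inter> space M)"
      by (subst emeasure_distr) auto
    also have "\<dots> = emeasure M (E \<inter> (V -` D \<inter> space M))"
      by (rule emeasure_restricted) auto
    finally show ?thesis
      by (simp add: emeasure_eq_measure vimage_def Int_def conj_commute)
  qed
  have em2: "emeasure ?N2 D = ennreal (prob E * prob {\<omega>\<in>space M. V' \<omega> \<in> D})" if [measurable]: "D \<in> sets paths" for D
  proof -
    have "emeasure ?N2 D = emeasure M E * emeasure M (V' -` D \<inter> space M)"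
      by (simp add: emeasure_distr)
    then show ?thesis
      by (simp add: emeasure_eq_measure vimage_def Int_def conj_commute ennreal_mult'')
  qed
  have "?N1 = ?N2"
  proof (rule paths_measure_eqI)
    show "finite_measure ?N1"
    proof
      have "emeasure ?N1 (space ?N1) = ennreal (prob (E \<inter> {\<omega>\<in>space M. V \<omega> \<in> space paths}))"
        by (subst em1[symmetric]) auto
      then show "emeasure ?N1 (space ?N1) \<noteq> \<infinity>" by simp
    qed
    show "emeasure ?N1 {w. \<forall>j\<in>J. w j < b j} = emeasure ?N2 {w. \<forall>j\<in>J. w j < b j}" if "finite J" for J b
      unfolding em1[OF cylinder_in_sets[OF that]] em2[OF cylinder_in_sets[OF that]] using eq[OF that, of b] by simp
  qed simp_all
  then have "emeasure ?N1 D = emeasure ?N2 D" by (rule arg_cong)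
  then show ?thesis unfolding em1[OF D] em2[OF D] by simp
qed

section \<open>The Markov property\<close>

text \<open>The definition of a Levy process speaks of infinite nondecreasing sequences of times; a
  finite set is listed in order and its last element repeated, which adds only zero
  increments.\<close>

lemma finite_set_as_range_incseq:
  fixes S :: "real set"
  assumes "finite S" "S \<noteq> {}"
  obtains \<sigma> :: "nat \<Rightarrow> real" where "incseq \<sigma>" "range \<sigma> = S"
proof
  let ?xs = "sorted_list_of_set S" and ?n = "card S - 1"
  have len: "length ?xs = card S" and pos: "card S > 0" using assms by (auto simp: card_gt_0_iff)
  show "incseq (\<lambda>i. ?xs ! min i ?n)"
    using pos by (intro incseq_SucI sorted_nth_mono) (auto simp: len)
  show "range (\<lambda>i. ?xs ! min i ?n) = S"
  proof (rule antisym)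
    show "range (\<lambda>i. ?xs ! min i ?n) \<subseteq> S"
    proof clarify
      fix i
      have "?xs ! min i ?n \<in> set ?xs" using pos by (intro nth_mem) (auto simp: len min_def)
      then show "?xs ! min i ?n \<in> S" using assms by simp
    qed
    show "S \<subseteq> range (\<lambda>i. ?xs ! min i ?n)"
    proof
      fix s assume "s \<in> S"
      then obtain i where "i < card S" "?xs ! i = s"
        using assms(1) by (metis in_set_conv_nth len set_sorted_list_of_set)
      then show "s \<in> range (\<lambda>i. ?xs ! min i ?n)"
        by (intro range_eqI[of _ _ i]) (simp add: min_absorb1)
    qed
  qed
qed

locale levy =
  fixes M :: "'a measure" and X :: "real \<Rightarrow> 'a \<Rightarrow> real"
  assumes levy: "levy_process M X"
begin

sublocale prob_space M
  using levy by (simp add: levy_process_def)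

lemma measurable_X [measurable]: "0 \<le> t \<Longrightarrow> X t \<in> borel_measurable M"
  using levy by (simp add: levy_process_def)

text \<open>Subtracting \<open>X 0\<close> makes the start 0 for every \<open>\<omega>\<close>, not
  just almost surely, so that pathwise lemmas apply on all of \<open>space M\<close>.\<close>

definition path :: "'a \<Rightarrow> real \<Rightarrow> real" where
  "path \<omega> = (\<lambda>t. X (max 0 t) \<omega> - X 0 \<omega>)"

lemma measurable_path [measurable]: "path \<in> M \<rightarrow>\<^sub>M paths"
  unfolding path_def by (rule measurable_pathsI) measurable

lemma path_0 [simp]: "path \<omega> 0 = 0"
  by (simp add: path_def)

lemma cadlag_path: "\<omega> \<in> space M \<Longrightarrow> cadlag (path \<omega>)"
proof -
  assume "\<omega> \<in> space M"
  then have "cadlag (\<lambda>t. X t \<omega>)" using levy by (simp add: levy_process_def)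
  from cadlag_post[OF this, of 0] show ?thesis by (simp add: post_def path_def)
qed

lemma AE_X_0: "AE \<omega> in M. X 0 \<omega> = 0"
  using levy by (simp add: levy_process_def)

lemma AE_path: "AE \<omega> in M. \<forall>t\<ge>0. path \<omega> t = X t \<omega>"
  using AE_X_0 by eventually_elim (simp add: path_def)

definition increment :: "(nat \<Rightarrow> real) \<Rightarrow> nat \<Rightarrow> 'a \<Rightarrow> real" where
  "increment \<sigma> i \<omega> = X (\<sigma> (Suc i)) \<omega> - X (\<sigma> i) \<omega>"

lemma indep_increments:
  "0 \<le> \<sigma> 0 \<Longrightarrow> incseq \<sigma> \<Longrightarrow> indep_vars (\<lambda>_. borel) (increment \<sigma>) UNIV"
  using levy unfolding levy_process_def increment_def by auto

lemma incseq_nonneg: "0 \<le> \<sigma> 0 \<Longrightarrow> incseq \<sigma> \<Longrightarrow> 0 \<le> (\<sigma> i :: real)"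
  using incseqD[of \<sigma> 0 i] by simp

text \<open>The right-hand side does not contain \<open>t\<close>: independence and stationarity of
  single increments combine into stationarity of the whole sequence of increments.\<close>

lemma distr_increments:
  assumes \<sigma>: "\<sigma> 0 = 0" "incseq \<sigma>" and t: "0 \<le> t"
  shows "distr M (PiM UNIV (\<lambda>_. borel)) (\<lambda>\<omega> i. increment (\<lambda>i. t + \<sigma> i) i \<omega>) =
    PiM UNIV (\<lambda>i. distr M borel (X (\<sigma> (Suc i) - \<sigma> i)))"
proof -
  have nn: "0 \<le> \<sigma> i" for i using \<sigma> by (simp add: incseq_nonneg)
  have ind: "indep_vars (\<lambda>_. borel) (increment (\<lambda>i. t + \<sigma> i)) UNIV"
    using \<sigma> t by (intro indep_increments) (auto simp: incseq_def)
  have rv: "random_variable borel (increment (\<lambda>i. t + \<sigma> i) i)" for i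
    unfolding increment_def using nn t by (intro borel_measurable_diff measurable_X) auto
  from indep_vars_iff_distr_eq_PiM[where X="increment (\<lambda>i. t + \<sigma> i)" and M'="\<lambda>_. borel" and I=UNIV, OF _ rv] ind
  have "distr M (PiM UNIV (\<lambda>_. borel)) (\<lambda>\<omega> i. increment (\<lambda>i. t + \<sigma> i) i \<omega>) =
    PiM UNIV (\<lambda>i. distr M borel (increment (\<lambda>i. t + \<sigma> i) i))"
    by (simp add: restrict_def)
  moreover have "distr M borel (increment (\<lambda>i. t + \<sigma> i) i) = distr M borel (X (\<sigma> (Suc i) - \<sigma> i))" for i
  proof -
    have "\<forall>s\<ge>0. \<forall>u\<ge>0. distr M borel (\<lambda>\<omega>. X (s + u) \<omega> - X s \<omega>) = distr M borel (X u)"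
      using levy by (simp add: levy_process_def)
    from this[rule_format, of "t + \<sigma> i" "\<sigma> (Suc i) - \<sigma> i"] show ?thesis
      using t nn[of i] incseq_SucD[OF \<sigma>(2), of i] unfolding increment_def by simp
  qed
  ultimately show ?thesis by simp
qed

lemma sum_increment: "k \<le> m \<Longrightarrow> (\<Sum>i\<in>{k..<m}. increment \<sigma> i \<omega>) = X (\<sigma> m) \<omega> - X (\<sigma> k) \<omega>"
  unfolding increment_def by (rule sum_Suc_diff'[of k m "\<lambda>i. X (\<sigma> i) \<omega>"])

lemma post_path: "0 \<le> t \<Longrightarrow> post t (path \<omega>) s = X (t + max 0 s) \<omega> - X t \<omega>"
  by (simp add: post_def path_def)

lemma prob_post_cylinder:
  assumes K: "finite K" and t: "0 \<le> t"
  shows "prob {\<omega>\<in>space M. \<forall>k\<in>K. post t (path \<omega>) k < c k} = prob {\<omega>\<in>space M. \<forall>k\<in>K. path \<omega> k < c k}"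
proof -
  obtain \<sigma> where \<sigma>: "incseq \<sigma>" "range \<sigma> = insert 0 (max 0 ` K)"
    using finite_set_as_range_incseq[of "insert 0 (max 0 ` K)"] K by auto
  have nn: "0 \<le> \<sigma> i" for i using \<sigma>(2) by (metis (no_types) imageE insertE max.cobounded1 order_refl rangeI)
  obtain i0 where "\<sigma> i0 = 0" using \<sigma>(2) by (metis imageE insertI1)
  then have \<sigma>0: "\<sigma> 0 = 0" using incseqD[OF \<sigma>(1), of 0 i0] nn[of 0] by simp
  have "\<forall>k\<in>K. \<exists>m. \<sigma> m = max 0 k" using \<sigma>(2) by (metis image_eqI imageE insertI2)
  then obtain m where m: "\<And>k. k \<in> K \<Longrightarrow> \<sigma> (m k) = max 0 k" by metis
  define C where "C = {v \<in> space (PiM UNIV (\<lambda>_::nat. borel)). \<forall>k\<in>K. (\<Sum>i\<in>{0..<m k}. v i) < c k}"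
  have [measurable]: "C \<in> sets (PiM UNIV (\<lambda>_. borel))"
    unfolding C_def using K by measurable
  \<comment> \<open>Stated for every start time, shadowing the given \<open>t\<close>: the
    right-hand side is the same for \<open>t\<close> and for 0, and comparing the two cases proves
    the lemma.\<close>
  have *: "prob {\<omega>\<in>space M. \<forall>k\<in>K. post t (path \<omega>) k < c k} =
     measure (PiM UNIV (\<lambda>i. distr M borel (X (\<sigma> (Suc i) - \<sigma> i)))) C" if t: "0 \<le> t" for t
  proof -
    have [measurable]: "increment (\<lambda>i. t + \<sigma> i) i \<in> borel_measurable M" for i
      unfolding increment_def using nn t by (intro borel_measurable_diff measurable_X) auto
    have "(\<Sum>i\<in>{0..<m k}. increment (\<lambda>i. t + \<sigma> i) i \<omega>) = post t (path \<omega>) k" if "k \<in> K" for k \<omega>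
      using t m[OF that] by (simp add: sum_increment \<sigma>0 post_path)
    then have "{\<omega>\<in>space M. \<forall>k\<in>K. post t (path \<omega>) k < c k} =
        (\<lambda>\<omega> i. increment (\<lambda>i. t + \<sigma> i) i \<omega>) -` C \<inter> space M"
      unfolding C_def by (auto simp: space_PiM)
    also have "prob \<dots> = measure (distr M (PiM UNIV (\<lambda>_. borel)) (\<lambda>\<omega> i. increment (\<lambda>i. t + \<sigma> i) i \<omega>)) C"
      by (rule measure_distr[symmetric]) (auto intro!: measurable_PiM_single')
    also note distr_increments[OF \<sigma>0 \<sigma>(1) t]
    finally show ?thesis .
  qed
  have "post 0 (path \<omega>) k = path \<omega> k" for \<omega> k by (simp add: post_def path_def)
  with *[OF t] *[of 0] show ?thesis by simp
qed

text \<open>One nondecreasing grid \<open>\<sigma>\<close> runs through all relevant times, with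
  \<open>t\<close> at position \<open>p\<close>. The stopped path is made of increments with index
  below \<open>p\<close>, the shifted path of the others, and these two groups are
  independent.\<close>

lemma prob_stopped_post_cylinder:
  assumes J: "finite J" and K: "finite K" and t: "0 \<le> t"
  shows "prob {\<omega>\<in>space M. (\<forall>j\<in>J. stopped t (path \<omega>) j < b j) \<and> (\<forall>k\<in>K. post t (path \<omega>) k < c k)} =
    prob {\<omega>\<in>space M. \<forall>j\<in>J. stopped t (path \<omega>) j < b j} * prob {\<omega>\<in>space M. \<forall>k\<in>K. post t (path \<omega>) k < c k}"
proof -
  let ?j = "\<lambda>j. min (max 0 j) t" and ?k = "\<lambda>k. t + max 0 k"
  define S where "S = {0, t} \<union> ?j ` J \<union> ?k ` K"
  obtain \<sigma> where \<sigma>: "incseq \<sigma>" "range \<sigma> = S"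
    using finite_set_as_range_incseq[of S] J K by (auto simp: S_def)
  have nn: "0 \<le> \<sigma> i" for i
  proof -
    have "\<sigma> i \<in> S" using \<sigma>(2) by auto
    then show ?thesis using t by (auto simp: S_def)
  qed
  have ex: "\<exists>i. \<sigma> i = s" if "s \<in> S" for s using \<sigma>(2) that by (metis imageE)
  obtain i0 where "\<sigma> i0 = 0" using ex[of 0] by (auto simp: S_def)
  then have \<sigma>0: "\<sigma> 0 = 0" using incseqD[OF \<sigma>(1), of 0 i0] nn[of 0] by simp
  obtain p where p: "\<sigma> p = t" using ex[of t] by (auto simp: S_def)
  \<comment> \<open>Repetitions in \<open>\<sigma>\<close> may put the index found beyond
    \<open>p\<close>; the time is then \<open>t\<close>, and \<open>p\<close> serves
    instead.\<close>
  have "\<exists>m\<le>p. \<sigma> m = ?j j" if j: "j \<in> J" for j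
  proof -
    obtain i where i: "\<sigma> i = ?j j" using ex[of "?j j"] j by (auto simp: S_def)
    show ?thesis
    proof (cases "i \<le> p")
      case False
      then have "t \<le> \<sigma> i" using incseqD[OF \<sigma>(1), of p i] p by simp
      then show ?thesis using i p by (intro exI[of _ p]) auto
    qed (use i in auto)
  qed
  then obtain m where m: "\<And>j. j \<in> J \<Longrightarrow> m j \<le> p" "\<And>j. j \<in> J \<Longrightarrow> \<sigma> (m j) = ?j j" by metis
  have "\<exists>n\<ge>p. \<sigma> n = ?k k" if k: "k \<in> K" for k
  proof -
    obtain i where i: "\<sigma> i = ?k k" using ex[of "?k k"] k by (auto simp: S_def)
    show ?thesis
    proof (cases "p \<le> i")
      case False
      then have "\<sigma> i \<le> t" using incseqD[OF \<sigma>(1), of i p] p by simp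
      then show ?thesis using i p by (intro exI[of _ p]) auto
    qed (use i in auto)
  qed
  then obtain n where n: "\<And>k. k \<in> K \<Longrightarrow> p \<le> n k" "\<And>k. k \<in> K \<Longrightarrow> \<sigma> (n k) = ?k k" by metis
  define A where "A = {v \<in> space (PiM {..<p} (\<lambda>_. borel)). \<forall>j\<in>J. (\<Sum>i\<in>{0..<m j}. v i) < b j}"
  define C where "C = {v \<in> space (PiM {p..} (\<lambda>_. borel)). \<forall>k\<in>K. (\<Sum>i\<in>{p..<n k}. v i) < c k}"
  have sumJ: "(\<lambda>v. \<Sum>i\<in>{0..<m j}. v i :: real) \<in> borel_measurable (PiM {..<p} (\<lambda>_. borel))" if "j \<in> J" for j
    using m(1)[OF that] by (intro borel_measurable_sum measurable_component_singleton) auto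
  have A: "A \<in> sets (PiM {..<p} (\<lambda>_. borel))"
    unfolding A_def using J sumJ by (intro sets.sets_Collect_finite_All borel_measurable_less) auto
  have sumK: "(\<lambda>v. \<Sum>i\<in>{p..<n k}. v i :: real) \<in> borel_measurable (PiM {p..} (\<lambda>_. borel))" if "k \<in> K" for k
    by (intro borel_measurable_sum measurable_component_singleton) auto
  have C: "C \<in> sets (PiM {p..} (\<lambda>_. borel))"
    unfolding C_def using K sumK by (intro sets.sets_Collect_finite_All borel_measurable_less) auto
  let ?A = "\<lambda>\<omega>. \<lambda>i\<in>{..<p}. increment \<sigma> i \<omega>" and ?C = "\<lambda>\<omega>. \<lambda>i\<in>{p..}. increment \<sigma> i \<omega>"
  have "indep_var (PiM {..<p} (\<lambda>_. borel)) ?A (PiM {p..} (\<lambda>_. borel)) ?C"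
    by (rule indep_var_restrict[OF indep_increments]) (auto simp: \<sigma>0 \<sigma>(1))
  from indep_varD[OF this A C]
  have eq: "prob ((\<lambda>x. (?A x, ?C x)) -` (A \<times> C) \<inter> space M) =
      prob (?A -` A \<inter> space M) * prob (?C -` C \<inter> space M)" .
  have "(\<Sum>i\<in>{0..<m j}. ?A \<omega> i) = stopped t (path \<omega>) j" if j: "j \<in> J" for j \<omega>
  proof -
    have "(\<Sum>i\<in>{0..<m j}. ?A \<omega> i) = (\<Sum>i\<in>{0..<m j}. increment \<sigma> i \<omega>)"
      using m(1)[OF j] by (intro sum.cong) auto
    then show ?thesis
      using t m(2)[OF j] by (simp add: sum_increment \<sigma>0 stopped_def path_def)
  qed
  then have A': "?A \<omega> \<in> A \<longleftrightarrow> (\<forall>j\<in>J. stopped t (path \<omega>) j < b j)" for \<omega>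
    unfolding A_def by (simp add: space_PiM)
  have "(\<Sum>i\<in>{p..<n k}. ?C \<omega> i) = post t (path \<omega>) k" if k: "k \<in> K" for k \<omega>
  proof -
    have "(\<Sum>i\<in>{p..<n k}. ?C \<omega> i) = (\<Sum>i\<in>{p..<n k}. increment \<sigma> i \<omega>)"
      by (intro sum.cong) auto
    then show ?thesis
      using t n[OF k] by (simp add: sum_increment p post_path)
  qed
  then have C': "?C \<omega> \<in> C \<longleftrightarrow> (\<forall>k\<in>K. post t (path \<omega>) k < c k)" for \<omega>
    unfolding C_def by (simp add: space_PiM)
  have "{\<omega>\<in>space M. ?A \<omega> \<in> A \<and> ?C \<omega> \<in> C} = (\<lambda>x. (?A x, ?C x)) -` (A \<times> C) \<inter> space M"
    "{\<omega>\<in>space M. ?A \<omega> \<in> A} = ?A -` A \<inter> space M" "{\<omega>\<in>space M. ?C \<omega> \<in> C} = ?C -` C \<inter> space M"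
    by auto
  then show ?thesis using eq unfolding A'[symmetric] C'[symmetric] by simp
qed

lemma prob_post:
  assumes D: "D \<in> sets paths" and t: "0 \<le> t"
  shows "prob {\<omega>\<in>space M. post t (path \<omega>) \<in> D} = prob {\<omega>\<in>space M. path \<omega> \<in> D}"
proof -
  have "prob (space M \<inter> {\<omega>\<in>space M. post t (path \<omega>) \<in> D}) = prob (space M) * prob {\<omega>\<in>space M. path \<omega> \<in> D}"
  proof (rule indep_paths_eqI[OF _ _ _ _ D])
    show "prob (space M \<inter> {\<omega>\<in>space M. \<forall>j\<in>J. post t (path \<omega>) j < b j}) =
      prob (space M) * prob {\<omega>\<in>space M. \<forall>j\<in>J. path \<omega> j < b j}" if "finite J" for J b
      using prob_post_cylinder[OF that t, of b] by (simp add: prob_space Int_def conj_commute)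
  qed simp_all
  then show ?thesis by (simp add: prob_space Int_def)
qed

text \<open>Cylinders are extended to general events one side at a time: first for the shifted path
  with a stopped cylinder fixed, then with the roles exchanged.\<close>

lemma prob_stopped_post:
  assumes C [measurable]: "C \<in> sets paths" and D [measurable]: "D \<in> sets paths" and t: "0 \<le> t"
  shows "prob {\<omega>\<in>space M. stopped t (path \<omega>) \<in> C \<and> post t (path \<omega>) \<in> D} =
    prob {\<omega>\<in>space M. stopped t (path \<omega>) \<in> C} * prob {\<omega>\<in>space M. path \<omega> \<in> D}"
proof -
  have cyl: "prob ({\<omega>\<in>space M. \<forall>j\<in>J. stopped t (path \<omega>) j < b j} \<inter> {\<omega>\<in>space M. post t (path \<omega>) \<in> D}) =
     prob {\<omega>\<in>space M. \<forall>j\<in>J. stopped t (path \<omega>) j < b j} * prob {\<omega>\<in>space M. post t (path \<omega>) \<in> D}"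
    if J: "finite J" and [measurable]: "D \<in> sets paths" for J b D
  proof (rule indep_paths_eqI)
    show "{\<omega>\<in>space M. \<forall>j\<in>J. stopped t (path \<omega>) j < b j} \<in> events"
      using J by measurable
    show "prob ({\<omega>\<in>space M. \<forall>j\<in>J. stopped t (path \<omega>) j < b j} \<inter> {\<omega>\<in>space M. \<forall>k\<in>K. post t (path \<omega>) k < c k}) =
       prob {\<omega>\<in>space M. \<forall>j\<in>J. stopped t (path \<omega>) j < b j} * prob {\<omega>\<in>space M. \<forall>k\<in>K. post t (path \<omega>) k < c k}"
      if "finite K" for K c
    proof -
      have "{\<omega>\<in>space M. \<forall>j\<in>J. stopped t (path \<omega>) j < b j} \<inter> {\<omega>\<in>space M. \<forall>k\<in>K. post t (path \<omega>) k < c k} =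
          {\<omega>\<in>space M. (\<forall>j\<in>J. stopped t (path \<omega>) j < b j) \<and> (\<forall>k\<in>K. post t (path \<omega>) k < c k)}"
        by auto
      then show ?thesis using prob_stopped_post_cylinder[OF J that t, of b c] by simp
    qed
  qed simp_all
  have "prob ({\<omega>\<in>space M. post t (path \<omega>) \<in> D} \<inter> {\<omega>\<in>space M. stopped t (path \<omega>) \<in> C}) =
    prob {\<omega>\<in>space M. post t (path \<omega>) \<in> D} * prob {\<omega>\<in>space M. stopped t (path \<omega>) \<in> C}"
  proof (rule indep_paths_eqI)
    show "prob ({\<omega>\<in>space M. post t (path \<omega>) \<in> D} \<inter> {\<omega>\<in>space M. \<forall>j\<in>J. stopped t (path \<omega>) j < b j}) =
       prob {\<omega>\<in>space M. post t (path \<omega>) \<in> D} * prob {\<omega>\<in>space M. \<forall>j\<in>J. stopped t (path \<omega>) j < b j}"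
      if "finite J" for J b
      using cyl[OF that D, of b] by (simp add: Int_commute mult.commute)
  qed simp_all
  moreover have "{\<omega>\<in>space M. stopped t (path \<omega>) \<in> C \<and> post t (path \<omega>) \<in> D} =
    {\<omega>\<in>space M. post t (path \<omega>) \<in> D} \<inter> {\<omega>\<in>space M. stopped t (path \<omega>) \<in> C}" by auto
  ultimately show ?thesis using prob_post[OF D t] by (simp add: mult.commute)
qed

end

text \<open>Fatou's lemma for events: \<open>B\<close> lies in the increasing union of the tail
  intersections of the \<open>A k\<close>, each of probability at most \<open>c\<close>.\<close>

lemma (in prob_space) prob_eventually_le:
  assumes A: "\<And>k::nat. A k \<in> events" and B: "B \<in> events"
    and ev: "\<And>\<omega>. \<omega> \<in> B \<Longrightarrow> \<forall>\<^sub>F k in sequentially. \<omega> \<in> A k"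
    and le: "\<And>k. prob (A k) \<le> c"
  shows "prob B \<le> c"
proof -
  let ?I = "\<lambda>n. \<Inter>k\<in>{n..}. A k"
  have I: "?I n \<in> events" for n using A by (intro sets.countable_INT') auto
  have inc: "incseq ?I" by (force simp: incseq_def)
  have "B \<subseteq> (\<Union>n. ?I n)" using ev by (fastforce simp: eventually_sequentially)
  then have "prob B \<le> prob (\<Union>n. ?I n)" using I by (intro finite_measure_mono) auto
  also have "\<dots> \<le> c"
  proof (rule LIMSEQ_le_const2)
    show "(\<lambda>n. prob (?I n)) \<longlonglongrightarrow> prob (\<Union>n. ?I n)"
      using I inc by (intro finite_Lim_measure_incseq) auto
    have "prob (?I n) \<le> prob (A n)" for n using A by (intro finite_measure_mono) auto
    then show "\<exists>N. \<forall>n\<ge>N. prob (?I n) \<le> c" using le order_trans by blast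
  qed
  finally show ?thesis .
qed

context levy
begin

text \<open>\<open>T\<close> need only be an optional time: adaptedness is required of the events \<open>T < t\<close>. The Markov
  property at the dyadic times decreasing to \<open>T\<close> passes to the limit by right-continuity.\<close>

lemma strong_markov_event:
  fixes T :: "(real \<Rightarrow> real) \<Rightarrow> ennreal" and Z :: "(real \<Rightarrow> real) \<Rightarrow> real"
  assumes T [measurable]: "T \<in> borel_measurable paths" and Z [measurable]: "Z \<in> borel_measurable paths"
    and adapted: "\<And>t w. 0 < t \<Longrightarrow> T w < ennreal t \<or> T (stopped t w) < ennreal t \<Longrightarrow>
      T (stopped t w) = T w \<and> Z (stopped t w) = Z w"
    and V [measurable]: "V \<in> M \<rightarrow>\<^sub>M paths"
    and V_eq: "\<And>\<omega>. \<omega> \<in> space M \<Longrightarrow> T (path \<omega>) < \<top> \<Longrightarrow> V \<omega> = post (enn2real (T (path \<omega>))) (path \<omega>)"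
    and B [measurable]: "B \<in> sets borel" and D: "D \<in> sets paths"
  shows "prob ({\<omega>\<in>space M. T (path \<omega>) < \<top> \<and> Z (path \<omega>) \<in> B} \<inter> {\<omega>\<in>space M. V \<omega> \<in> D}) =
    prob {\<omega>\<in>space M. T (path \<omega>) < \<top> \<and> Z (path \<omega>) \<in> B} * prob {\<omega>\<in>space M. path \<omega> \<in> D}"
proof -
  define E where "E = {\<omega>\<in>space M. T (path \<omega>) < \<top> \<and> Z (path \<omega>) \<in> B}"
  have E [measurable]: "E \<in> events" unfolding E_def by measurable
  \<comment> \<open>The least grid point strictly after \<open>T\<close>. On the event that it
    equals a fixed \<open>t\<close> one has \<open>T < t\<close>, the kind of event that adaptedness
    controls.\<close>
  define \<tau> where "\<tau> k \<omega> = (of_int \<lfloor>enn2real (T (path \<omega>)) * 2 ^ k\<rfloor> + 1) / (2::real) ^ k" for k \<omega>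
  define W where "W k \<omega> = post (\<tau> k \<omega>) (path \<omega>)" for k \<omega>
  have W [measurable]: "W k \<in> M \<rightarrow>\<^sub>M paths" for k
  proof (rule measurable_pathsI)
    fix s
    have *: "(\<lambda>\<omega>. \<lfloor>enn2real (T (path \<omega>)) * 2 ^ k\<rfloor>) \<in> M \<rightarrow>\<^sub>M count_space UNIV" by measurable
    show "(\<lambda>\<omega>. W k \<omega> s) \<in> borel_measurable M"
      unfolding W_def post_def \<tau>_def
      by (intro borel_measurable_diff
          measurable_eval_countable[OF * measurable_path, where h="\<lambda>i. (of_int i + 1) / 2 ^ k + max 0 s"]
          measurable_eval_countable[OF * measurable_path, where h="\<lambda>i. (of_int i + 1) / 2 ^ k"])
  qed
  have dyadic: "prob (E \<inter> {\<omega>\<in>space M. W k \<omega> \<in> D}) = prob E * prob {\<omega>\<in>space M. path \<omega> \<in> D}"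
    if D [measurable]: "D \<in> sets paths" for k D
  proof -
    define C where "C j = {w \<in> space paths. T w < \<top> \<and> \<lfloor>enn2real (T w) * 2 ^ k\<rfloor> = int j \<and> Z w \<in> B}" for j
    define t where "t j = (real j + 1) / 2 ^ k" for j
    have t: "0 < t j" for j by (simp add: t_def)
    have C [measurable]: "C j \<in> sets paths" for j unfolding C_def by measurable
    have lt: "T w < ennreal (t j)" if "T w < \<top>" "\<lfloor>enn2real (T w) * 2 ^ k\<rfloor> = int j" for w j
    proof -
      have "enn2real (T w) < t j"
        using floor_dyadic_bounds(1)[of "enn2real (T w)" k] that(2) by (simp add: t_def)
      then have "ennreal (enn2real (T w)) < ennreal (t j)" using t[of j] by (simp add: ennreal_less_iff)
      then show ?thesis using that(1) by simp
    qed
    \<comment> \<open>\<open>C j\<close> is decided by the path stopped at \<open>t j\<close>, so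
      the Markov property at this fixed time applies; summing over \<open>j\<close> gives it at the
      dyadic time.\<close>
    have CC: "stopped (t j) w \<in> C j \<longleftrightarrow> w \<in> C j" for w j
    proof
      assume "w \<in> C j"
      then have "T w < ennreal (t j)" using lt by (auto simp: C_def)
      with \<open>w \<in> C j\<close> adapted[OF t, of w j] show "stopped (t j) w \<in> C j" by (simp add: C_def space_PiM)
    next
      assume "stopped (t j) w \<in> C j"
      then have "T (stopped (t j) w) < ennreal (t j)" using lt by (auto simp: C_def)
      with \<open>stopped (t j) w \<in> C j\<close> adapted[OF t, of w j] show "w \<in> C j" by (simp add: C_def space_PiM)
    qed
    have EC: "\<omega> \<in> E \<longleftrightarrow> (\<exists>j. path \<omega> \<in> C j)" if "\<omega> \<in> space M" for \<omega>
    proof -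
      have "\<lfloor>enn2real (T (path \<omega>)) * 2 ^ k\<rfloor> = int (nat \<lfloor>enn2real (T (path \<omega>)) * 2 ^ k\<rfloor>)" by simp
      then have "\<exists>j. \<lfloor>enn2real (T (path \<omega>)) * 2 ^ k\<rfloor> = int j" ..
      then show ?thesis using that unfolding E_def C_def space_PiM by auto
    qed
    have WC: "W k \<omega> = post (t j) (path \<omega>)" if "path \<omega> \<in> C j" for \<omega> j
      using that by (simp add: W_def \<tau>_def t_def C_def)
    have disj: "disjoint_family C" by (auto simp: disjoint_family_on_def C_def)
    define A where "A j = {\<omega>\<in>space M. stopped (t j) (path \<omega>) \<in> C j \<and> post (t j) (path \<omega>) \<in> D}" for j
    define A' where "A' j = {\<omega>\<in>space M. stopped (t j) (path \<omega>) \<in> C j}" for j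
    have [measurable]: "A j \<in> events" "A' j \<in> events" for j unfolding A_def A'_def by measurable
    have "disjoint_family A" "disjoint_family A'"
      using disj unfolding A_def A'_def CC disjoint_family_on_def by auto
    then have sums: "(\<lambda>j. prob (A j)) sums prob (\<Union>j. A j)" and sums': "(\<lambda>j. prob (A' j)) sums prob (\<Union>j. A' j)"
      by (auto intro!: finite_measure_UNION)
    have "A j = {\<omega>\<in>space M. path \<omega> \<in> C j \<and> W k \<omega> \<in> D}" for j
      unfolding A_def CC by (auto simp: WC)
    then have "(\<Union>j. A j) = E \<inter> {\<omega>\<in>space M. W k \<omega> \<in> D}"
      using sets.sets_into_space[OF E] EC by auto
    moreover have "(\<Union>j. A' j) = E"
      using sets.sets_into_space[OF E] EC unfolding A'_def CC by auto
    moreover have "prob (A j) = prob (A' j) * prob {\<omega>\<in>space M. path \<omega> \<in> D}" for j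
      unfolding A_def A'_def using t[of j] by (intro prob_stopped_post) auto
    ultimately show ?thesis
      using sums sums' sums_mult2[of "\<lambda>j. prob (A' j)" "prob E" "prob {\<omega>\<in>space M. path \<omega> \<in> D}"] sums_unique2 by auto
  qed
  have conv: "(\<lambda>k. W k \<omega> s) \<longlonglongrightarrow> V \<omega> s" if \<omega>: "\<omega> \<in> E" for \<omega> s
  proof -
    let ?T = "enn2real (T (path \<omega>))"
    have \<omega>': "\<omega> \<in> space M" "T (path \<omega>) < \<top>" using \<omega> by (auto simp: E_def)
    have \<tau>: "filterlim (\<lambda>k. \<tau> k \<omega>) (at_right ?T) sequentially"
      unfolding \<tau>_def by (rule filterlim_floor_dyadic)
    have shift: "filterlim (\<lambda>r. r + u) (at_right (?T + u)) (at_right ?T)" for u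
      by (auto simp: filterlim_at eventually_at_filter intro!: tendsto_eq_intros)
    have "(\<lambda>k. path \<omega> (\<tau> k \<omega> + u)) \<longlonglongrightarrow> path \<omega> (?T + u)" if "0 \<le> u" for u
      using filterlim_compose[OF cadlag_tendsto_right[OF cadlag_path[OF \<omega>'(1)]] filterlim_compose[OF shift \<tau>], of u] that
      by simp
    from tendsto_diff[OF this[of "max 0 s"] this[of 0]] show ?thesis
      using V_eq[OF \<omega>'] by (simp add: W_def post_def)
  qed
  \<comment> \<open>For sets open under pointwise convergence, \<open>conv\<close> and Fatou turn
    the dyadic equalities into an inequality in the limit.\<close>
  have open_le: "prob (E \<inter> {\<omega>\<in>space M. V \<omega> \<in> G}) \<le> prob E * prob {\<omega>\<in>space M. path \<omega> \<in> G}"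
    if [measurable]: "G \<in> sets paths"
      and G: "\<And>w f. w \<in> G \<Longrightarrow> (\<And>s. (\<lambda>k. f k s) \<longlonglongrightarrow> w s) \<Longrightarrow> \<forall>\<^sub>F k in sequentially. f k \<in> G" for G
  proof (rule prob_eventually_le)
    show "E \<inter> {\<omega>\<in>space M. W k \<omega> \<in> G} \<in> events" for k by measurable
    show "\<forall>\<^sub>F k in sequentially. \<omega> \<in> E \<inter> {\<omega>\<in>space M. W k \<omega> \<in> G}"
      if "\<omega> \<in> E \<inter> {\<omega>\<in>space M. V \<omega> \<in> G}" for \<omega>
      using G[of "V \<omega>" "\<lambda>k. W k \<omega>"] conv[of \<omega>] that by auto
  qed (simp_all add: dyadic)
  show ?thesis unfolding E_def[symmetric]
  proof (rule indep_paths_eqI[OF E V measurable_path _ D])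
    fix J :: "real set" and b :: "real \<Rightarrow> real" assume J: "finite J"
    define d where "d m = 1 / (real m + 1)" for m :: nat
    have d: "0 < d m" "d (Suc m) \<le> d m" for m by (simp_all add: d_def field_simps)
    have d0: "d \<longlonglongrightarrow> 0"
      unfolding d_def using LIMSEQ_inverse_real_of_nat by (simp add: field_simps)
    let ?O = "{w. \<forall>j\<in>J. w j < b j}"
    let ?K = "\<lambda>m. {w \<in> space paths. \<forall>j\<in>J. w j \<le> b j - d m}"
    let ?G = "\<lambda>m. {w \<in> space paths. \<exists>j\<in>J. b j - d m < w j}"
    have O [measurable]: "?O \<in> sets paths" by (rule cylinder_in_sets[OF J])
    have K [measurable]: "?K m \<in> sets paths" for m using J by measurable
    have G [measurable]: "?G m \<in> sets paths" for m using J by measurable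
    have "prob (E \<inter> {\<omega>\<in>space M. V \<omega> \<in> ?O}) \<le> prob E * prob {\<omega>\<in>space M. path \<omega> \<in> ?O}"
    proof (rule open_le[OF O])
      fix w :: "real \<Rightarrow> real" and f assume "w \<in> ?O" and f: "\<And>s. (\<lambda>k. f k s) \<longlonglongrightarrow> w s"
      then have "\<forall>\<^sub>F k in sequentially. \<forall>j\<in>J. f k j < b j"
        using J by (intro eventually_ball_finite ballI order_tendstoD(2)[OF f]) auto
      then show "\<forall>\<^sub>F k in sequentially. f k \<in> ?O" by simp
    qed
    \<comment> \<open>The reverse inequality for an orthant: it is exhausted by the closed orthants
      \<open>?K m\<close>, and the upper bound for the open complement \<open>?G m\<close> is a
      lower bound for \<open>?K m\<close>.\<close>
    moreover have "prob E * prob {\<omega>\<in>space M. path \<omega> \<in> ?O} \<le> prob (E \<inter> {\<omega>\<in>space M. V \<omega> \<in> ?O})"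
    proof (rule LIMSEQ_le_const2)
      have "(\<Union>m. {\<omega>\<in>space M. path \<omega> \<in> ?K m}) = {\<omega>\<in>space M. path \<omega> \<in> ?O}"
      proof (intro set_eqI iffI)
        fix \<omega> assume "\<omega> \<in> (\<Union>m. {\<omega>\<in>space M. path \<omega> \<in> ?K m})"
        then obtain m where "\<omega> \<in> space M" "\<forall>j\<in>J. path \<omega> j \<le> b j - d m" by auto
        then show "\<omega> \<in> {\<omega>\<in>space M. path \<omega> \<in> ?O}" using d(1)[of m] by force
      next
        fix \<omega> assume \<omega>: "\<omega> \<in> {\<omega>\<in>space M. path \<omega> \<in> ?O}"
        have "(\<lambda>m. b j - d m) \<longlonglongrightarrow> b j - 0" for j
          by (intro tendsto_diff tendsto_const d0)
        then have "\<forall>\<^sub>F m in sequentially. \<forall>j\<in>J. path \<omega> j < b j - d m"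
          using J \<omega> by (intro eventually_ball_finite ballI order_tendstoD(1)) auto
        then obtain m where "\<forall>j\<in>J. path \<omega> j < b j - d m"
          by (auto simp: eventually_sequentially)
        then show "\<omega> \<in> (\<Union>m. {\<omega>\<in>space M. path \<omega> \<in> ?K m})"
          using \<omega> by (auto simp: space_PiM intro!: exI[of _ m] less_imp_le)
      qed
      moreover have "incseq (\<lambda>m. {\<omega>\<in>space M. path \<omega> \<in> ?K m})"
      proof (rule incseq_SucI, safe)
        fix m \<omega> j assume "\<forall>j\<in>J. path \<omega> j \<le> b j - d m" "j \<in> J"
        then show "path \<omega> j \<le> b j - d (Suc m)" using d(2)[of m] by force
      qed
      moreover have "range (\<lambda>m. {\<omega>\<in>space M. path \<omega> \<in> ?K m}) \<subseteq> events"
      proof (rule image_subsetI)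
        show "{\<omega>\<in>space M. path \<omega> \<in> ?K m} \<in> events" for m
          using K[of m] measurable_path by measurable
      qed
      ultimately have "(\<lambda>m. prob {\<omega>\<in>space M. path \<omega> \<in> ?K m}) \<longlonglongrightarrow> prob {\<omega>\<in>space M. path \<omega> \<in> ?O}"
        using finite_Lim_measure_incseq[of "\<lambda>m. {\<omega>\<in>space M. path \<omega> \<in> ?K m}"] by presburger
      then show "(\<lambda>m. prob E * prob {\<omega>\<in>space M. path \<omega> \<in> ?K m}) \<longlonglongrightarrow> prob E * prob {\<omega>\<in>space M. path \<omega> \<in> ?O}"
        by (rule tendsto_mult_left)
      have "prob E * prob {\<omega>\<in>space M. path \<omega> \<in> ?K m} \<le> prob (E \<inter> {\<omega>\<in>space M. V \<omega> \<in> ?O})" for m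
      proof -
        have "prob (E \<inter> {\<omega>\<in>space M. V \<omega> \<in> ?G m}) \<le> prob E * prob {\<omega>\<in>space M. path \<omega> \<in> ?G m}"
        proof (rule open_le[OF G])
          fix w :: "real \<Rightarrow> real" and f assume "w \<in> ?G m" and f: "\<And>s. (\<lambda>k. f k s) \<longlonglongrightarrow> w s"
          then obtain j where j: "j \<in> J" "b j - d m < w j" by auto
          have "\<forall>\<^sub>F k in sequentially. b j - d m < f k j"
            by (rule order_tendstoD(1)[OF f j(2)])
          then show "\<forall>\<^sub>F k in sequentially. f k \<in> ?G m"
            by eventually_elim (use j in \<open>auto simp: space_PiM\<close>)
        qed
        moreover have "prob {\<omega>\<in>space M. path \<omega> \<in> ?G m} = 1 - prob {\<omega>\<in>space M. path \<omega> \<in> ?K m}"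
        proof -
          have "{\<omega>\<in>space M. path \<omega> \<in> ?G m} = space M - {\<omega>\<in>space M. path \<omega> \<in> ?K m}"
            by (force simp: space_PiM)
          then show ?thesis by (simp add: prob_compl)
        qed
        moreover have "prob (E \<inter> {\<omega>\<in>space M. V \<omega> \<in> ?K m}) = prob E - prob (E \<inter> {\<omega>\<in>space M. V \<omega> \<in> ?G m})"
        proof -
          have "E \<inter> {\<omega>\<in>space M. V \<omega> \<in> ?K m} = E - (E \<inter> {\<omega>\<in>space M. V \<omega> \<in> ?G m})"
            using sets.sets_into_space[OF E] by (force simp: space_PiM)
          then show ?thesis by (simp add: finite_measure_Diff)
        qed
        moreover have "prob (E \<inter> {\<omega>\<in>space M. V \<omega> \<in> ?K m}) \<le> prob (E \<inter> {\<omega>\<in>space M. V \<omega> \<in> ?O})"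
        proof (rule finite_measure_mono)
          have "?K m \<subseteq> ?O"
          proof safe
            fix w j assume "\<forall>j\<in>J. w j \<le> b j - d m" "j \<in> J"
            then show "w j < b j" using d(1)[of m] by force
          qed
          then show "E \<inter> {\<omega>\<in>space M. V \<omega> \<in> ?K m} \<subseteq> E \<inter> {\<omega>\<in>space M. V \<omega> \<in> ?O}" by auto
        qed measurable
        moreover have "e * k \<le> z" if "a \<le> e * g" "g = 1 - k" "v = e - a" "v \<le> z" for a e g k v z :: real
          using that by (simp add: algebra_simps)
        ultimately show ?thesis by blast
      qed
      then show "\<exists>N. \<forall>m\<ge>N. prob E * prob {\<omega>\<in>space M. path \<omega> \<in> ?K m} \<le> prob (E \<inter> {\<omega>\<in>space M. V \<omega> \<in> ?O})"
        by blast
    qed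
    ultimately show "prob (E \<inter> {\<omega>\<in>space M. \<forall>j\<in>J. V \<omega> j < b j}) =
        prob E * prob {\<omega>\<in>space M. \<forall>j\<in>J. path \<omega> j < b j}" by simp
  qed
qed

text \<open>Rectangles determine the product law. \<open>Z\<close> stands for any quantity fixed by
  the path up to \<open>T\<close>; it will be the level before the passage.\<close>

lemma strong_markov:
  fixes T :: "(real \<Rightarrow> real) \<Rightarrow> ennreal" and Z :: "(real \<Rightarrow> real) \<Rightarrow> real"
  assumes T [measurable]: "T \<in> borel_measurable paths" and Z [measurable]: "Z \<in> borel_measurable paths"
    and adapted: "\<And>t w. 0 < t \<Longrightarrow> T w < ennreal t \<or> T (stopped t w) < ennreal t \<Longrightarrow>
      T (stopped t w) = T w \<and> Z (stopped t w) = Z w"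
    and V [measurable]: "V \<in> M \<rightarrow>\<^sub>M paths"
    and V_eq: "\<And>\<omega>. \<omega> \<in> space M \<Longrightarrow> T (path \<omega>) < \<top> \<Longrightarrow> V \<omega> = post (enn2real (T (path \<omega>))) (path \<omega>)"
    and fin: "AE \<omega> in M. T (path \<omega>) < \<top>"
  shows "distr M (borel \<Otimes>\<^sub>M paths) (\<lambda>\<omega>. (Z (path \<omega>), V \<omega>)) =
    distr M borel (\<lambda>\<omega>. Z (path \<omega>)) \<Otimes>\<^sub>M distr M paths path"
proof (rule pair_measure_eqI[symmetric])
  have [measurable]: "(\<lambda>\<omega>. Z (path \<omega>)) \<in> borel_measurable M" by measurable
  interpret A: prob_space "distr M borel (\<lambda>\<omega>. Z (path \<omega>))" by (rule prob_space_distr) measurable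
  interpret B: prob_space "distr M paths path" by (rule prob_space_distr) measurable
  show "sigma_finite_measure (distr M borel (\<lambda>\<omega>. Z (path \<omega>)))" "sigma_finite_measure (distr M paths path)"
    by (rule A.sigma_finite_measure_axioms B.sigma_finite_measure_axioms)+
  show "sets (distr M borel (\<lambda>\<omega>. Z (path \<omega>)) \<Otimes>\<^sub>M distr M paths path) =
      sets (distr M (borel \<Otimes>\<^sub>M paths) (\<lambda>\<omega>. (Z (path \<omega>), V \<omega>)))"
    by (simp cong: sets_pair_measure_cong)
  fix B D assume "B \<in> sets (distr M borel (\<lambda>\<omega>. Z (path \<omega>)))" "D \<in> sets (distr M paths path)"
  then have [measurable]: "B \<in> sets borel" "D \<in> sets paths" by auto
  have 1: "emeasure M ((\<lambda>\<omega>. (Z (path \<omega>), V \<omega>)) -` (B \<times> D) \<inter> space M) =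
    emeasure M ({\<omega>\<in>space M. T (path \<omega>) < \<top> \<and> Z (path \<omega>) \<in> B} \<inter> {\<omega>\<in>space M. V \<omega> \<in> D})"
    by (rule emeasure_eq_AE) (use fin in \<open>auto elim!: eventually_mono\<close>)
  have 2: "emeasure M ((\<lambda>\<omega>. Z (path \<omega>)) -` B \<inter> space M) =
    emeasure M {\<omega>\<in>space M. T (path \<omega>) < \<top> \<and> Z (path \<omega>) \<in> B}"
    by (rule emeasure_eq_AE) (use fin in \<open>auto elim!: eventually_mono\<close>)
  have 3: "path -` D \<inter> space M = {\<omega>\<in>space M. path \<omega> \<in> D}" by auto
  show "emeasure (distr M borel (\<lambda>\<omega>. Z (path \<omega>))) B * emeasure (distr M paths path) D =
      emeasure (distr M (borel \<Otimes>\<^sub>M paths) (\<lambda>\<omega>. (Z (path \<omega>), V \<omega>))) (B \<times> D)"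
  proof -
    have "prob ({\<omega>\<in>space M. T (path \<omega>) < \<top> \<and> Z (path \<omega>) \<in> B} \<inter> {\<omega>\<in>space M. V \<omega> \<in> D}) =
        prob {\<omega>\<in>space M. T (path \<omega>) < \<top> \<and> Z (path \<omega>) \<in> B} * prob {\<omega>\<in>space M. path \<omega> \<in> D}"
      by (rule strong_markov_event[OF T Z adapted V V_eq]) auto
    then have "emeasure M ({\<omega>\<in>space M. T (path \<omega>) < \<top> \<and> Z (path \<omega>) \<in> B} \<inter> {\<omega>\<in>space M. V \<omega> \<in> D}) =
        emeasure M {\<omega>\<in>space M. T (path \<omega>) < \<top> \<and> Z (path \<omega>) \<in> B} * emeasure M {\<omega>\<in>space M. path \<omega> \<in> D}"
      unfolding emeasure_eq_measure by (simp add: ennreal_mult'')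
    moreover have "emeasure (distr M borel (\<lambda>\<omega>. Z (path \<omega>))) B = emeasure M ((\<lambda>\<omega>. Z (path \<omega>)) -` B \<inter> space M)"
      by (rule emeasure_distr) measurable
    moreover have "emeasure (distr M paths path) D = emeasure M (path -` D \<inter> space M)"
      by (rule emeasure_distr) measurable
    moreover have "emeasure (distr M (borel \<Otimes>\<^sub>M paths) (\<lambda>\<omega>. (Z (path \<omega>), V \<omega>))) (B \<times> D) =
        emeasure M ((\<lambda>\<omega>. (Z (path \<omega>), V \<omega>)) -` (B \<times> D) \<inter> space M)"
      by (rule emeasure_distr) measurable
    ultimately show ?thesis unfolding 1 2 3 by simp
  qed
qed

end

section \<open>Passage below a level\<close>

text \<open>Rational times and a strict inequality make this jointly measurable in level and path.
  For cadlag paths right-continuity makes it the infimum over all times, see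
  \<open>hit_le\<close>.\<close>

definition hit :: "real \<Rightarrow> (real \<Rightarrow> real) \<Rightarrow> ennreal" where
  "hit y w = (INF r\<in>{r\<in>\<rat>. 0 \<le> r}. if w r < - y then ennreal r else \<top>)"

text \<open>A passage at time 0 has no left limit; the starting level is taken instead.\<close>

definition pre_level :: "real \<Rightarrow> (real \<Rightarrow> real) \<Rightarrow> real" where
  "pre_level y w = (if hit y w = 0 then y else y + lval (enn2real (hit y w)) w)"

text \<open>This is \<open>post\<close> at the passage time, with \<open>rval\<close> in place of
  evaluation for the sake of measurability; on cadlag paths the two agree
  (\<open>post_hit_eq\<close>).\<close>

definition post_hit :: "real \<Rightarrow> (real \<Rightarrow> real) \<Rightarrow> real \<Rightarrow> real" where
  "post_hit y w = (\<lambda>s. rval (enn2real (hit y w) + max 0 s) w - rval (enn2real (hit y w)) w)"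

lemma measurable_hit [measurable]:
  assumes [measurable]: "y \<in> borel_measurable N" "f \<in> N \<rightarrow>\<^sub>M paths"
  shows "(\<lambda>x. hit (y x) (f x)) \<in> borel_measurable N"
  unfolding hit_def
proof (rule borel_measurable_INF)
  have "{r\<in>\<rat>. 0 \<le> (r::real)} \<subseteq> \<rat>" by auto
  then show "countable {r\<in>\<rat>. 0 \<le> (r::real)}" using countable_rat countable_subset by blast
  fix r :: real
  have [measurable]: "(\<lambda>x. f x r) \<in> borel_measurable N"
    by (rule measurable_compose[OF assms(2) measurable_coord])
  show "(\<lambda>x. if f x r < - y x then ennreal r else \<top>) \<in> borel_measurable N" by measurable
qed

lemma measurable_pre_level [measurable]:
  assumes [measurable]: "y \<in> borel_measurable N" "f \<in> N \<rightarrow>\<^sub>M paths"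
  shows "(\<lambda>x. pre_level (y x) (f x)) \<in> borel_measurable N"
  unfolding pre_level_def by measurable

lemma measurable_post_hit [measurable]:
  assumes [measurable]: "y \<in> borel_measurable N" "f \<in> N \<rightarrow>\<^sub>M paths"
  shows "(\<lambda>x. post_hit (y x) (f x)) \<in> N \<rightarrow>\<^sub>M paths"
  unfolding post_hit_def by (rule measurable_pathsI) measurable

lemma ennreal_less_obtain:
  assumes "ennreal t < c" "0 \<le> t"
  obtains u where "t < u" "ennreal u \<le> c"
proof (cases c)
  case (real r)
  then show ?thesis using assms that[of r] by (simp add: ennreal_less_iff)
next
  case top
  then show ?thesis using that[of "t + 1"] by simp
qed

lemma hit_less_iff: "hit y w < c \<longleftrightarrow> (\<exists>r\<in>\<rat>. 0 \<le> r \<and> w r < - y \<and> ennreal r < c)"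
  unfolding hit_def INF_less_iff by (auto split: if_splits)

lemma hit_mono: "y \<le> z \<Longrightarrow> hit y w \<le> hit z w"
proof (rule ccontr)
  assume yz: "y \<le> z" and "\<not> hit y w \<le> hit z w"
  then obtain r where "r \<in> \<rat>" "0 \<le> r" "w r < - z" "ennreal r < hit y w"
    by (auto simp: not_le hit_less_iff)
  then have "hit y w < hit y w" using yz by (subst hit_less_iff) force
  then show False by simp
qed

lemma hit_stopped_less_iff:
  assumes "0 < t" "c \<le> ennreal t"
  shows "hit y (stopped t w) < c \<longleftrightarrow> hit y w < c"
proof -
  have "stopped t w r = w r" if "0 \<le> r" "ennreal r < c" for r
  proof -
    have "r < t" using that assms by (metis ennreal_less_iff less_le_trans)
    then show ?thesis using that by (simp add: stopped_def)
  qed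
  then show ?thesis unfolding hit_less_iff by metis
qed

text \<open>Adaptedness in the form that \<open>strong_markov\<close> requires. The level before the
  passage is read off strictly before it, so freezing the path at a later time has no
  effect.\<close>

lemma hit_stopped:
  assumes t: "0 < t" and less: "hit y w < ennreal t \<or> hit y (stopped t w) < ennreal t"
  shows "hit y (stopped t w) = hit y w" "pre_level y (stopped t w) = pre_level y w"
proof -
  have both: "hit y w < ennreal t" "hit y (stopped t w) < ennreal t"
    using less hit_stopped_less_iff[OF t order_refl] by auto
  show eq: "hit y (stopped t w) = hit y w"
  proof (rule ccontr)
    assume "hit y (stopped t w) \<noteq> hit y w"
    then consider "hit y (stopped t w) < hit y w" | "hit y w < hit y (stopped t w)"
      using less_linear by blast
    then show False
      using hit_stopped_less_iff[OF t, of "hit y w" y w] hit_stopped_less_iff[OF t, of "hit y (stopped t w)" y w] both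
      by cases (auto simp: less_imp_le)
  qed
  let ?r = "enn2real (hit y w)"
  have "lval ?r (stopped t w) = lval ?r w" if "hit y w \<noteq> 0"
  proof -
    have r: "hit y w = ennreal ?r" using both(1) by (metis ennreal_enn2real ennreal_less_top less_trans)
    have "0 < ?r" using that r by (metis enn2real_nonneg ennreal_0 less_eq_real_def)
    have "?r < t" using both(1) r t by (metis enn2real_nonneg ennreal_less_iff)
    \<comment> \<open>The approximating sequences agree term by term, so the claim holds for
      arbitrary functions, whether or not a left limit exists.\<close>
    have "stopped t w ((of_int \<lceil>?r * 2 ^ k\<rceil> - 1) / 2 ^ k) = w ((of_int \<lceil>?r * 2 ^ k\<rceil> - 1) / 2 ^ k)" for k
    proof -
      let ?s = "(of_int \<lceil>?r * 2 ^ k\<rceil> - 1) / (2::real) ^ k"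
      have "?s < t" using ceiling_dyadic_bounds(1)[of ?r k] \<open>?r < t\<close> by simp
      moreover have "0 < \<lceil>?r * 2 ^ k\<rceil>" using \<open>0 < ?r\<close> by simp
      then have "0 \<le> ?s" by simp
      ultimately show ?thesis by (simp add: stopped_def)
    qed
    then show ?thesis unfolding lval_def by presburger
  qed
  then show "pre_level y (stopped t w) = pre_level y w"
    unfolding pre_level_def eq by simp
qed

context
  fixes w :: "real \<Rightarrow> real"
  assumes w: "cadlag w"
begin

lemma hit_le:
  assumes t: "0 \<le> t" "w t < - y"
  shows "hit y w \<le> ennreal t"
proof (rule ccontr)
  assume "\<not> hit y w \<le> ennreal t"
  then have lt: "ennreal t < hit y w" by simp
  then obtain u where u: "t < u" "ennreal u \<le> hit y w" using t(1) by (rule ennreal_less_obtain)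
  have "\<forall>\<^sub>F s in at_right t. w s < - y"
    by (rule order_tendstoD(2)[OF cadlag_tendsto_right[OF w t(1)] t(2)])
  then obtain b where b: "t < b" "\<And>s. t < s \<Longrightarrow> s < b \<Longrightarrow> w s < - y"
    by (auto simp: eventually_at_right_field)
  obtain r where r: "r \<in> \<rat>" "t < r" "r < min b u"
    using Rats_dense_in_real[of t "min b u"] b u by auto
  then have "ennreal r < hit y w" using u t by (metis ennreal_less_iff less_le_trans less_imp_le min_less_iff_conj order_trans)
  then have "hit y w < hit y w" using r b t by (subst hit_less_iff) (auto intro!: bexI[of _ r])
  then show False by simp
qed

lemma hit_before: "0 \<le> t \<Longrightarrow> ennreal t < hit y w \<Longrightarrow> - y \<le> w t"
  using hit_le[of t y] by (meson leD leI)

text \<open>Otherwise the path would stay above \<open>- y\<close> on a right neighbourhood of the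
  passage time, and the passage would occur later. Only the weak inequality survives in the limit
  from the right.\<close>

lemma hit_value:
  assumes h: "hit y w < \<top>"
  shows "w (enn2real (hit y w)) \<le> - y"
proof (rule ccontr)
  let ?T = "enn2real (hit y w)"
  have T: "hit y w = ennreal ?T" using h by simp
  assume "\<not> w ?T \<le> - y"
  then have "- y < w ?T" by simp
  from order_tendstoD(1)[OF cadlag_tendsto_right[OF w] this]
  obtain b where b: "?T < b" "\<And>s. ?T < s \<Longrightarrow> s < b \<Longrightarrow> - y < w s"
    by (auto simp: eventually_at_right_field)
  have "hit y w < ennreal b" using b(1) by (subst T) (simp add: ennreal_less_iff)
  then obtain r where r: "r \<in> \<rat>" "0 \<le> r" "w r < - y" "ennreal r < ennreal b"
    by (auto simp: hit_less_iff)
  have "r < b" using r by (simp add: ennreal_less_iff)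
  have "?T \<le> r" using hit_le[OF r(2,3)] r(2) by (subst (asm) T) simp
  then consider "r = ?T" | "?T < r" by linarith
  then show False using \<open>- y < w ?T\<close> b(2)[of r] \<open>r < b\<close> r(3) by cases auto
qed

lemma post_hit_eq: "post_hit y w = post (enn2real (hit y w)) w"
  unfolding post_hit_def post_def by (simp add: cadlag_rval w)

text \<open>At its passage the path is at or below \<open>- x\<close>, so a further fall by more
  than \<open>y\<close> carries it below \<open>- (x + y)\<close>. An overshoot may make the
  inequality strict.\<close>

lemma hit_add_le:
  assumes "0 \<le> x" "hit x w < \<top>"
  shows "hit (x + y) w \<le> hit x w + hit y (post_hit x w)"
proof (rule ccontr)
  let ?T = "enn2real (hit x w)"
  assume "\<not> hit (x + y) w \<le> hit x w + hit y (post_hit x w)"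
  then have lt: "hit x w + hit y (post_hit x w) < hit (x + y) w" by simp
  then have "hit y (post_hit x w) < \<top>" by (cases "hit y (post_hit x w)") auto
  then have eq: "hit x w = ennreal ?T" "hit y (post_hit x w) = ennreal (enn2real (hit y (post_hit x w)))" (is "_ = ennreal ?s")
    using assms(2) by simp_all
  have "ennreal (?T + ?s) = hit x w + hit y (post_hit x w)"
    using eq by (metis enn2real_nonneg ennreal_plus)
  with lt have "ennreal (?T + ?s) < hit (x + y) w" by simp
  then obtain u where u: "?T + ?s < u" "ennreal u \<le> hit (x + y) w"
    by (rule ennreal_less_obtain) simp
  then have "hit y (post_hit x w) < ennreal (u - ?T)"
    by (subst eq) (simp add: ennreal_less_iff)
  then obtain r where r: "0 \<le> r" "post_hit x w r < - y" "ennreal r < ennreal (u - ?T)"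
    by (auto simp: hit_less_iff)
  have "w (?T + r) < - (x + y)"
    using r(1,2) hit_value[OF assms(2)] by (simp add: post_hit_eq post_def)
  then have "hit (x + y) w \<le> ennreal (?T + r)" using r(1) by (intro hit_le) auto
  also have "\<dots> < ennreal u" using r by (simp add: ennreal_less_iff del: ennreal_plus)
  also note u(2)
  finally show False by simp
qed

end

section \<open>The strong Markov property at the passage and the mean passage time\<close>

context levy
begin

lemma passage_distr:
  assumes "AE \<omega> in M. hit y (path \<omega>) < \<top>"
  shows "distr M (borel \<Otimes>\<^sub>M paths) (\<lambda>\<omega>. (pre_level y (path \<omega>), post_hit y (path \<omega>))) =
    distr M borel (\<lambda>\<omega>. pre_level y (path \<omega>)) \<Otimes>\<^sub>M distr M paths path"
proof (rule strong_markov[where T="hit y"])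
  show "post_hit y (path \<omega>) = post (enn2real (hit y (path \<omega>))) (path \<omega>)" if "\<omega> \<in> space M" for \<omega>
    by (rule post_hit_eq[OF cadlag_path[OF that]])
qed (use assms hit_stopped in \<open>auto simp: measurable_hit[of "\<lambda>_. y" paths "\<lambda>w. w"] measurable_pre_level[of "\<lambda>_. y" paths "\<lambda>w. w"]\<close>)

text \<open>The form in which a fresh start from a random level is used: fix the level, average over
  an independent copy of the path, then average over the level.\<close>

lemma nn_integral_passage:
  assumes fin: "AE \<omega> in M. hit y (path \<omega>) < \<top>"
    and \<phi> [measurable]: "\<phi> \<in> borel_measurable (borel \<Otimes>\<^sub>M paths)"
  shows "(\<integral>\<^sup>+\<omega>. \<phi> (pre_level y (path \<omega>), post_hit y (path \<omega>)) \<partial>M) =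
    (\<integral>\<^sup>+\<omega>. (\<integral>\<^sup>+\<omega>'. \<phi> (pre_level y (path \<omega>), path \<omega>') \<partial>M) \<partial>M)"
proof -
  interpret P: prob_space "distr M paths path" by (rule prob_space_distr) measurable
  let ?Z = "\<lambda>\<omega>. pre_level y (path \<omega>)"
  have "(\<integral>\<^sup>+\<omega>. \<phi> (?Z \<omega>, post_hit y (path \<omega>)) \<partial>M) =
      (\<integral>\<^sup>+p. \<phi> p \<partial>distr M (borel \<Otimes>\<^sub>M paths) (\<lambda>\<omega>. (?Z \<omega>, post_hit y (path \<omega>))))"
    by (subst nn_integral_distr) auto
  also have "\<dots> = (\<integral>\<^sup>+p. \<phi> p \<partial>(distr M borel ?Z \<Otimes>\<^sub>M distr M paths path))"
    unfolding passage_distr[OF fin] ..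
  also have "\<dots> = (\<integral>\<^sup>+z. (\<integral>\<^sup>+w. \<phi> (z, w) \<partial>distr M paths path) \<partial>distr M borel ?Z)"
    by (subst P.nn_integral_fst[symmetric]) (simp_all cong: measurable_cong_sets)
  also have "\<dots> = (\<integral>\<^sup>+z. (\<integral>\<^sup>+\<omega>'. \<phi> (z, path \<omega>') \<partial>M) \<partial>distr M borel ?Z)"
    by (subst nn_integral_distr) auto
  also have "\<dots> = (\<integral>\<^sup>+\<omega>. (\<integral>\<^sup>+\<omega>'. \<phi> (?Z \<omega>, path \<omega>') \<partial>M) \<partial>M)"
    by (subst nn_integral_distr) auto
  finally show ?thesis .
qed

lemma AE_passage:
  assumes fin: "AE \<omega> in M. hit y (path \<omega>) < \<top>"
    and [measurable]: "Measurable.pred (borel \<Otimes>\<^sub>M paths) (\<lambda>p. Q (fst p) (snd p))"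
    and Q: "AE \<omega> in M. AE \<omega>' in M. Q (pre_level y (path \<omega>)) (path \<omega>')"
  shows "AE \<omega> in M. Q (pre_level y (path \<omega>)) (post_hit y (path \<omega>))"
proof -
  let ?\<phi> = "\<lambda>p. indicator {p\<in>space (borel \<Otimes>\<^sub>M paths). \<not> Q (fst p) (snd p)} p :: ennreal"
  have sp: "space (borel \<Otimes>\<^sub>M paths) = (UNIV :: (real \<times> (real \<Rightarrow> real)) set)"
    by (simp add: space_pair_measure space_PiM)
  have "(\<integral>\<^sup>+\<omega>. ?\<phi> (pre_level y (path \<omega>), post_hit y (path \<omega>)) \<partial>M) =
    (\<integral>\<^sup>+\<omega>. (\<integral>\<^sup>+\<omega>'. ?\<phi> (pre_level y (path \<omega>), path \<omega>') \<partial>M) \<partial>M)"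
    by (rule nn_integral_passage[OF fin]) measurable
  also have "\<dots> = (\<integral>\<^sup>+\<omega>. 0 \<partial>M)"
  proof (rule nn_integral_cong_AE)
    show "AE \<omega> in M. (\<integral>\<^sup>+\<omega>'. ?\<phi> (pre_level y (path \<omega>), path \<omega>') \<partial>M) = 0"
      using Q
    proof eventually_elim
      case (elim \<omega>)
      then have "(\<integral>\<^sup>+\<omega>'. ?\<phi> (pre_level y (path \<omega>), path \<omega>') \<partial>M) = (\<integral>\<^sup>+\<omega>'. 0 \<partial>M)"
        by (intro nn_integral_cong_AE) (auto elim!: eventually_mono)
      then show ?case by simp
    qed
  qed
  finally have "(\<integral>\<^sup>+\<omega>. ?\<phi> (pre_level y (path \<omega>), post_hit y (path \<omega>)) \<partial>M) = 0" by simp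
  then have "AE \<omega> in M. ?\<phi> (pre_level y (path \<omega>), post_hit y (path \<omega>)) = 0"
    by (subst (asm) nn_integral_0_iff_AE) measurable
  then show ?thesis by eventually_elim (auto simp: sp indicator_def split: if_splits)
qed

definition mean_hit :: "real \<Rightarrow> ennreal" where
  "mean_hit y = (\<integral>\<^sup>+\<omega>. hit y (path \<omega>) \<partial>M)"

lemma mean_hit_mono: "y \<le> z \<Longrightarrow> mean_hit y \<le> mean_hit z"
  unfolding mean_hit_def by (intro nn_integral_mono hit_mono)

lemma measurable_mean_hit [measurable]: "mean_hit \<in> borel_measurable borel"
  unfolding mean_hit_def by measurable

lemma AE_hit_finite: "mean_hit y < \<top> \<Longrightarrow> AE \<omega> in M. hit y (path \<omega>) < \<top>"
  unfolding mean_hit_def using nn_integral_PInf_AE[of "\<lambda>\<omega>. hit y (path \<omega>)" M]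
  by (auto simp: less_top)

lemma mean_hit_add_le:
  assumes "0 \<le> x" "mean_hit x < \<top>"
  shows "mean_hit (x + y) \<le> mean_hit x + mean_hit y"
proof -
  note fin = AE_hit_finite[OF assms(2)]
  have "mean_hit (x + y) \<le> (\<integral>\<^sup>+\<omega>. hit x (path \<omega>) + hit y (post_hit x (path \<omega>)) \<partial>M)"
    unfolding mean_hit_def
  proof (rule nn_integral_mono_AE)
    show "AE \<omega> in M. hit (x + y) (path \<omega>) \<le> hit x (path \<omega>) + hit y (post_hit x (path \<omega>))"
      using fin AE_space by eventually_elim (intro hit_add_le cadlag_path assms)
  qed
  also have "\<dots> = mean_hit x + (\<integral>\<^sup>+\<omega>. hit y (post_hit x (path \<omega>)) \<partial>M)"
    unfolding mean_hit_def by (rule nn_integral_add) measurable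
  also have "(\<integral>\<^sup>+\<omega>. hit y (post_hit x (path \<omega>)) \<partial>M) = (\<integral>\<^sup>+\<omega>. mean_hit y \<partial>M)"
    unfolding mean_hit_def using nn_integral_passage[OF fin, of "\<lambda>p. hit y (snd p)"] by simp
  finally show ?thesis by (simp add: emeasure_space_1)
qed

end

section \<open>Finiteness of the mean passage time\<close>

text \<open>The sum counts the integers \<open>n \<ge> 0\<close> below \<open>c\<close>, so it is
  \<open>c\<close> rounded up. Integrated, it bounds a mean by the sum of tail
  probabilities.\<close>

lemma ennreal_le_suminf_indicator:
  "c \<le> (\<Sum>n. indicator {n. ennreal (real n) < c} n :: ennreal)"
proof -
  let ?f = "\<lambda>n. indicator {n. ennreal (real n) < c} n :: ennreal"
  have *: "min c (ennreal (real N)) \<le> (\<Sum>n<N. ?f n)" for N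
  proof (induction N)
    case (Suc N)
    show ?case
    proof (cases "ennreal (real N) < c")
      case True
      then have "min c (ennreal (real N)) = ennreal (real N)" by (simp add: min_absorb2 less_imp_le)
      then have "ennreal (real N) + 1 \<le> (\<Sum>n<Suc N. ?f n)"
        using Suc True by (simp add: add_right_mono)
      moreover have "ennreal (real (Suc N)) = ennreal (real N) + 1"
        by (simp add: ennreal_plus[symmetric] del: ennreal_plus flip: ennreal_1)
      ultimately show ?thesis by (metis min.cobounded2 order_trans)
    next
      case False
      then have "min c (ennreal (real (Suc N))) \<le> min c (ennreal (real N))" by (simp add: min.coboundedI1)
      also note Suc
      also have "(\<Sum>n<N. ?f n) = (\<Sum>n<Suc N. ?f n)" using False by simp
      finally show ?thesis .
    qed
  qed simp
  have le: "min c (ennreal (real N)) \<le> suminf ?f" for N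
    using * sum_le_suminf[of ?f "{..<N}"] by (meson order_trans finite_lessThan summableI zero_le)
  have "(SUP N. min c (ennreal (real N))) = min c (SUP N. ennreal (real N))"
    by (simp add: inf_min[symmetric] inf_SUP)
  also have "\<dots> = c" by (simp add: ennreal_SUP_of_nat_eq_top ennreal_of_nat_eq_real_of_nat[symmetric])
  finally have "c = (SUP N. min c (ennreal (real N)))" ..
  then show ?thesis using le by (metis SUP_least)
qed

context levy
begin

text \<open>The increments over unit intervals are independent and identically distributed, so
  reversing the order of the first \<open>n\<close> preserves their joint law.\<close>

lemma prob_reversed_walk:
  "prob {\<omega>\<in>space M. \<forall>k\<le>n. - x \<le> path \<omega> (real k)} =
   prob {\<omega>\<in>space M. \<forall>k\<le>n. - x \<le> path \<omega> (real n) - path \<omega> (real (n - k))}"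
proof -
  let ?\<nu> = "distr M borel (X 1)"
  let ?I = "\<lambda>\<omega> i. increment real i \<omega>"
  interpret N: prob_space ?\<nu> by (rule prob_space_distr) simp
  have inc: "distr M (PiM UNIV (\<lambda>_. borel)) ?I = PiM UNIV (\<lambda>i::nat. ?\<nu>)"
    using distr_increments[of real 0] by (simp add: incseq_def)
  have [measurable]: "increment real i \<in> borel_measurable M" for i
    unfolding increment_def by measurable
  \<comment> \<open>Reversal of the first \<open>n\<close> indices, identity beyond; an injective
    reindexing preserves an infinite product of equal factors.\<close>
  define f where "f i = (if i < n then n - 1 - i else i)" for i
  have "inj f" unfolding f_def inj_def by (auto split: if_splits)
  then have reindex: "distr (PiM UNIV (\<lambda>i. ?\<nu>)) (PiM UNIV (\<lambda>i. ?\<nu>)) (\<lambda>v i. v (f i)) = PiM UNIV (\<lambda>i. ?\<nu>)"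
    using distr_PiM_reindex[of UNIV "\<lambda>_. ?\<nu>" f UNIV] N.prob_space_axioms by (simp add: restrict_UNIV)
  have sets_eq: "sets (PiM UNIV (\<lambda>i::nat. ?\<nu>)) = sets (PiM UNIV (\<lambda>i. borel))"
    by (intro sets_PiM_cong) auto
  define C where "C = {v \<in> space (PiM UNIV (\<lambda>_::nat. borel)). \<forall>k\<le>n. - x \<le> (\<Sum>i\<in>{0..<k}. v i :: real)}"
  have C [measurable]: "C \<in> sets (PiM UNIV (\<lambda>_. borel))"
    unfolding C_def by measurable
  have shift [measurable]: "(\<lambda>v i. v (f i)) \<in> PiM UNIV (\<lambda>_::nat. borel :: real measure) \<rightarrow>\<^sub>M PiM UNIV (\<lambda>_. borel)"
    by (rule measurable_PiM_single') auto
  have I [measurable]: "?I \<in> M \<rightarrow>\<^sub>M PiM UNIV (\<lambda>_. borel)"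
    by (rule measurable_PiM_single') auto
  have "prob (?I -` C \<inter> space M) = measure (PiM UNIV (\<lambda>i. ?\<nu>)) C"
    unfolding inc[symmetric] by (rule measure_distr[symmetric]) measurable
  also have "\<dots> = measure (PiM UNIV (\<lambda>i. ?\<nu>)) ((\<lambda>v i. v (f i)) -` C \<inter> space (PiM UNIV (\<lambda>i. ?\<nu>)))"
    by (subst reindex[symmetric], rule measure_distr)
       (use C shift sets_eq in \<open>simp_all cong: measurable_cong_sets\<close>)
  also have "\<dots> = measure (distr M (PiM UNIV (\<lambda>_. borel)) ?I) ((\<lambda>v i. v (f i)) -` C \<inter> space (PiM UNIV (\<lambda>i. borel)))"
    unfolding inc using sets_eq_imp_space_eq[OF sets_eq] by simp
  also have "\<dots> = prob (?I -` ((\<lambda>v i. v (f i)) -` C \<inter> space (PiM UNIV (\<lambda>i. borel))) \<inter> space M)"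
    by (rule measure_distr) (use measurable_sets[OF shift C] in auto)
  finally have eq: "prob (?I -` C \<inter> space M) =
      prob (?I -` ((\<lambda>v i. v (f i)) -` C \<inter> space (PiM UNIV (\<lambda>i. borel))) \<inter> space M)" .
  have "(\<Sum>i\<in>{0..<k}. ?I \<omega> i) = path \<omega> (real k)" for \<omega> k
    by (simp add: sum_increment path_def)
  then have 1: "?I -` C \<inter> space M = {\<omega>\<in>space M. \<forall>k\<le>n. - x \<le> path \<omega> (real k)}"
    unfolding C_def by (auto simp: space_PiM)
  have "(\<Sum>i\<in>{0..<k}. ?I \<omega> (f i)) = path \<omega> (real n) - path \<omega> (real (n - k))" if "k \<le> n" for \<omega> k
  proof -
    have "(\<Sum>i\<in>{0..<k}. ?I \<omega> (f i)) = (\<Sum>i\<in>{n-k..<n}. ?I \<omega> i)"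
      by (rule sum.reindex_bij_witness[where i="\<lambda>i. n - 1 - i" and j="\<lambda>i. n - 1 - i"])
         (use that in \<open>auto simp: f_def\<close>)
    then show ?thesis by (simp add: sum_increment path_def)
  qed
  then have 2: "?I -` ((\<lambda>v i. v (f i)) -` C \<inter> space (PiM UNIV (\<lambda>i. borel))) \<inter> space M =
     {\<omega>\<in>space M. \<forall>k\<le>n. - x \<le> path \<omega> (real n) - path \<omega> (real (n - k))}"
    unfolding C_def by (auto simp: space_PiM)
  show ?thesis using eq unfolding 1 2 .
qed

text \<open>After time reversal, \<open>hit x > n\<close> becomes the event that the walk at time \<open>n\<close> is within \<open>x\<close>
  of its maximum. With probability at least \<open>1/2\<close> such an \<open>n\<close> is the last one up to a fixed delay \<open>m\<close>,
  so the expected number of such \<open>n\<close> is at most \<open>2 m\<close>.\<close>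

lemma mean_hit_finite:
  assumes drift: "drifts_to_minus_infinity M X"
  shows "mean_hit x < \<top>"
proof -
  define B where "B m = {w \<in> space paths. \<exists>j\<ge>m. - x \<le> w (real j)}" for m :: nat
  have B [measurable]: "B m \<in> sets paths" for m unfolding B_def by measurable
  have "(\<lambda>m. prob {\<omega>\<in>space M. path \<omega> \<in> B m}) \<longlonglongrightarrow> prob (\<Inter>m. {\<omega>\<in>space M. path \<omega> \<in> B m})"
  proof (rule finite_Lim_measure_decseq)
    have "B n \<subseteq> B m" if "m \<le> n" for m n using that unfolding B_def by (auto intro: order_trans)
    then show "decseq (\<lambda>m. {\<omega>\<in>space M. path \<omega> \<in> B m})" unfolding decseq_def by blast
  qed auto
  moreover have "prob (\<Inter>m. {\<omega>\<in>space M. path \<omega> \<in> B m}) = 0"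
  proof -
    have "AE \<omega> in M. \<omega> \<notin> (\<Inter>m. {\<omega>\<in>space M. path \<omega> \<in> B m})"
      using drift[unfolded drifts_to_minus_infinity_def] AE_path
    proof eventually_elim
      case (elim \<omega>)
      then have "\<forall>\<^sub>F t in at_top. X t \<omega> < - x" by (simp add: filterlim_at_bot_dense)
      then obtain T where T: "\<And>t. T \<le> t \<Longrightarrow> X t \<omega> < - x" by (auto simp: eventually_at_top_linorder)
      obtain m where "T \<le> real m" using real_arch_simple by blast
      then have "path \<omega> (real j) < - x" if "m \<le> j" for j
        using elim(2) T[of "real j"] that by simp
      then have "path \<omega> \<notin> B m" by (force simp: B_def)
      then show ?case by auto
    qed
    moreover have "(\<Inter>m. {\<omega>\<in>space M. path \<omega> \<in> B m}) \<in> events"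
      by (intro sets.countable_INT') auto
    ultimately show ?thesis using prob_eq_0 by blast
  qed
  ultimately have "(\<lambda>m. prob {\<omega>\<in>space M. path \<omega> \<in> B m}) \<longlonglongrightarrow> 0" by simp
  \<comment> \<open>Drift makes late returns above \<open>- x\<close> unlikely; \<open>m\<close> is
    the delay after which they have probability below \<open>1/2\<close>. Any bound below 1 would
    serve, at the price of another factor.\<close>
  from order_tendstoD(2)[OF this, of "1/2"] obtain m where m: "prob {\<omega>\<in>space M. path \<omega> \<in> B m} < 1/2"
    by (auto simp: eventually_sequentially)
  define A where "A n = {\<omega>\<in>space M. \<forall>k\<le>n. - x \<le> path \<omega> (real n) - path \<omega> (real (n - k))}" for n
  have A [measurable]: "A n \<in> events" for n unfolding A_def by measurable
  define G where "G n = A n \<inter> {\<omega>\<in>space M. post (real n) (path \<omega>) \<in> - B m}" for n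
  have B' [measurable]: "- B m \<in> sets paths"
    using sets.compl_sets[OF B[of m]] by (simp add: space_PiM Compl_eq_Diff_UNIV)
  have G [measurable]: "G n \<in> events" for n unfolding G_def by measurable
  have GA: "prob (A n) \<le> 2 * prob (G n)" for n
  proof -
    define C where "C = {w \<in> space paths. \<forall>k\<le>n. - x \<le> w (real n) - w (real (n - k))}"
    have C [measurable]: "C \<in> sets paths" unfolding C_def by measurable
    have "stopped (real n) (path \<omega>) \<in> C \<longleftrightarrow> \<omega> \<in> A n" if "\<omega> \<in> space M" for \<omega>
      using that unfolding C_def A_def by (simp add: stopped_def space_PiM)
    then have "G n = {\<omega>\<in>space M. stopped (real n) (path \<omega>) \<in> C \<and> post (real n) (path \<omega>) \<in> - B m}"
      "A n = {\<omega>\<in>space M. stopped (real n) (path \<omega>) \<in> C}"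
      using sets.sets_into_space[OF A[of n]] unfolding G_def by auto
    then have "prob (G n) = prob (A n) * prob {\<omega>\<in>space M. path \<omega> \<in> - B m}"
      using prob_stopped_post[OF C B', of "real n"] by simp
    moreover have "{\<omega>\<in>space M. path \<omega> \<in> - B m} = space M - {\<omega>\<in>space M. path \<omega> \<in> B m}" by auto
    then have "prob {\<omega>\<in>space M. path \<omega> \<in> - B m} \<ge> 1/2"
      using m by (simp add: prob_compl)
    ultimately show ?thesis
      using mult_left_mono[of "1/2" "prob {\<omega>\<in>space M. path \<omega> \<in> - B m}" "prob (A n)"] by simp
  qed
  \<comment> \<open>A later near-maximum \<open>n'\<close> with \<open>n' \<ge> n + m\<close> would
    be a late return, which \<open>G n\<close> forbids. So for each \<open>\<omega>\<close> all such
    times fit into a window of length \<open>m\<close>.\<close>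
  have GG: "n' < n + m" if "\<omega> \<in> G n" "\<omega> \<in> G n'" for n n' \<omega>
  proof (rule ccontr)
    assume "\<not> n' < n + m"
    then have n': "n' = n + (n' - n)" "m \<le> n' - n" by auto
    have "- x \<le> path \<omega> (real n') - path \<omega> (real (n' - (n' - n)))"
      using that(2) unfolding G_def A_def by (auto simp del: of_nat_diff)
    then have "- x \<le> post (real n) (path \<omega>) (real (n' - n))"
      using n' by (simp add: post_def)
    then have "post (real n) (path \<omega>) \<in> B m"
      using n'(2) unfolding B_def by (auto simp: space_PiM simp del: of_nat_diff)
    then show False using that(1) by (simp add: G_def)
  qed
  have sum_le: "(\<Sum>n<N. indicator (G n) \<omega> :: real) \<le> real m" for N \<omega>
  proof (cases "{n\<in>{..<N}. \<omega> \<in> G n} = {}")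
    case True
    then have "(\<Sum>n<N. indicator (G n) \<omega> :: real) = 0" by (intro sum.neutral) (auto simp: indicator_def)
    then show ?thesis by simp
  next
    case False
    let ?S = "{n\<in>{..<N}. \<omega> \<in> G n}"
    have "Min ?S \<in> ?S" using False by (intro Min_in) auto
    then have "?S \<subseteq> {Min ?S..<Min ?S + m}" using GG by auto
    then have "card ?S \<le> m" using card_mono[of "{Min ?S..<Min ?S + m}" ?S] by simp
    moreover have "(\<Sum>n<N. indicator (G n) \<omega> :: real) = real (card ?S)"
      by (simp add: indicator_def sum.If_cases Int_def)
    ultimately show ?thesis by simp
  qed
  have sumG: "(\<Sum>n<N. prob (G n)) \<le> real m" for N
  proof -
    have "(\<Sum>n<N. prob (G n)) = expectation (\<lambda>\<omega>. \<Sum>n<N. indicator (G n) \<omega>)"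
      by (subst Bochner_Integration.integral_sum) (auto simp: less_top[symmetric] emeasure_eq_measure)
    also have "\<dots> \<le> expectation (\<lambda>\<omega>. real m)"
      by (intro integral_mono sum_le) (auto simp: less_top[symmetric] emeasure_eq_measure)
    finally show ?thesis by (simp add: prob_space)
  qed
  have hit_A: "emeasure M {\<omega>\<in>space M. ennreal (real n) < hit x (path \<omega>)} \<le> ennreal (2 * prob (G n))" for n
  proof -
    have "{\<omega>\<in>space M. ennreal (real n) < hit x (path \<omega>)} \<subseteq> {\<omega>\<in>space M. \<forall>k\<le>n. - x \<le> path \<omega> (real k)}"
    proof safe
      fix \<omega> k assume "\<omega> \<in> space M" "ennreal (real n) < hit x (path \<omega>)" "k \<le> n"
      then show "- x \<le> path \<omega> (real k)"
        by (intro hit_before[OF cadlag_path]) (auto intro: le_less_trans[of _ "ennreal (real n)"] ennreal_leI)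
    qed
    then have "emeasure M {\<omega>\<in>space M. ennreal (real n) < hit x (path \<omega>)} \<le>
        emeasure M {\<omega>\<in>space M. \<forall>k\<le>n. - x \<le> path \<omega> (real k)}"
      by (rule emeasure_mono) measurable
    also have "\<dots> = ennreal (prob (A n))"
      unfolding emeasure_eq_measure A_def prob_reversed_walk ..
    finally show ?thesis using GA[of n] by (meson ennreal_leI order_trans)
  qed
  have "mean_hit x \<le> (\<integral>\<^sup>+\<omega>. (\<Sum>n. indicator {\<omega>\<in>space M. ennreal (real n) < hit x (path \<omega>)} \<omega>) \<partial>M)"
    unfolding mean_hit_def
  proof (rule nn_integral_mono)
    fix \<omega> assume "\<omega> \<in> space M"
    then show "hit x (path \<omega>) \<le> (\<Sum>n. indicator {\<omega>\<in>space M. ennreal (real n) < hit x (path \<omega>)} \<omega>)"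
      using ennreal_le_suminf_indicator[of "hit x (path \<omega>)"] by (simp add: indicator_def)
  qed
  also have "\<dots> = (\<Sum>n. emeasure M {\<omega>\<in>space M. ennreal (real n) < hit x (path \<omega>)})"
    by (subst nn_integral_suminf) auto
  also have "\<dots> \<le> (\<Sum>n. ennreal (2 * prob (G n)))"
    by (intro suminf_le hit_A) auto
  also have "\<dots> \<le> ennreal (2 * real m)"
  proof -
    have "(\<Sum>n<N. ennreal (2 * prob (G n))) \<le> ennreal (2 * real m)" for N
    proof -
      have "(\<Sum>n<N. ennreal (2 * prob (G n))) = ennreal (2 * (\<Sum>n<N. prob (G n)))"
        by (subst sum_ennreal) (auto simp: sum_distrib_left)
      also have "\<dots> \<le> ennreal (2 * real m)" using sumG by (intro ennreal_leI) simp
      finally show ?thesis .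
    qed
    then show ?thesis by (subst suminf_eq_SUP) (auto intro: SUP_least)
  qed
  finally show ?thesis by (rule le_less_trans) simp
qed

end

section \<open>Regularity and the renewal function\<close>

text \<open>The limit of the passage times over levels increasing to \<open>y\<close>: a measurable
  lower bound for the first passage into the closed half-line.\<close>

definition hit_left :: "real \<Rightarrow> (real \<Rightarrow> real) \<Rightarrow> ennreal" where
  "hit_left y w = (SUP n. hit (y - inverse (real (Suc n))) w)"

lemma measurable_hit_left [measurable]:
  assumes [measurable]: "y \<in> borel_measurable N" "f \<in> N \<rightarrow>\<^sub>M paths"
  shows "(\<lambda>x. hit_left (y x) (f x)) \<in> borel_measurable N"
  unfolding hit_left_def by measurable

lemma hit_le_first_passage:
  assumes w: "cadlag w" and "z < y"
  shows "hit z w \<le> first_passage (\<lambda>t. y + w t)"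
  unfolding first_passage_def using assms by (intro INF_greatest hit_le[OF w]) auto

lemma hit_left_le_first_passage: "cadlag w \<Longrightarrow> hit_left y w \<le> first_passage (\<lambda>t. y + w t)"
  unfolding hit_left_def by (intro SUP_least hit_le_first_passage) auto

lemma first_passage_le_hit: "first_passage (\<lambda>t. y + w t) \<le> hit y w"
  unfolding hit_def by (rule INF_greatest) (auto intro: first_passage_le)

text \<open>The ladder process is killed at an exponential time of rate \<open>\<kappa>\<close>, so
  the total mass is the integral of \<open>exp (- \<kappa> * t)\<close>.\<close>

lemma emeasure_ladder_potential_UNIV:
  assumes U: "ladder_potential N X L U \<kappa>" and \<kappa>: "0 < \<kappa>"
  shows "emeasure U UNIV = ennreal (1 / \<kappa>)"
proof -
  have m: "measure (completion N) {\<omega>\<in>space N. inverse_local_time L t \<omega> < \<top>} = exp (- \<kappa> * t)" if "0 \<le> t" for t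
    using U that by (simp add: ladder_potential_def)
  have em: "emeasure (completion N) {\<omega>\<in>space N. inverse_local_time L t \<omega> < \<top>} = ennreal (exp (- \<kappa> * t))"
    if "0 \<le> t" for t
  proof -
    \<comment> \<open>\<open>measure\<close> is 0 on sets of infinite mass, whereas the exponential
      is positive; so the mass is finite.\<close>
    have "emeasure (completion N) {\<omega>\<in>space N. inverse_local_time L t \<omega> < \<top>} \<noteq> \<top>"
      using m[OF that] by (auto simp: measure_def)
    then show ?thesis using m[OF that] emeasure_eq_ennreal_measure by metis
  qed
  have "emeasure U UNIV = (\<integral>\<^sup>+t\<in>{0..}. emeasure (completion N) {\<omega>\<in>space N. inverse_local_time L t \<omega> < \<top>} \<partial>lborel)"
    using U by (simp add: ladder_potential_def)
  also have "\<dots> = (\<integral>\<^sup>+t. ennreal (exp (- \<kappa> * t)) * indicator {0..} t \<partial>lborel)"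
    by (intro nn_integral_cong) (auto simp: em split: split_indicator)
  also have "\<dots> = ennreal (0 - (- exp (- \<kappa> * 0) / \<kappa>))"
  proof (rule nn_integral_FTC_atLeast)
    show "((\<lambda>t. - exp (- \<kappa> * t) / \<kappa>) has_real_derivative exp (- \<kappa> * t)) (at t)" for t
      using \<kappa> by (auto intro!: derivative_eq_intros)
    have "filterlim (\<lambda>t. \<kappa> * t) at_top at_top"
      by (rule filterlim_tendsto_pos_mult_at_top[OF tendsto_const \<kappa> filterlim_ident])
    then have "((\<lambda>t. exp (- (\<kappa> * t))) \<longlongrightarrow> 0) at_top"
      by (intro filterlim_compose[OF exp_at_bot] filterlim_compose[OF filterlim_uminus_at_bot_at_top])
    from tendsto_divide[OF tendsto_minus[OF this] tendsto_const[of \<kappa>]]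
    show "((\<lambda>t. - exp (- \<kappa> * t) / \<kappa>) \<longlongrightarrow> 0) at_top" using \<kappa> by simp
  qed auto
  finally show ?thesis by simp
qed

lemma emeasure_ascending_ladder_UNIV:
  assumes "ascending_ladder M X U \<kappa>" "0 < \<kappa>"
  shows "emeasure U UNIV = ennreal (1 / \<kappa>)"
  using assms unfolding ascending_ladder_def
  by (auto split: if_splits intro: emeasure_ladder_potential_UNIV)

lemma sets_ascending_ladder: "ascending_ladder M X U \<kappa> \<Longrightarrow> sets U = sets borel"
  unfolding ascending_ladder_def ladder_potential_def by (auto split: if_splits)

locale levy_to_minus_infinity = levy +
  assumes drift: "drifts_to_minus_infinity M X" and regular: "regular_for M X {..<0}"
begin

lemma mean_hit_less_top [simp]: "mean_hit y < \<top>"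
  using drift by (rule mean_hit_finite)

lemma mean_hit_0: "mean_hit 0 = 0"
proof -
  have "AE \<omega> in M. hit 0 (path \<omega>) = 0"
    using regular[unfolded regular_for_def] AE_path AE_space
  proof eventually_elim
    case (elim \<omega>)
    have "hit 0 (path \<omega>) \<le> (INF t\<in>{t. 0 < t \<and> X t \<omega> \<in> {..<0}}. ennreal t)"
      using elim(2,3) by (intro INF_greatest hit_le cadlag_path) auto
    then show ?case using elim(1) by simp
  qed
  then have "mean_hit 0 = (\<integral>\<^sup>+\<omega>. 0 \<partial>M)"
    unfolding mean_hit_def by (rule nn_integral_cong_AE)
  then show ?thesis by simp
qed

text \<open>Pathwise, \<open>hit\<close> is right-continuous in the level at 0, because a value
  below 0 is also below \<open>- d\<close> for small \<open>d > 0\<close>. Finite means let the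
  decreasing limit pass through the integral, and the limit is
  \<open>mean_hit 0 = 0\<close>.\<close>

lemma mean_hit_right_0: "0 < e \<Longrightarrow> \<exists>n. \<forall>m\<ge>n. mean_hit (inverse (real (Suc m))) < e"
proof -
  assume e: "0 < e"
  let ?d = "\<lambda>n. inverse (real (Suc n))"
  have d: "?d m \<le> ?d n" if "n \<le> m" for m n using that by (simp add: field_simps)
  have "(INF n. hit (?d n) w) = hit 0 w" for w
  proof (rule antisym)
    show "(INF n. hit (?d n) w) \<le> hit 0 w"
    proof (rule ccontr)
      assume "\<not> ?thesis"
      then obtain r where r: "r \<in> \<rat>" "0 \<le> r" "w r < 0" "ennreal r < (INF n. hit (?d n) w)"
        by (auto simp: not_le hit_less_iff)
      obtain n where "?d n < - w r" using reals_Archimedean[of "- w r"] r by auto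
      then have "hit (?d n) w < (INF n. hit (?d n) w)" using r by (subst hit_less_iff) force
      then show False using INF_lower[of n UNIV "\<lambda>n. hit (?d n) w"] by simp
    qed
  qed (auto intro!: INF_greatest hit_mono)
  moreover have "(\<integral>\<^sup>+\<omega>. (INF n. hit (?d n) (path \<omega>)) \<partial>M) = (INF n. mean_hit (?d n))"
    unfolding mean_hit_def
  proof (rule nn_integral_monotone_convergence_INF_AE')
    show "(\<integral>\<^sup>+\<omega>. hit (?d 0) (path \<omega>) \<partial>M) < \<infinity>"
      using mean_hit_less_top[of "?d 0"] by (simp add: mean_hit_def)
  qed (auto intro!: hit_mono simp: field_simps)
  ultimately have "(INF n. mean_hit (?d n)) = 0"
    using mean_hit_0 by (simp add: mean_hit_def)
  then obtain n where "mean_hit (?d n) < e"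
    using e by (metis (no_types, lifting) INF_less_iff UNIV_I)
  then show ?thesis using mean_hit_mono[OF d] by (meson le_less_trans)
qed

text \<open>By subadditivity \<open>mean_hit y\<close> exceeds \<open>mean_hit (y - d)\<close> by at
  most \<open>mean_hit d\<close>, which is small for small \<open>d\<close>.\<close>

lemma SUP_mean_hit:
  assumes y: "0 < y"
  shows "(SUP n. mean_hit (y - inverse (real (Suc n)))) = mean_hit y"
proof (rule antisym)
  show "mean_hit y \<le> (SUP n. mean_hit (y - inverse (real (Suc n))))" (is "_ \<le> ?S")
  proof (rule ennreal_le_epsilon)
    fix e :: real assume "0 < e"
    then obtain n where n: "\<And>m. n \<le> m \<Longrightarrow> mean_hit (inverse (real (Suc m))) < ennreal e"
      using mean_hit_right_0[of "ennreal e"] by auto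
    obtain n' where n': "inverse (real (Suc n')) < y" using reals_Archimedean[OF y] by auto
    let ?d = "inverse (real (Suc (max n n')))"
    have "?d \<le> inverse (real (Suc n'))" by (simp add: field_simps)
    with n' have "?d \<le> y" by linarith
    then have "mean_hit ((y - ?d) + ?d) \<le> mean_hit (y - ?d) + mean_hit ?d"
      by (intro mean_hit_add_le) auto
    also have "\<dots> \<le> ?S + ennreal e"
      using n[of "max n n'"] by (intro add_mono SUP_upper) (auto simp: less_imp_le)
    finally show "mean_hit y \<le> ?S + ennreal e" by simp
  qed
qed (auto intro!: SUP_least mean_hit_mono)

text \<open>Two ordered random variables with the same finite mean coincide almost surely; the
  equality of means is the left-continuity of \<open>mean_hit\<close>.\<close>

lemma AE_hit_left:
  assumes y: "0 < y"
  shows "AE \<omega> in M. hit_left y (path \<omega>) = hit y (path \<omega>)"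
proof -
  have le: "hit_left y w \<le> hit y w" for w
    unfolding hit_left_def by (intro SUP_least hit_mono) simp
  have "(\<integral>\<^sup>+\<omega>. hit_left y (path \<omega>) \<partial>M) = (SUP n. mean_hit (y - inverse (real (Suc n))))"
    unfolding mean_hit_def hit_left_def
    by (intro nn_integral_monotone_convergence_SUP incseq_SucI le_funI hit_mono) (auto simp: field_simps)
  then have eq: "(\<integral>\<^sup>+\<omega>. hit_left y (path \<omega>) \<partial>M) = mean_hit y" using SUP_mean_hit[OF y] by simp
  have "(\<integral>\<^sup>+\<omega>. hit y (path \<omega>) - hit_left y (path \<omega>) \<partial>M) = 0"
    by (subst nn_integral_diff)
       (use le eq mean_hit_less_top[of y] in \<open>auto simp: mean_hit_def[symmetric] less_top[symmetric]\<close>)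
  then have "AE \<omega> in M. hit y (path \<omega>) - hit_left y (path \<omega>) = 0"
    by (subst (asm) nn_integral_0_iff_AE) measurable
  then show ?thesis
    using AE_hit_finite[OF mean_hit_less_top[of y]]
  proof eventually_elim
    case (elim \<omega>)
    then have "hit y (path \<omega>) \<le> hit_left y (path \<omega>)"
      by (simp add: ennreal_minus_eq_0)
    then show ?case using le by (simp add: antisym)
  qed
qed

text \<open>With \<open>h = 1\<close> the left side of the factorisation is a mean first passage
  into the closed half-line, which pathwise dominates \<open>hit z\<close> for \<open>z < y\<close>;
  left-continuity then reaches \<open>y\<close>. On the right, each inner integral is at most the
  total mass of \<open>U\<close>.\<close>

lemma mean_hit_le_renewal:
  assumes WH: "wiener_hopf_normalized M X U Ustar"
    and sets: "sets U = sets borel" "sets Ustar = sets borel" and y: "0 < y"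
  shows "mean_hit y \<le> emeasure U UNIV * emeasure Ustar ({0..} \<times> {0..y})"
proof -
  have "mean_hit z \<le> emeasure U UNIV * emeasure Ustar ({0..} \<times> {0..y})" if z: "z < y" for z
  proof -
    have [measurable]: "({0..} \<times> {0..<y} :: (real \<times> real) set) \<in> sets Ustar" "({0..} \<times> {0..} :: (real \<times> real) set) \<in> sets U"
      unfolding sets by (auto intro!: borel_Times)
    have "mean_hit z \<le> (\<integral>\<^sup>+\<omega>. (\<integral>\<^sup>+s\<in>{s. 0 \<le> s \<and> ennreal s < first_passage (\<lambda>t. y + X t \<omega>)}. 1 \<partial>lborel) \<partial>M)"
      unfolding mean_hit_def
    proof (rule nn_integral_mono_AE)
      show "AE \<omega> in M. hit z (path \<omega>) \<le>
          (\<integral>\<^sup>+s\<in>{s. 0 \<le> s \<and> ennreal s < first_passage (\<lambda>t. y + X t \<omega>)}. 1 \<partial>lborel)"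
        using AE_path AE_space AE_hit_finite[OF mean_hit_less_top[of z]]
      proof eventually_elim
        case (elim \<omega>)
        let ?h = "hit z (path \<omega>)"
        have "?h \<le> first_passage (\<lambda>t. y + path \<omega> t)"
          using elim(2) z by (intro hit_le_first_passage cadlag_path)
        also have "\<dots> = first_passage (\<lambda>t. y + X t \<omega>)"
          using elim(1) by (intro first_passage_cong) auto
        finally have le: "?h \<le> first_passage (\<lambda>t. y + X t \<omega>)" .
        have "s \<in> {s. 0 \<le> s \<and> ennreal s < first_passage (\<lambda>t. y + X t \<omega>)}" if "s \<in> {0..<enn2real ?h}" for s
        proof -
          have "ennreal s < ennreal (enn2real ?h)" using that by (auto simp: ennreal_less_iff)
          then show ?thesis using le elim(3) that by simp
        qed
        then have "(\<integral>\<^sup>+s\<in>{0..<enn2real ?h}. 1 \<partial>lborel) \<le>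
            (\<integral>\<^sup>+s\<in>{s. 0 \<le> s \<and> ennreal s < first_passage (\<lambda>t. y + X t \<omega>)}. 1 \<partial>lborel)"
          by (intro nn_integral_mono) (auto split: split_indicator)
        moreover have "(\<integral>\<^sup>+s\<in>{0..<enn2real ?h}. 1 \<partial>lborel) = ?h"
          using elim(3) by simp
        ultimately show ?case by simp
      qed
    qed
    also have "\<dots> = (\<integral>\<^sup>+p\<in>{0..} \<times> {0..<y}. (\<integral>\<^sup>+q\<in>{0..} \<times> {0..}.
              1 * indicator {0<..} (y - snd p + snd q) \<partial>U) \<partial>Ustar)"
      using WH[unfolded wiener_hopf_normalized_def, rule_format, OF y, of "\<lambda>_. 1"] by simp
    also have "\<dots> \<le> (\<integral>\<^sup>+p. emeasure U UNIV * indicator ({0..} \<times> {0..<y}) p \<partial>Ustar)"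
    proof (intro nn_integral_mono mult_right_mono)
      fix p
      have "(\<integral>\<^sup>+q\<in>{0..} \<times> {0..}. 1 * indicator {0<..} (y - snd p + snd q) \<partial>U) \<le> (\<integral>\<^sup>+q. 1 \<partial>U)"
        by (intro nn_integral_mono) (auto split: split_indicator)
      then show "(\<integral>\<^sup>+q\<in>{0..} \<times> {0..}. 1 * indicator {0<..} (y - snd p + snd q) \<partial>U) \<le> emeasure U UNIV"
        using sets_eq_imp_space_eq[OF sets(1)] by simp
    qed simp
    also have "\<dots> = emeasure U UNIV * emeasure Ustar ({0..} \<times> {0..<y})"
      by (rule nn_integral_cmult_indicator) measurable
    also have "\<dots> \<le> emeasure U UNIV * emeasure Ustar ({0..} \<times> {0..y})"
      by (intro mult_left_mono emeasure_mono) (auto simp: sets intro!: borel_Times)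
    finally show ?thesis .
  qed
  then have "(SUP n. mean_hit (y - inverse (real (Suc n)))) \<le> emeasure U UNIV * emeasure Ustar ({0..} \<times> {0..y})"
    by (intro SUP_least) simp
  then show ?thesis using SUP_mean_hit[OF y] by simp
qed

end

section \<open>Large negative jumps\<close>

text \<open>For cadlag \<open>w\<close>, \<open>0 < a\<close> and rational \<open>h\<close> this
  says that \<open>w\<close> has a jump of at most \<open>- a\<close> in \<open>{0<..h}\<close>.
  Ever closer pairs of rational times keep it measurable jointly in \<open>a\<close> and
  \<open>w\<close>.\<close>

definition has_drop :: "real \<Rightarrow> real \<Rightarrow> (real \<Rightarrow> real) \<Rightarrow> bool" where
  "has_drop h a w \<longleftrightarrow> (\<forall>m::nat. \<exists>u v :: rat. 0 \<le> u \<and> u < v \<and> of_rat v \<le> h \<and>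
     of_rat v - of_rat u < inverse (real (Suc m)) \<and> w (of_rat v) - w (of_rat u) < - a + inverse (real (Suc m)))"

lemma measurable_has_drop [measurable]:
  assumes [measurable]: "a \<in> borel_measurable N" "f \<in> N \<rightarrow>\<^sub>M paths"
  shows "Measurable.pred N (\<lambda>x. has_drop h (a x) (f x))"
proof -
  have [measurable]: "(\<lambda>x. f x t) \<in> borel_measurable N" for t
    by (rule measurable_compose[OF assms(2) measurable_coord])
  have *: "Measurable.pred N (\<lambda>x. f x t - f x s < - a x + c)" for s t c by measurable
  show ?thesis
    unfolding has_drop_def
    by (intro pred_intros_countable pred_intros_logic * measurable_const) simp_all
qed

lemma cadlag_jump: "cadlag w \<Longrightarrow> 0 < s \<Longrightarrow> jump w s = w s - lval s w"
  by (rule jump_eq[OF _ cadlag_tendsto_lval])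

lemma jump_post:
  assumes w: "cadlag w" and "0 \<le> t" "0 < s"
  shows "jump (post t w) s = jump w (t + s)"
proof -
  have "jump (post t w) s = jump (\<lambda>r. w (t + r) - w t) s"
    by (rule jump_cong) (use assms in \<open>auto simp: post_def\<close>)
  also have "\<dots> = jump (\<lambda>r. w r - w t) (t + s)"
    using assms by (intro jump_shift[of s t "\<lambda>r. w r - w t"]) auto
  also have "\<dots> = (w (t + s) - w t) - (lval (t + s) w - w t)"
    using assms by (intro jump_eq tendsto_diff cadlag_tendsto_lval tendsto_const) auto
  also have "\<dots> = jump w (t + s)" using assms by (simp add: cadlag_jump)
  finally show ?thesis .
qed

lemma has_drop_jump:
  assumes w: "cadlag w" and h: "h \<in> \<rat>" and s: "0 < s" "s \<le> h" and j: "jump w s \<le> - a"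
  shows "has_drop h a w"
  unfolding has_drop_def
proof
  fix m :: nat
  define e where "e = inverse (real (Suc m)) / 2"
  have e: "0 < e" by (simp add: e_def)
  have "\<forall>\<^sub>F u in at_left s. dist (w u) (lval s w) < e"
    using cadlag_tendsto_lval[OF w s(1)] e by (simp add: tendsto_iff)
  then obtain b where b: "b < s" "\<And>u. b < u \<Longrightarrow> u < s \<Longrightarrow> dist (w u) (lval s w) < e"
    by (auto simp: eventually_at_left_field)
  obtain u where u: "u \<in> \<rat>" "max b (max 0 (s - e)) < u" "u < s"
    using Rats_dense_in_real[of "max b (max 0 (s - e))" s] b(1) s(1) e by auto
  \<comment> \<open>A jump exactly at \<open>h\<close> leaves no room to its right, so
    \<open>v = h\<close> must be allowed; hence the rationality of \<open>h\<close>.\<close>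
  have "\<exists>v\<in>\<rat>. s \<le> v \<and> v \<le> h \<and> v < s + e \<and> dist (w v) (w s) < e"
  proof (cases "s = h")
    case True
    then show ?thesis using h e by (intro bexI[of _ h]) auto
  next
    case False
    have "\<forall>\<^sub>F v in at_right s. dist (w v) (w s) < e"
      using cadlag_tendsto_right[OF w, of s] s e by (simp add: tendsto_iff)
    then obtain c where c: "s < c" "\<And>v. s < v \<Longrightarrow> v < c \<Longrightarrow> dist (w v) (w s) < e"
      by (auto simp: eventually_at_right_field)
    obtain v where "v \<in> \<rat>" "s < v" "v < min c (min h (s + e))"
      using Rats_dense_in_real[of s "min c (min h (s + e))"] c(1) s False e by auto
    then show ?thesis using c(2)[of v] by (intro bexI[of _ v]) auto
  qed
  then obtain v where v: "v \<in> \<rat>" "s \<le> v" "v \<le> h" "v < s + e" "dist (w v) (w s) < e" by auto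
  have "w v - w u < w s - lval s w + 2 * e"
    using v(5) b(2)[of u] u by (auto simp: dist_real_def)
  also have "w s - lval s w \<le> - a" using j cadlag_jump[OF w s(1)] by simp
  finally have "w v - w u < - a + inverse (real (Suc m))" by (simp add: e_def)
  moreover have "v - u < inverse (real (Suc m))" using u v(4) by (simp add: e_def)
  moreover obtain u' v' :: rat where uv: "u = of_rat u'" "v = of_rat v'"
    using u(1) v(1) by (auto elim!: Rats_cases)
  moreover have "0 < u" "u < v" using u(2,3) v(2) by auto
  then have "0 < u'" "u' < v'" unfolding uv by (simp_all add: of_rat_less)
  ultimately show "\<exists>u v :: rat. 0 \<le> u \<and> u < v \<and> of_rat v \<le> h \<and>
     of_rat v - of_rat u < inverse (real (Suc m)) \<and> w (of_rat v) - w (of_rat u) < - a + inverse (real (Suc m))"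
    using v(3) by (intro exI[of _ u'] exI[of _ v']) simp
qed

text \<open>By compactness the left ends of the approximate drops cluster at some \<open>s\<close>.
  Unless \<open>s\<close> carries a jump of at most \<open>- a\<close>, close pairs of times near
  \<open>s\<close> cannot drop by almost \<open>a\<close>.\<close>

lemma jump_has_drop:
  assumes w: "cadlag w" and a: "0 < a" and d: "has_drop h a w"
  shows "\<exists>s. 0 < s \<and> s \<le> h \<and> jump w s \<le> - a"
proof (rule ccontr)
  assume no: "\<not> ?thesis"
  have "\<forall>m. \<exists>u v. 0 \<le> u \<and> u < v \<and> v \<le> h \<and> v - u < inverse (real (Suc m)) \<and> w v - w u < - a + inverse (real (Suc m))"
  proof
    fix m
    obtain u v :: rat where "0 \<le> u \<and> u < v \<and> of_rat v \<le> h \<and>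
       of_rat v - of_rat u < inverse (real (Suc m)) \<and> w (of_rat v) - w (of_rat u) < - a + inverse (real (Suc m))"
      using d unfolding has_drop_def by blast
    then show "\<exists>u v. 0 \<le> u \<and> u < v \<and> v \<le> h \<and> v - u < inverse (real (Suc m)) \<and> w v - w u < - a + inverse (real (Suc m))"
      by (intro exI[of _ "of_rat u"] exI[of _ "of_rat v"]) (auto simp: of_rat_less)
  qed
  then obtain u v where uv: "\<And>m. 0 \<le> u m" "\<And>m. u m < v m" "\<And>m. v m \<le> h"
    "\<And>m. v m - u m < inverse (real (Suc m))" "\<And>m. w (v m) - w (u m) < - a + inverse (real (Suc m))"
    by metis
  have "u m \<in> {0..h}" for m using uv(1-3)[of m] by auto
  then obtain s r where s: "s \<in> {0..h}" and r: "strict_mono r" "(u \<circ> r) \<longlonglongrightarrow> s"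
    using compact_Icc[of 0 h] unfolding compact_eq_seq_compact_metric seq_compact_def by metis
  \<comment> \<open>Half the amount by which the jump at \<open>s\<close> stays above
    \<open>- a\<close>, capped by \<open>a / 2\<close>; at \<open>s = 0\<close> there is no jump to
    consider.\<close>
  define \<eta> where "\<eta> = (if 0 < s then min (a / 2) ((jump w s + a) / 2) else a / 2)"
  have \<eta>: "0 < \<eta>" using no s a unfolding \<eta>_def by (auto simp: not_le)
  define e where "e = \<eta> / 2"
  have e: "0 < e" "2 * e \<le> a / 2" "0 < s \<Longrightarrow> 2 * e \<le> (jump w s + a) / 2"
    using \<eta> by (auto simp: e_def \<eta>_def min_def)
  have "\<forall>\<^sub>F v in at_right s. dist (w v) (w s) < e"
    using cadlag_tendsto_right[OF w, of s] s e by (simp add: tendsto_iff)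
  then obtain c where c: "s < c" "\<And>v. s < v \<Longrightarrow> v < c \<Longrightarrow> dist (w v) (w s) < e"
    by (auto simp: eventually_at_right_field)
  have c': "dist (w v) (w s) < e" if "s \<le> v" "v < c" for v
    using c(2)[of v] that e by (cases "v = s") auto
  obtain b where b: "b < s" "\<And>u. 0 < s \<Longrightarrow> b < u \<Longrightarrow> u < s \<Longrightarrow> dist (w u) (lval s w) < e"
  proof (cases "0 < s")
    case True
    have "\<forall>\<^sub>F u in at_left s. dist (w u) (lval s w) < e"
      using cadlag_tendsto_lval[OF w True] e by (simp add: tendsto_iff)
    then show ?thesis using that by (auto simp: eventually_at_left_field)
  qed (use that[of "s - 1"] in auto)
  have ge: "w v - w u \<ge> - a + \<eta>" if "b < u" "u < v" "v < c" "0 \<le> u" for u v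
  proof -
    \<comment> \<open>On either side of \<open>s\<close> the path is nearly constant; across
      \<open>s\<close> the difference is nearly the jump.\<close>
    consider "s \<le> u" | "v < s" | "u < s" "s \<le> v" by linarith
    then show ?thesis
    proof cases
      case 1
      then have "dist (w u) (w s) < e" "dist (w v) (w s) < e" using c' that by auto
      then show ?thesis using e(2) \<eta> unfolding dist_real_def e_def by linarith
    next
      case 2
      then have "dist (w u) (lval s w) < e" "dist (w v) (lval s w) < e" using b(2) that by auto
      then show ?thesis using e(2) \<eta> unfolding dist_real_def e_def by linarith
    next
      case 3
      then have "0 < s" using that by simp
      then have "dist (w u) (lval s w) < e" "dist (w v) (w s) < e" using b(2) c' 3 that \<open>0 < s\<close> by auto
      then have "w u < lval s w + e" "w s - e < w v" by (auto simp: dist_real_def)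
      moreover have "2 * (2 * e) \<le> w s - lval s w + a"
        using e(3)[OF \<open>0 < s\<close>] cadlag_jump[OF w \<open>0 < s\<close>] by simp
      moreover have "\<eta> = 2 * e" by (simp add: e_def)
      ultimately show ?thesis by linarith
    qed
  qed
  have inv: "(\<lambda>m. inverse (real (Suc (r m)))) \<longlonglongrightarrow> 0"
    using LIMSEQ_subseq_LIMSEQ[OF LIMSEQ_inverse_real_of_nat r(1)] by (simp add: o_def)
  have "(\<lambda>m. u (r m) + inverse (real (Suc (r m)))) \<longlonglongrightarrow> s + 0"
    using r(2) inv by (intro tendsto_add) (simp_all add: o_def)
  then have "\<forall>\<^sub>F m in sequentially. u (r m) + inverse (real (Suc (r m))) < c"
    using c(1) by (intro order_tendstoD(2)) auto
  moreover have "\<forall>\<^sub>F m in sequentially. b < u (r m)"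
    using r(2) b(1) by (intro order_tendstoD(1)) (simp_all add: o_def)
  moreover have "\<forall>\<^sub>F m in sequentially. inverse (real (Suc (r m))) < \<eta>"
    using inv \<eta> by (rule order_tendstoD(2))
  ultimately have "\<forall>\<^sub>F m in sequentially. False"
  proof eventually_elim
    case (elim m)
    then show False
      using ge[of "u (r m)" "v (r m)"] uv[of "r m"] by auto
  qed
  then show False by simp
qed

section \<open>Jump frequency and the Levy measure\<close>

context levy
begin

lemma stopped_post_distr:
  assumes t: "0 \<le> t"
  shows "distr M (paths \<Otimes>\<^sub>M paths) (\<lambda>\<omega>. (stopped t (path \<omega>), post t (path \<omega>))) =
    distr M paths (\<lambda>\<omega>. stopped t (path \<omega>)) \<Otimes>\<^sub>M distr M paths path"
proof (rule pair_measure_eqI[symmetric])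
  interpret A: prob_space "distr M paths (\<lambda>\<omega>. stopped t (path \<omega>))" by (rule prob_space_distr) measurable
  interpret B: prob_space "distr M paths path" by (rule prob_space_distr) measurable
  show "sigma_finite_measure (distr M paths (\<lambda>\<omega>. stopped t (path \<omega>)))" "sigma_finite_measure (distr M paths path)"
    by (rule A.sigma_finite_measure_axioms B.sigma_finite_measure_axioms)+
  show "sets (distr M paths (\<lambda>\<omega>. stopped t (path \<omega>)) \<Otimes>\<^sub>M distr M paths path) =
      sets (distr M (paths \<Otimes>\<^sub>M paths) (\<lambda>\<omega>. (stopped t (path \<omega>), post t (path \<omega>))))"
    by (simp cong: sets_pair_measure_cong)
  fix C D assume "C \<in> sets (distr M paths (\<lambda>\<omega>. stopped t (path \<omega>)))" "D \<in> sets (distr M paths path)"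
  then have [measurable]: "C \<in> sets paths" "D \<in> sets paths" by auto
  have "emeasure M {\<omega>\<in>space M. stopped t (path \<omega>) \<in> C \<and> post t (path \<omega>) \<in> D} =
      emeasure M {\<omega>\<in>space M. stopped t (path \<omega>) \<in> C} * emeasure M {\<omega>\<in>space M. path \<omega> \<in> D}"
    unfolding emeasure_eq_measure using prob_stopped_post[of C D t] t by (simp add: ennreal_mult'')
  moreover have "emeasure (distr M paths (\<lambda>\<omega>. stopped t (path \<omega>))) C = emeasure M {\<omega>\<in>space M. stopped t (path \<omega>) \<in> C}"
    by (subst emeasure_distr) (auto intro!: arg_cong[where f="emeasure M"])
  moreover have "emeasure (distr M paths path) D = emeasure M {\<omega>\<in>space M. path \<omega> \<in> D}"
    by (subst emeasure_distr) (auto intro!: arg_cong[where f="emeasure M"])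
  moreover have "emeasure (distr M (paths \<Otimes>\<^sub>M paths) (\<lambda>\<omega>. (stopped t (path \<omega>), post t (path \<omega>)))) (C \<times> D) =
      emeasure M {\<omega>\<in>space M. stopped t (path \<omega>) \<in> C \<and> post t (path \<omega>) \<in> D}"
    by (subst emeasure_distr) (auto intro!: arg_cong[where f="emeasure M"])
  ultimately show "emeasure (distr M paths (\<lambda>\<omega>. stopped t (path \<omega>))) C * emeasure (distr M paths path) D =
      emeasure (distr M (paths \<Otimes>\<^sub>M paths) (\<lambda>\<omega>. (stopped t (path \<omega>), post t (path \<omega>)))) (C \<times> D)" by simp
qed

lemma nn_integral_stopped_post:
  assumes t: "0 \<le> t" and \<phi> [measurable]: "\<phi> \<in> borel_measurable (paths \<Otimes>\<^sub>M paths)"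
  shows "(\<integral>\<^sup>+\<omega>. \<phi> (stopped t (path \<omega>), post t (path \<omega>)) \<partial>M) =
    (\<integral>\<^sup>+\<omega>. (\<integral>\<^sup>+\<omega>'. \<phi> (stopped t (path \<omega>), path \<omega>') \<partial>M) \<partial>M)"
proof -
  interpret P: prob_space "distr M paths path" by (rule prob_space_distr) measurable
  let ?Z = "\<lambda>\<omega>. stopped t (path \<omega>)"
  have "(\<integral>\<^sup>+\<omega>. \<phi> (?Z \<omega>, post t (path \<omega>)) \<partial>M) =
      (\<integral>\<^sup>+p. \<phi> p \<partial>distr M (paths \<Otimes>\<^sub>M paths) (\<lambda>\<omega>. (?Z \<omega>, post t (path \<omega>))))"
    by (subst nn_integral_distr) auto
  also have "\<dots> = (\<integral>\<^sup>+p. \<phi> p \<partial>(distr M paths ?Z \<Otimes>\<^sub>M distr M paths path))"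
    unfolding stopped_post_distr[OF t] ..
  also have "\<dots> = (\<integral>\<^sup>+z. (\<integral>\<^sup>+w. \<phi> (z, w) \<partial>distr M paths path) \<partial>distr M paths ?Z)"
    by (subst P.nn_integral_fst[symmetric]) (simp_all cong: measurable_cong_sets)
  also have "\<dots> = (\<integral>\<^sup>+z. (\<integral>\<^sup>+\<omega>'. \<phi> (z, path \<omega>') \<partial>M) \<partial>distr M paths ?Z)"
  proof (rule nn_integral_cong)
    fix z
    show "(\<integral>\<^sup>+w. \<phi> (z, w) \<partial>distr M paths path) = (\<integral>\<^sup>+\<omega>'. \<phi> (z, path \<omega>') \<partial>M)"
      by (subst nn_integral_distr) (auto simp: space_PiM)
  qed
  also have "\<dots> = (\<integral>\<^sup>+\<omega>. (\<integral>\<^sup>+\<omega>'. \<phi> (?Z \<omega>, path \<omega>') \<partial>M) \<partial>M)"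
    by (subst nn_integral_distr) auto
  finally show ?thesis .
qed

lemma jump_path: "\<omega> \<in> space M \<Longrightarrow> 0 < s \<Longrightarrow> jump (path \<omega>) s = jump (\<lambda>t. X t \<omega>) s"
proof -
  assume "\<omega> \<in> space M" "0 < s"
  moreover then have "cadlag (\<lambda>t. X t \<omega>)" using levy by (simp add: levy_process_def)
  moreover have "path \<omega> = post 0 (\<lambda>t. X t \<omega>)" by (simp add: path_def post_def)
  ultimately show ?thesis using jump_post[of "\<lambda>t. X t \<omega>" 0 s] by simp
qed

text \<open>Cut the unit interval into \<open>N\<close> blocks. By stationarity each has a drop with
  the same probability, and blocks with a drop contribute distinct jumps, whose expected number over
  unit time is given by the Levy measure.\<close>

lemma prob_has_drop_le:
  assumes \<pi>: "is_levy_measure M X \<pi>" and a: "0 < a" and N: "0 < N"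
  shows "of_nat N * emeasure M {\<omega>\<in>space M. has_drop (1 / real N) a (path \<omega>)} \<le> emeasure \<pi> {..- a}"
proof -
  let ?t = "\<lambda>i. real i / real N" and ?h = "1 / real N"
  let ?J = "\<lambda>\<omega>. {s\<in>{0<..1}. jump (\<lambda>t. X t \<omega>) s \<in> {..- a} - {0}}"
  define D where "D = {w \<in> space paths. has_drop ?h a w}"
  have D [measurable]: "D \<in> sets paths" unfolding D_def by measurable
  have D_iff: "w \<in> D \<longleftrightarrow> has_drop ?h a w" for w by (simp add: D_def space_PiM)
  have "emeasure M {\<omega>\<in>space M. post (?t i) (path \<omega>) \<in> D} = emeasure M {\<omega>\<in>space M. path \<omega> \<in> D}" for i
    unfolding emeasure_eq_measure by (subst prob_post[OF D]) auto
  then have "of_nat N * emeasure M {\<omega>\<in>space M. path \<omega> \<in> D} =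
      (\<Sum>i<N. emeasure M {\<omega>\<in>space M. post (?t i) (path \<omega>) \<in> D})" by simp
  also have "\<dots> = (\<Sum>i<N. \<integral>\<^sup>+\<omega>. indicator D (post (?t i) (path \<omega>)) \<partial>M)"
  proof (intro sum.cong refl)
    fix i
    have "(\<integral>\<^sup>+\<omega>. indicator D (post (?t i) (path \<omega>)) \<partial>M) =
        (\<integral>\<^sup>+\<omega>. indicator {\<omega>\<in>space M. post (?t i) (path \<omega>) \<in> D} \<omega> \<partial>M)"
      by (intro nn_integral_cong) (auto split: split_indicator)
    then show "emeasure M {\<omega>\<in>space M. post (?t i) (path \<omega>) \<in> D} = (\<integral>\<^sup>+\<omega>. indicator D (post (?t i) (path \<omega>)) \<partial>M)"
      by simp
  qed
  also have "\<dots> = (\<integral>\<^sup>+\<omega>. (\<Sum>i<N. indicator D (post (?t i) (path \<omega>))) \<partial>M)"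
    by (rule nn_integral_sum[symmetric]) measurable
  also have "\<dots> \<le> (\<integral>\<^sup>+\<omega>. emeasure (count_space UNIV) (?J \<omega>) \<partial>M)"
  proof (rule nn_integral_mono)
    fix \<omega> assume \<omega>: "\<omega> \<in> space M"
    define I where "I = {i\<in>{..<N}. post (?t i) (path \<omega>) \<in> D}"
    have I: "finite I" "I \<subseteq> {..<N}" by (auto simp: I_def)
    have "\<exists>s. ?t i < s \<and> s \<le> ?t (Suc i) \<and> s \<in> ?J \<omega>" if i: "i \<in> I" for i
    proof -
      have "cadlag (post (?t i) (path \<omega>))" by (intro cadlag_post cadlag_path \<omega>) auto
      from jump_has_drop[OF this a, of ?h] i obtain s where s: "0 < s" "s \<le> ?h" "jump (post (?t i) (path \<omega>)) s \<le> - a"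
        by (auto simp: I_def D_iff)
      have "jump (post (?t i) (path \<omega>)) s = jump (path \<omega>) (?t i + s)"
        using s(1) by (intro jump_post cadlag_path \<omega>) auto
      also have "\<dots> = jump (\<lambda>t. X t \<omega>) (?t i + s)"
        using s(1) by (intro jump_path \<omega> add_nonneg_pos) auto
      finally have "jump (\<lambda>t. X t \<omega>) (?t i + s) \<le> - a" using s(3) by simp
      moreover have "?t i + s \<le> ?t (Suc i)" using s(2) by (simp add: add_divide_distrib)
      moreover have "?t (Suc i) \<le> 1" using i I(2) N by (auto simp: field_simps)
      ultimately show ?thesis
        using s(1) a add_nonneg_pos[of "?t i" s] by (intro exI[of _ "?t i + s"]) auto
    qed
    then have "\<forall>i\<in>I. \<exists>s. ?t i < s \<and> s \<le> ?t (Suc i) \<and> s \<in> ?J \<omega>" by blast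
    from bchoice[OF this] obtain s where "\<forall>i\<in>I. ?t i < s i \<and> s i \<le> ?t (Suc i) \<and> s i \<in> ?J \<omega>" ..
    then have s: "?t i < s i" "s i \<le> ?t (Suc i)" "s i \<in> ?J \<omega>" if "i \<in> I" for i
      using that by blast+
    \<comment> \<open>The chosen jump times lie in disjoint half-open blocks.\<close>
    have "inj_on s I"
    proof (rule linorder_inj_onI)
      fix i j assume ij: "i < j" "i \<in> I" "j \<in> I"
      then have "?t (Suc i) \<le> ?t j" by (intro divide_right_mono) auto
      then show "s i \<noteq> s j" using s(2)[OF ij(2)] s(1)[OF ij(3)] by simp
    qed auto
    have "(\<Sum>i<N. indicator D (post (?t i) (path \<omega>)) :: ennreal) = of_nat (card I)"
      by (simp add: I_def indicator_def sum.If_cases Int_def)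
    also have "\<dots> = emeasure (count_space UNIV) (s ` I)"
      using I(1) \<open>inj_on s I\<close> by (simp add: card_image)
    also have "\<dots> \<le> emeasure (count_space UNIV) (?J \<omega>)"
      using s(3) by (intro emeasure_mono) auto
    finally show "(\<Sum>i<N. indicator D (post (?t i) (path \<omega>))) \<le> emeasure (count_space UNIV) (?J \<omega>)" .
  qed
  also have "\<dots> = emeasure \<pi> {..- a}"
    using \<pi> by (simp add: is_levy_measure_def)
  finally show ?thesis by (simp add: D_iff)
qed

end

lemma sum_indicator_le_ennreal:
  "(\<Sum>k<K. indicator {k. ennreal (real k) \<le> c} k :: ennreal) \<le> c + 1"
proof (induction K)
  case (Suc K)
  show ?case
  proof (cases "ennreal (real K) \<le> c")
    case True
    have "(\<Sum>k<Suc K. indicator {k. ennreal (real k) \<le> c} k :: ennreal) \<le> (\<Sum>k<Suc K. 1)"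
      by (intro sum_mono) (simp add: indicator_def)
    also have "\<dots> = ennreal (real K) + 1" by (simp add: ennreal_of_nat_eq_real_of_nat)
    also have "\<dots> \<le> c + 1" using True by (intro add_right_mono)
    finally show ?thesis .
  next
    case False
    then show ?thesis using Suc by simp
  qed
qed simp

text \<open>A Riemann sum for the length \<open>c\<close>: the grid points up to \<open>c\<close>,
  with 0 included, number at most \<open>N * c + 1\<close>, and the extra point costs one mesh
  width.\<close>

lemma suminf_grid_indicator_le:
  assumes N: "0 < N"
  shows "(\<Sum>k. ennreal (1 / real N) * indicator {k. ennreal (real k / real N) \<le> c} k) \<le> c + ennreal (1 / real N)"
proof -
  have sets: "{k. ennreal (real k / real N) \<le> c} = {k. ennreal (real k) \<le> ennreal (real N) * c}"
  proof (intro Collect_cong)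
    fix k
    have eq: "ennreal (real k) = ennreal (real N) * ennreal (real k / real N)"
      using N by (subst ennreal_mult[symmetric]) auto
    show "(ennreal (real k / real N) \<le> c) = (ennreal (real k) \<le> ennreal (real N) * c)"
      unfolding eq using N by (subst ennreal_mult_le_mult_iff) auto
  qed
  have "(\<Sum>k. indicator {k. ennreal (real k / real N) \<le> c} k) \<le> ennreal (real N) * c + 1"
    unfolding sets by (subst suminf_eq_SUP) (auto intro!: SUP_least sum_indicator_le_ennreal)
  then have "ennreal (1 / real N) * (\<Sum>k. indicator {k. ennreal (real k / real N) \<le> c} k) \<le>
      ennreal (1 / real N) * (ennreal (real N) * c + 1)"
    by (intro mult_left_mono) auto
  also have "\<dots> = c + ennreal (1 / real N)"
    using N by (simp add: distrib_left mult.assoc[symmetric] ennreal_mult[symmetric])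
  finally show ?thesis by simp
qed

lemma hit_pos:
  assumes w: "cadlag w" "w 0 = 0" and y: "0 < y"
  shows "0 < hit y w"
proof -
  have "\<forall>\<^sub>F t in at_right 0. - y < w t"
    using cadlag_tendsto_right[OF w(1), of 0] w(2) y by (intro order_tendstoD(1)) auto
  then obtain b where b: "0 < b" "\<And>t. 0 < t \<Longrightarrow> t < b \<Longrightarrow> - y < w t"
    by (auto simp: eventually_at_right_field)
  have "\<not> hit y w < ennreal b"
  proof
    assume "hit y w < ennreal b"
    then obtain r where r: "0 \<le> r" "w r < - y" "r < b"
      by (auto simp: hit_less_iff ennreal_less_iff)
    then show False using b(2)[of r] w(2) y by (cases "r = 0") auto
  qed
  then show ?thesis using b(1) by (metis ennreal_less_zero_iff less_le_trans not_less)
qed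

lemma pre_level_nonneg:
  assumes w: "cadlag w" and y: "0 \<le> y" and fin: "hit y w < \<top>"
  shows "0 \<le> pre_level y w"
proof (cases "hit y w = 0")
  case False
  let ?T = "enn2real (hit y w)"
  have T: "0 < ?T" using False fin by (simp add: enn2real_positive_iff zero_less_iff_neq_zero)
  have "\<forall>\<^sub>F t in at_left ?T. - y \<le> w t"
  proof -
    have "\<forall>\<^sub>F t in at_left ?T. t \<in> {0<..<?T}" by (rule eventually_at_left_real[OF T])
    then show ?thesis
    proof eventually_elim
      case (elim t)
      then have "ennreal t < ennreal ?T" by (simp add: ennreal_less_iff)
      then show ?case using elim fin by (intro hit_before[OF w]) auto
    qed
  qed
  then have "- y \<le> lval ?T w"
    by (intro tendsto_lowerbound[OF cadlag_tendsto_lval[OF w T]]) auto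
  then show ?thesis using False by (simp add: pre_level_def)
qed (use y in \<open>simp add: pre_level_def\<close>)

context levy_to_minus_infinity
begin

lemma mean_hit_nonpos: "y \<le> 0 \<Longrightarrow> mean_hit y = 0"
  using mean_hit_mono[of y 0] by (simp add: mean_hit_0)

text \<open>Compensation formula, as an inequality: a passage by a jump from level \<open>Y > 0\<close> is preceded by
  a dyadic time \<open>k / N\<close> with \<open>y + X(k / N)\<close> close to \<open>Y\<close> and followed, within \<open>1 / N\<close>, by a drop
  of at least that size.\<close>

definition drop_weight :: "nat \<Rightarrow> real \<Rightarrow> real \<Rightarrow> nat \<Rightarrow> (real \<Rightarrow> real) \<Rightarrow> (real \<Rightarrow> real) \<Rightarrow> ennreal" where
  "drop_weight N e y k v w =
     (if ennreal (real k / real N) \<le> hit y v \<and> has_drop (1 / real N) (y + v (real k / real N) - e) w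
      then mean_hit (y + v (real k / real N) - e) else 0)"

lemma measurable_drop_weight [measurable]:
  "(\<lambda>p. drop_weight N e y k (fst p) (snd p)) \<in> borel_measurable (paths \<Otimes>\<^sub>M paths)"
proof -
  have [measurable]: "(\<lambda>p. fst p (real k / real N)) \<in> borel_measurable (paths \<Otimes>\<^sub>M paths)"
    by (rule measurable_compose[OF measurable_fst measurable_coord])
  show ?thesis unfolding drop_weight_def by measurable
qed

text \<open>Whether the passage is still to come, and the current level, depend on the path up to
  \<open>k / N\<close>; the drop concerns the independent future. Given the past, the mean weight is
  at most \<open>mean_hit a * \<pi> {..- a} / N\<close> for \<open>a > 0\<close>, hence at most
  \<open>q / N\<close>; for \<open>a \<le> 0\<close> it is 0.\<close>

lemma nn_integral_drop_weight:
  assumes \<pi>: "is_levy_measure M X \<pi>" and bound: "\<And>a. 0 < a \<Longrightarrow> mean_hit a * emeasure \<pi> {..- a} \<le> q"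
    and N: "0 < N"
  shows "(\<integral>\<^sup>+\<omega>. drop_weight N e y k (path \<omega>) (post (real k / real N) (path \<omega>)) \<partial>M) \<le>
    (\<integral>\<^sup>+\<omega>. q * (ennreal (1 / real N) * indicator {k. ennreal (real k / real N) \<le> hit y (path \<omega>)} k) \<partial>M)"
proof -
  define t where "t = real k / real N"
  have t: "0 \<le> t" by (simp add: t_def)
  have stop: "drop_weight N e y k v w = drop_weight N e y k (stopped t v) w" for v w
  proof -
    \<comment> \<open>The weak inequality matters: its negation \<open>hit y v < ennreal t\<close>
      is decided by the path stopped at \<open>t\<close>.\<close>
    have "ennreal t \<le> hit y v \<longleftrightarrow> ennreal t \<le> hit y (stopped t v)"
    proof (cases "t = 0")
      case False
      then show ?thesis using t hit_stopped_less_iff[of t "ennreal t" y v] by (auto simp: not_less[symmetric])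
    qed simp
    moreover have "stopped t v t = v t" using t by (simp add: stopped_def)
    ultimately show ?thesis by (simp add: drop_weight_def t_def[symmetric])
  qed
  have le: "(\<integral>\<^sup>+\<omega>'. drop_weight N e y k v (path \<omega>') \<partial>M) \<le>
      q * (ennreal (1 / real N) * indicator {k. ennreal (real k / real N) \<le> hit y v} k)" for v
  proof -
    define a where "a = y + v t - e"
    have "(\<integral>\<^sup>+\<omega>'. drop_weight N e y k v (path \<omega>') \<partial>M) \<le>
      (\<integral>\<^sup>+\<omega>'. (mean_hit a * indicator {k. ennreal (real k / real N) \<le> hit y v} k) * indicator {\<omega>\<in>space M. has_drop (1 / real N) a (path \<omega>)} \<omega>' \<partial>M)"
      by (intro nn_integral_mono) (auto simp: drop_weight_def a_def t_def indicator_def)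
    also have "\<dots> = (mean_hit a * indicator {k. ennreal (real k / real N) \<le> hit y v} k) * emeasure M {\<omega>\<in>space M. has_drop (1 / real N) a (path \<omega>)}"
      by (rule nn_integral_cmult_indicator) measurable
    also have "\<dots> \<le> q * (ennreal (1 / real N) * indicator {k. ennreal (real k / real N) \<le> hit y v} k)"
    proof (cases "0 < a")
      case True
      let ?p = "emeasure M {\<omega>\<in>space M. has_drop (1 / real N) a (path \<omega>)}"
      have "?p = ennreal (1 / real N) * (of_nat N * ?p)"
        using N by (simp add: mult.assoc[symmetric] ennreal_of_nat_eq_real_of_nat ennreal_mult[symmetric])
      also have "\<dots> \<le> ennreal (1 / real N) * emeasure \<pi> {..- a}"
        by (intro mult_left_mono prob_has_drop_le[OF \<pi> True N]) simp
      finally have "mean_hit a * ?p \<le> mean_hit a * (ennreal (1 / real N) * emeasure \<pi> {..- a})"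
        by (rule mult_left_mono) simp
      also have "\<dots> = (mean_hit a * emeasure \<pi> {..- a}) * ennreal (1 / real N)" by (simp add: ac_simps)
      also have "\<dots> \<le> q * ennreal (1 / real N)" by (intro mult_right_mono bound True) simp
      finally have "mean_hit a * ?p \<le> q * ennreal (1 / real N)" .
      then show ?thesis by (simp add: indicator_def)
    qed (simp add: mean_hit_nonpos)
    finally show ?thesis .
  qed
  have "(\<integral>\<^sup>+\<omega>. drop_weight N e y k (path \<omega>) (post t (path \<omega>)) \<partial>M) =
      (\<integral>\<^sup>+\<omega>. drop_weight N e y k (stopped t (path \<omega>)) (post t (path \<omega>)) \<partial>M)"
    using stop by simp
  also have "\<dots> = (\<integral>\<^sup>+\<omega>. (\<integral>\<^sup>+\<omega>'. drop_weight N e y k (stopped t (path \<omega>)) (path \<omega>') \<partial>M) \<partial>M)"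
    using nn_integral_stopped_post[OF t measurable_drop_weight, of N e y k] by simp
  also have "\<dots> = (\<integral>\<^sup>+\<omega>. (\<integral>\<^sup>+\<omega>'. drop_weight N e y k (path \<omega>) (path \<omega>') \<partial>M) \<partial>M)"
    using stop by simp
  also have "\<dots> \<le> (\<integral>\<^sup>+\<omega>. q * (ennreal (1 / real N) * indicator {k. ennreal (real k / real N) \<le> hit y (path \<omega>)} k) \<partial>M)"
    by (intro nn_integral_mono le)
  finally show ?thesis by (simp add: t_def)
qed

text \<open>One summand suffices, that of the last grid time strictly before the passage. A passage
  without a jump has level 0 before it, where the left side vanishes.\<close>

lemma mean_hit_le_liminf_drop_weight:
  assumes w: "cadlag w" "w 0 = 0" and y: "0 < y" and e: "0 < e" and fin: "hit y w < \<top>"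
  shows "mean_hit (pre_level y w - 2 * e) \<le>
    liminf (\<lambda>K. \<Sum>k. drop_weight (2 ^ K) e y k w (post (real k / real (2 ^ K)) w))"
proof (cases "pre_level y w - 2 * e \<le> 0")
  case False
  let ?T = "enn2real (hit y w)"
  have hit0: "hit y w \<noteq> 0" using hit_pos[OF w y] by simp
  have T: "0 < ?T" "hit y w = ennreal ?T"
    using hit0 fin by (auto simp: enn2real_positive_iff zero_less_iff_neq_zero)
  define Y where "Y = pre_level y w"
  have Y: "lval ?T w = Y - y" using hit0 by (simp add: Y_def pre_level_def)
  let ?t = "\<lambda>K. (of_int \<lceil>?T * 2 ^ K\<rceil> - 1) / (2::real) ^ K"
  have "(\<lambda>K. w (?t K)) \<longlonglongrightarrow> Y - y"
    using filterlim_compose[OF cadlag_tendsto_lval[OF w(1) T(1)] filterlim_ceiling_dyadic] by (simp add: Y)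
  then have "\<forall>\<^sub>F K in sequentially. dist (w (?t K)) (Y - y) < e"
    using e by (rule tendstoD)
  then have "\<forall>\<^sub>F K in sequentially. mean_hit (Y - 2 * e) \<le>
      (\<Sum>k. drop_weight (2 ^ K) e y k w (post (real k / real (2 ^ K)) w))"
  proof eventually_elim
    case (elim K)
    \<comment> \<open>Its grid time is the one used by \<open>lval\<close>, so the path there tends
      to the left limit at the passage.\<close>
    let ?k = "nat (\<lceil>?T * 2 ^ K\<rceil> - 1)"
    have "0 < \<lceil>?T * 2 ^ K\<rceil>" using T(1) by simp
    then have k: "real ?k / real (2 ^ K) = ?t K" by simp
    define t where "t = ?t K"
    have t: "0 \<le> t" using k unfolding t_def by (metis divide_nonneg_nonneg of_nat_0_le_iff)
    have tT: "t < ?T" "?T - t \<le> 1 / real (2 ^ K)"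
      using ceiling_dyadic_bounds[of ?T K] by (auto simp: t_def)
    \<comment> \<open>The margin \<open>e\<close> puts \<open>a\<close> between
      \<open>Y - 2 * e\<close> and \<open>Y\<close>: the upper bound makes the passage jump a drop
      of at least \<open>a\<close>, the lower one keeps the weight at least
      \<open>mean_hit (Y - 2 * e)\<close>.\<close>
    define a where "a = y + w t - e"
    have a: "Y - 2 * e \<le> a" "a \<le> Y"
      using elim e by (auto simp: a_def t_def dist_real_def)
    have "jump (post t w) (?T - t) = jump w ?T"
      using jump_post[OF w(1) t, of "?T - t"] tT(1) by simp
    also have "\<dots> = w ?T - (Y - y)" using cadlag_jump[OF w(1) T(1)] Y by simp
    also have "\<dots> \<le> - a" using hit_value[OF w(1) fin] a(2) by simp
    finally have "has_drop (1 / real (2 ^ K)) a (post t w)"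
      using tT t w(1) by (intro has_drop_jump[of _ _ "?T - t"] cadlag_post) auto
    moreover have "ennreal t \<le> hit y w"
      using tT(1) by (subst T(2)) (intro ennreal_leI, simp)
    ultimately have "drop_weight (2 ^ K) e y ?k w (post (real ?k / real (2 ^ K)) w) = mean_hit a"
      unfolding drop_weight_def k t_def[symmetric] a_def by simp
    then have "mean_hit (Y - 2 * e) \<le> drop_weight (2 ^ K) e y ?k w (post (real ?k / real (2 ^ K)) w)"
      using mean_hit_mono[OF a(1)] by simp
    also have "\<dots> \<le> (\<Sum>k. drop_weight (2 ^ K) e y k w (post (real k / real (2 ^ K)) w))"
      using sum_le_suminf[of "\<lambda>k. drop_weight (2 ^ K) e y k w (post (real k / real (2 ^ K)) w)" "{?k}"] by simp
    finally show ?case .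
  qed
  then show ?thesis unfolding Y_def by (rule Liminf_bounded)
qed (simp add: mean_hit_nonpos)

text \<open>Fatou's lemma along \<open>N = 2 ^ K\<close> integrates the pathwise bound. Each grid
  time up to the passage contributes at most \<open>q / N\<close>, and these contributions form a
  Riemann sum for \<open>q * mean_hit y\<close>.\<close>

lemma mean_hit_pre_level_le:
  assumes \<pi>: "is_levy_measure M X \<pi>" and bound: "\<And>a. 0 < a \<Longrightarrow> mean_hit a * emeasure \<pi> {..- a} \<le> q"
    and q: "q < \<top>" and y: "0 < y"
  shows "(\<integral>\<^sup>+\<omega>. mean_hit (pre_level y (path \<omega>)) \<partial>M) \<le> q * mean_hit y"
proof -
  note fin = AE_hit_finite[OF mean_hit_less_top[of y]]
  have le: "(\<integral>\<^sup>+\<omega>. mean_hit (pre_level y (path \<omega>) - 2 * e) \<partial>M) \<le> q * mean_hit y" if e: "0 < e" for e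
  proof -
    let ?g = "\<lambda>K \<omega>. \<Sum>k. drop_weight (2 ^ K) e y k (path \<omega>) (post (real k / real (2 ^ K)) (path \<omega>))"
    have dw [measurable]: "(\<lambda>\<omega>. drop_weight N e y k (path \<omega>) (post (real k / real N) (path \<omega>))) \<in> borel_measurable M" for N k
      using measurable_compose[OF measurable_Pair[OF measurable_path measurable_compose[OF measurable_path measurable_post]] measurable_drop_weight]
      by simp
    have "(\<integral>\<^sup>+\<omega>. mean_hit (pre_level y (path \<omega>) - 2 * e) \<partial>M) \<le> (\<integral>\<^sup>+\<omega>. liminf (\<lambda>K. ?g K \<omega>) \<partial>M)"
    proof (rule nn_integral_mono_AE)
      show "AE \<omega> in M. mean_hit (pre_level y (path \<omega>) - 2 * e) \<le> liminf (\<lambda>K. ?g K \<omega>)"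
        using fin AE_space
        by eventually_elim (intro mean_hit_le_liminf_drop_weight cadlag_path path_0 y e)
    qed
    also have "\<dots> \<le> liminf (\<lambda>K. \<integral>\<^sup>+\<omega>. ?g K \<omega> \<partial>M)"
      by (rule nn_integral_liminf) measurable
    also have "\<dots> \<le> liminf (\<lambda>K. q * (mean_hit y + ennreal (1 / 2 ^ K)))"
    proof (intro Liminf_mono always_eventually allI)
      fix K
      let ?N = "2 ^ K :: nat"
      have "(\<integral>\<^sup>+\<omega>. ?g K \<omega> \<partial>M) = (\<Sum>k. \<integral>\<^sup>+\<omega>. drop_weight ?N e y k (path \<omega>) (post (real k / real ?N) (path \<omega>)) \<partial>M)"
        by (rule nn_integral_suminf) measurable
      also have "\<dots> \<le> (\<Sum>k. \<integral>\<^sup>+\<omega>. q * (ennreal (1 / real ?N) * indicator {k. ennreal (real k / real ?N) \<le> hit y (path \<omega>)} k) \<partial>M)"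
        by (intro suminf_le nn_integral_drop_weight[OF \<pi> bound]) auto
      also have "\<dots> = (\<integral>\<^sup>+\<omega>. (\<Sum>k. q * (ennreal (1 / real ?N) * indicator {k. ennreal (real k / real ?N) \<le> hit y (path \<omega>)} k)) \<partial>M)"
        by (subst nn_integral_suminf) (auto simp: indicator_def)
      also have "\<dots> \<le> (\<integral>\<^sup>+\<omega>. q * (hit y (path \<omega>) + ennreal (1 / real ?N)) \<partial>M)"
      proof (rule nn_integral_mono)
        fix \<omega>
        show "(\<Sum>k. q * (ennreal (1 / real ?N) * indicator {k. ennreal (real k / real ?N) \<le> hit y (path \<omega>)} k)) \<le>
            q * (hit y (path \<omega>) + ennreal (1 / real ?N))"
          by (subst ennreal_suminf_cmult) (intro mult_left_mono suminf_grid_indicator_le, auto)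
      qed
      also have "\<dots> = q * (mean_hit y + ennreal (1 / real ?N))"
        by (subst nn_integral_cmult) (auto simp: nn_integral_add mean_hit_def emeasure_space_1)
      finally show "(\<integral>\<^sup>+\<omega>. ?g K \<omega> \<partial>M) \<le> q * (mean_hit y + ennreal (1 / 2 ^ K))" by simp
    qed
    also have "\<dots> = q * mean_hit y"
    proof (rule lim_imp_Liminf)
      have "(\<lambda>K. ennreal (1 / 2 ^ K)) \<longlonglongrightarrow> ennreal 0"
        by (rule tendsto_ennrealI[OF tendsto_dyadic_0])
      then have "(\<lambda>K. mean_hit y + ennreal (1 / 2 ^ K)) \<longlonglongrightarrow> mean_hit y + 0"
        by (intro tendsto_add tendsto_const) simp
      then show "(\<lambda>K. q * (mean_hit y + ennreal (1 / 2 ^ K))) \<longlonglongrightarrow> q * mean_hit y"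
        using q by (intro ennreal_tendsto_cmult) (simp_all add: less_top)
    qed simp
    finally show ?thesis .
  qed
  \<comment> \<open>Letting \<open>e = ?d n / 2\<close> tend to 0 uses left-continuity of
    \<open>mean_hit\<close> at the random level.\<close>
  let ?d = "\<lambda>n. inverse (real (Suc n))"
  have "(\<integral>\<^sup>+\<omega>. mean_hit (pre_level y (path \<omega>)) \<partial>M) \<le> (\<integral>\<^sup>+\<omega>. (SUP n. mean_hit (pre_level y (path \<omega>) - ?d n)) \<partial>M)"
  proof (rule nn_integral_mono)
    fix \<omega>
    show "mean_hit (pre_level y (path \<omega>)) \<le> (SUP n. mean_hit (pre_level y (path \<omega>) - ?d n))"
      using SUP_mean_hit[of "pre_level y (path \<omega>)"] mean_hit_nonpos[of "pre_level y (path \<omega>)"]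
      by (cases "0 < pre_level y (path \<omega>)") auto
  qed
  also have "\<dots> = (SUP n. \<integral>\<^sup>+\<omega>. mean_hit (pre_level y (path \<omega>) - ?d n) \<partial>M)"
    by (intro nn_integral_monotone_convergence_SUP incseq_SucI le_funI mean_hit_mono) (auto simp: field_simps)
  also have "\<dots> \<le> q * mean_hit y"
  proof (rule SUP_least)
    show "(\<integral>\<^sup>+\<omega>. mean_hit (pre_level y (path \<omega>) - ?d n) \<partial>M) \<le> q * mean_hit y" for n
      using le[of "?d n / 2"] by simp
  qed
  finally show ?thesis .
qed

end

section \<open>The absorption time\<close>

text \<open>\<open>f\<close> differs from \<open>g\<close> on a subset of a null set, which the
  completion contains. It serves the absorption time, which is identified with a measurable
  functional of the path only almost surely.\<close>

lemma borel_measurable_completion_AE: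
  fixes f g :: "'a \<Rightarrow> 'b :: topological_space"
  assumes g: "g \<in> borel_measurable M" and eq: "AE x in M. f x = g x"
  shows "f \<in> borel_measurable (completion M)"
proof (rule measurableI)
  fix A :: "'b set" assume A: "A \<in> sets borel"
  have [measurable]: "Measurable.pred (completion M) (\<lambda>x. f x \<noteq> g x)"
    "Measurable.pred (completion M) (\<lambda>x. f x \<in> A \<and> f x \<noteq> g x)"
    by (auto intro!: sets_completion_AE eventually_mono[OF eq])
  have [measurable]: "Measurable.pred (completion M) (\<lambda>x. g x \<in> A)"
    using measurable_sets[OF measurable_completion[OF g] A] by (simp add: pred_def vimage_def Int_def conj_commute)
  have "f -` A \<inter> space (completion M) =
      {x \<in> space (completion M). (g x \<in> A \<and> \<not> f x \<noteq> g x) \<or> (f x \<in> A \<and> f x \<noteq> g x)}"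
    by auto
  also have "\<dots> \<in> sets (completion M)" by measurable
  finally show "f -` A \<inter> space (completion M) \<in> sets (completion M)" .
qed simp

text \<open>\<open>zeta n y w\<close> is the \<open>n\<close>-th passage time of the process started from \<open>y\<close> along the path \<open>w\<close>:
  restart from \<open>pre_level\<close>, the left limit at the passage, along the path shifted by that time.\<close>

fun zeta :: "nat \<Rightarrow> real \<Rightarrow> (real \<Rightarrow> real) \<Rightarrow> ennreal" where
  "zeta 0 y w = 0"
| "zeta (Suc n) y w = (if y \<le> 0 then 0 else hit y w + zeta n (pre_level y w) (post_hit y w))"

text \<open>\<open>hit_left \<le> first_passage \<le> hit\<close>, so \<open>hit_left = hit\<close> determines the first passage into the
  closed half-line, which need not be a measurable function of the path.\<close>

fun proper_passages :: "nat \<Rightarrow> real \<Rightarrow> (real \<Rightarrow> real) \<Rightarrow> bool" where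
  "proper_passages 0 y w = True"
| "proper_passages (Suc n) y w = (y \<le> 0 \<or>
     hit_left y w = hit y w \<and> hit y w < \<top> \<and> proper_passages n (pre_level y w) (post_hit y w))"

lemma measurable_zeta [measurable]:
  "y \<in> borel_measurable N \<Longrightarrow> f \<in> N \<rightarrow>\<^sub>M paths \<Longrightarrow> (\<lambda>x. zeta n (y x) (f x)) \<in> borel_measurable N"
proof (induction n arbitrary: y f)
  case (Suc n)
  note [measurable] = Suc.prems
  have [measurable]: "(\<lambda>x. zeta n (pre_level (y x) (f x)) (post_hit (y x) (f x))) \<in> borel_measurable N"
    by (rule Suc.IH) measurable
  show ?case by simp
qed simp

lemma measurable_proper_passages [measurable]:
  "y \<in> borel_measurable N \<Longrightarrow> f \<in> N \<rightarrow>\<^sub>M paths \<Longrightarrow> Measurable.pred N (\<lambda>x. proper_passages n (y x) (f x))"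
proof (induction n arbitrary: y f)
  case (Suc n)
  note [measurable] = Suc.prems
  have [measurable]: "Measurable.pred N (\<lambda>x. proper_passages n (pre_level (y x) (f x)) (post_hit (y x) (f x)))"
    by (rule Suc.IH) measurable
  show ?case by simp
qed simp

lemma zeta_le_Suc: "zeta n y w \<le> zeta (Suc n) y w"
proof (induction n arbitrary: y w)
  case (Suc n)
  then show ?case by (simp del: zeta.simps(2) add: zeta.simps(2)[of n] zeta.simps(2)[of "Suc n"] add_left_mono)
qed simp

text \<open>Steps are counted from 0, so step \<open>n\<close> is about passage
  \<open>n + 1\<close>. After the first passage either \<open>Y = 0\<close> and the process is
  absorbed there, or \<open>Y > 0\<close> and it restarts as
  \<open>\<lambda>t. Y + \<theta> t\<close>.\<close>

lemma first_passage_resurrection_step_eq_zeta: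
  assumes "cadlag w" "w 0 = 0" "0 \<le> y" "proper_passages (Suc n) y w" "\<And>t. 0 \<le> t \<Longrightarrow> f t = y + w t"
  shows "first_passage (resurrection_step f n) = zeta (Suc n) y w"
  using assms
proof (induction n arbitrary: y w f)
  case (0 y w f)
  note w = \<open>cadlag w\<close>
  have fp: "first_passage f = first_passage (\<lambda>t. y + w t)" by (rule first_passage_cong) (use 0 in auto)
  show ?case
  proof (cases "y \<le> 0")
    case True
    then have "first_passage f = 0"
      unfolding fp using first_passage_le[of 0 "\<lambda>t. y + w t"] 0 by simp
    then show ?thesis using True by simp
  next
    case False
    then have "first_passage f = hit y w"
      unfolding fp using hit_left_le_first_passage[OF w, of y] first_passage_le_hit[of y w] 0(4) by simp
    then show ?thesis using False by simp
  qed
next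
  case (Suc m y w f)
  note w = \<open>cadlag w\<close> and w0 = \<open>w 0 = 0\<close> and f = Suc.prems(5)
  have fp: "first_passage f = first_passage (\<lambda>t. y + w t)" by (rule first_passage_cong) (use f in auto)
  show ?case
  proof (cases "y = 0")
    case True
    have "first_passage f = ennreal 0"
      unfolding fp using first_passage_le[of 0 "\<lambda>t. y + w t"] w0 True by simp
    then have "first_passage (resurrection_step f (Suc m)) = ennreal 0"
      by (rule first_passage_resurrection_step_stationary) (simp_all add: jump_def)
    then show ?thesis using True by simp
  next
    case False
    then have y: "0 < y" using Suc.prems by simp
    define T where "T = enn2real (hit y w)"
    define Y where "Y = pre_level y w"
    define \<theta> where "\<theta> = post_hit y w"
    have good: "hit_left y w = hit y w" "hit y w < \<top>" "proper_passages (Suc m) Y \<theta>"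
      using Suc.prems(4) y by (simp_all add: Y_def \<theta>_def)
    have hit0: "hit y w \<noteq> 0" using hit_pos[OF w w0 y] by simp
    have T: "hit y w = ennreal T" "0 < T"
      using good hit0 by (auto simp: T_def enn2real_positive_iff zero_less_iff_neq_zero)
    have fpT: "first_passage f = ennreal T"
      unfolding fp T(1)[symmetric]
      using hit_left_le_first_passage[OF w, of y] first_passage_le_hit[of y w] good by simp
    have Y: "Y = y + lval T w" using hit0 by (simp add: Y_def T_def pre_level_def)
    have "0 \<le> Y" unfolding Y_def using w y good by (intro pre_level_nonneg) auto
    have \<theta>: "\<theta> = post T w" unfolding \<theta>_def T_def by (rule post_hit_eq[OF w])
    have \<theta>': "cadlag \<theta>" "\<theta> 0 = 0" unfolding \<theta> using w T cadlag_post[of w T] by (simp_all add: post_def)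
    have left: "(f \<longlongrightarrow> Y) (at_left T)"
      unfolding Y using tendsto_at_left_cong[of f "\<lambda>t. y + w t" T, OF f T(2)]
        tendsto_add[OF tendsto_const cadlag_tendsto_lval[OF w T(2)]] by blast
    have jump: "jump f T = f T - Y" by (rule jump_eq[OF T(2) left])
    let ?g = "remove_passage_jump f"
    \<comment> \<open>Removing the jump \<open>f T - Y\<close> shifts the rest of the path so that
      it continues from the left limit \<open>Y\<close>.\<close>
    have g: "?g (T + t) = Y + \<theta> t" if "0 \<le> t" for t
      using that T(2) f[of "T + t"] f[of T]
      by (simp add: remove_passage_jump_def fpT jump \<theta> post_def ennreal_less_iff del: ennreal_plus)
    have g_pos: "?g t > 0" if "0 \<le> t" "t < T" for t
    proof -
      have "ennreal t < first_passage f" using that T by (simp add: fpT ennreal_less_iff)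
      then show ?thesis using that by (simp add: remove_passage_jump_before first_passage_pos)
    qed
    have Suc_eq: "zeta (Suc (Suc m)) y w = ennreal T + zeta (Suc m) Y \<theta>"
      using y T by (simp add: Y_def \<theta>_def)
    show ?thesis
    proof (cases "Y = 0")
      case True
      \<comment> \<open>The repaired path reaches 0 at \<open>T\<close> with left limit 0, so no
        jump remains to be removed.\<close>
      have gT: "?g T = 0" using g[of 0] True \<theta>' by simp
      have "first_passage ?g = ennreal T"
        using first_passage_remove_ge[of f] first_passage_le[of T ?g] T gT by (simp add: fpT)
      moreover have "(?g \<longlongrightarrow> Y) (at_left T)"
      proof -
        have "\<forall>\<^sub>F t in at_left T. t \<in> {0<..<T}" by (rule eventually_at_left_real[OF T(2)])
        then have "\<forall>\<^sub>F t in at_left T. f t = ?g t"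
          by eventually_elim (simp add: remove_passage_jump_before fpT ennreal_less_iff)
        then show ?thesis using left by (rule Lim_transform_eventually[rotated])
      qed
      then have "jump ?g T = 0" using jump_eq[OF T(2), of ?g Y] gT True by simp
      ultimately have "first_passage (resurrection_step ?g m) = ennreal T"
        using T by (intro first_passage_resurrection_step_stationary) auto
      moreover have "zeta (Suc m) Y \<theta> = 0" using True by simp
      ultimately show ?thesis by (simp only: resurrection_step_Suc' Suc_eq add_0_right)
    next
      case False
      then have "0 < Y" using \<open>0 \<le> Y\<close> by simp
      \<comment> \<open>Positivity of the restarted passage, as the restart lemma requires; the
        lower level \<open>Y / 2\<close> allows \<open>hit\<close> to be compared with the closed
        passage.\<close>
      then have "0 < hit (Y / 2) \<theta>" using \<theta>' by (intro hit_pos) auto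
      also have "\<dots> \<le> first_passage (\<lambda>t. Y + \<theta> t)"
        using \<open>0 < Y\<close> \<theta>' by (intro hit_le_first_passage) auto
      finally have "first_passage (resurrection_step ?g m) =
          ennreal T + first_passage (resurrection_step (\<lambda>t. Y + \<theta> t) m)"
        using T g g_pos by (intro first_passage_resurrection_step_restart) auto
      also have "first_passage (resurrection_step (\<lambda>t. Y + \<theta> t) m) = zeta (Suc m) Y \<theta>"
        using \<theta>' \<open>0 \<le> Y\<close> good by (intro Suc.IH) auto
      finally show ?thesis by (simp only: resurrection_step_Suc' Suc_eq)
    qed
  qed
qed

context levy_to_minus_infinity
begin

lemma AE_pre_level_nonneg: "0 \<le> y \<Longrightarrow> AE \<omega> in M. 0 \<le> pre_level y (path \<omega>)"
  using AE_hit_finite[OF mean_hit_less_top[of y]] AE_space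
  by eventually_elim (intro pre_level_nonneg cadlag_path)

text \<open>The null set depends on the level. Since the path after the passage is independent of
  the level before it, \<open>AE_passage\<close> still allows the random level to be
  inserted.\<close>

lemma AE_proper_passages: "0 \<le> y \<Longrightarrow> AE \<omega> in M. proper_passages n y (path \<omega>)"
proof (induction n arbitrary: y)
  case (Suc n)
  show ?case
  proof (cases "y = 0")
    case False
    then have y: "0 < y" using Suc.prems by simp
    note fin = AE_hit_finite[OF mean_hit_less_top[of y]]
    have "AE \<omega> in M. proper_passages n (pre_level y (path \<omega>)) (post_hit y (path \<omega>))"
    proof (rule AE_passage[OF fin])
      show "AE \<omega> in M. AE \<omega>' in M. proper_passages n (pre_level y (path \<omega>)) (path \<omega>')"
        using AE_pre_level_nonneg[OF Suc.prems] by eventually_elim (rule Suc.IH)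
    qed measurable
    with fin AE_hit_left[OF y] show ?thesis
      by eventually_elim simp
  qed simp
qed simp

text \<open>The condition on \<open>K\<close> makes the bound reproduce itself: the first passage
  costs \<open>mean_hit y\<close>, the remaining ones at most
  \<open>K * q * mean_hit y\<close>.\<close>

lemma nn_integral_zeta_le:
  assumes \<pi>: "is_levy_measure M X \<pi>" and bound: "\<And>a. 0 < a \<Longrightarrow> mean_hit a * emeasure \<pi> {..- a} \<le> q"
    and q: "q < \<top>" and K: "1 + K * q \<le> K" and y: "0 \<le> y"
  shows "(\<integral>\<^sup>+\<omega>. zeta n y (path \<omega>) \<partial>M) \<le> K * mean_hit y"
  using y
proof (induction n arbitrary: y)
  case (Suc n)
  show ?case
  proof (cases "y = 0")
    case False
    then have y: "0 < y" using Suc.prems by simp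
    note fin = AE_hit_finite[OF mean_hit_less_top[of y]]
    have "(\<integral>\<^sup>+\<omega>. zeta (Suc n) y (path \<omega>) \<partial>M) =
        mean_hit y + (\<integral>\<^sup>+\<omega>. zeta n (pre_level y (path \<omega>)) (post_hit y (path \<omega>)) \<partial>M)"
      using y by (simp add: nn_integral_add mean_hit_def)
    also have "(\<integral>\<^sup>+\<omega>. zeta n (pre_level y (path \<omega>)) (post_hit y (path \<omega>)) \<partial>M) =
        (\<integral>\<^sup>+\<omega>. (\<integral>\<^sup>+\<omega>'. zeta n (pre_level y (path \<omega>)) (path \<omega>') \<partial>M) \<partial>M)"
      using nn_integral_passage[OF fin, of "\<lambda>p. zeta n (fst p) (snd p)"] by simp
    also have "\<dots> \<le> (\<integral>\<^sup>+\<omega>. K * mean_hit (pre_level y (path \<omega>)) \<partial>M)"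
    proof (rule nn_integral_mono_AE)
      show "AE \<omega> in M. (\<integral>\<^sup>+\<omega>'. zeta n (pre_level y (path \<omega>)) (path \<omega>') \<partial>M) \<le> K * mean_hit (pre_level y (path \<omega>))"
        using AE_pre_level_nonneg[OF Suc.prems] by eventually_elim (rule Suc.IH)
    qed
    also have "\<dots> = K * (\<integral>\<^sup>+\<omega>. mean_hit (pre_level y (path \<omega>)) \<partial>M)"
      by (rule nn_integral_cmult) measurable
    also have "\<dots> \<le> K * (q * mean_hit y)"
      by (intro mult_left_mono mean_hit_pre_level_le[OF \<pi> bound q y]) simp_all
    finally have "(\<integral>\<^sup>+\<omega>. zeta (Suc n) y (path \<omega>) \<partial>M) \<le> (1 + K * q) * mean_hit y"
      by (simp add: distrib_right mult.assoc add_left_mono)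
    also have "\<dots> \<le> K * mean_hit y" using K by (rule mult_right_mono) simp
    finally show ?thesis .
  qed simp
qed simp

lemma absorption_time_finite_mean:
  assumes \<pi>: "is_levy_measure M X \<pi>" and bound: "\<And>a. 0 < a \<Longrightarrow> mean_hit a * emeasure \<pi> {..- a} \<le> q"
    and q: "q < 1" and x: "0 \<le> x"
  defines "Z \<equiv> \<lambda>\<omega>. absorption_time (\<lambda>t. x + X t \<omega>)"
  shows "Z \<in> borel_measurable (completion M)" "(\<integral>\<^sup>+\<omega>. Z \<omega> \<partial>completion M) < \<top>" "AE \<omega> in M. Z \<omega> < \<top>"
proof -
  \<comment> \<open>A measurable version of the absorption time.\<close>
  define W where "W \<omega> = (SUP n. zeta (Suc n) x (path \<omega>))" for \<omega>
  have W [measurable]: "W \<in> borel_measurable M" unfolding W_def by measurable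
  have "AE \<omega> in M. \<forall>n. proper_passages (Suc n) x (path \<omega>)"
    by (subst AE_all_countable) (intro allI AE_proper_passages x)
  then have eq: "AE \<omega> in M. Z \<omega> = W \<omega>"
    using AE_path AE_space
  proof eventually_elim
    case (elim \<omega>)
    then have "first_passage (resurrection_step (\<lambda>t. x + X t \<omega>) n) = zeta (Suc n) x (path \<omega>)" for n
      using x by (intro first_passage_resurrection_step_eq_zeta cadlag_path path_0) auto
    then show ?case unfolding Z_def W_def absorption_time_eq by simp
  qed
  show "Z \<in> borel_measurable (completion M)"
    by (rule borel_measurable_completion_AE[OF W eq])
  obtain r where r: "q = ennreal r" "0 \<le> r" "r < 1"
    using q by (cases q) (auto simp: ennreal_less_one_iff)
  \<comment> \<open>The solution of \<open>1 + K * q = K\<close>, the sum of the geometric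
    series.\<close>
  define K where "K = ennreal (1 / (1 - r))"
  have "1 + K * q = ennreal (1 + 1 / (1 - r) * r)"
    using r unfolding K_def by (simp add: ennreal_mult[symmetric] ennreal_plus[symmetric] del: ennreal_plus flip: ennreal_1)
  also have "1 + 1 / (1 - r) * r = 1 / (1 - r)" using r by (simp add: field_simps)
  finally have K: "1 + K * q \<le> K" by (simp add: K_def)
  have "(\<integral>\<^sup>+\<omega>. W \<omega> \<partial>M) = (SUP n. \<integral>\<^sup>+\<omega>. zeta (Suc n) x (path \<omega>) \<partial>M)"
    unfolding W_def
    by (intro nn_integral_monotone_convergence_SUP incseq_SucI le_funI zeta_le_Suc) measurable
  also have "\<dots> \<le> K * mean_hit x"
    using q by (intro SUP_least nn_integral_zeta_le[OF \<pi> bound _ K x]) (auto intro: less_trans)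
  also have "\<dots> < \<top>"
    using mean_hit_less_top[of x] by (auto simp: K_def ennreal_mult_less_top)
  finally have fin: "(\<integral>\<^sup>+\<omega>. W \<omega> \<partial>M) < \<top>" .
  have "(\<integral>\<^sup>+\<omega>. Z \<omega> \<partial>completion M) = (\<integral>\<^sup>+\<omega>. W \<omega> \<partial>completion M)"
    by (intro nn_integral_cong_AE AE_completion eq)
  then show "(\<integral>\<^sup>+\<omega>. Z \<omega> \<partial>completion M) < \<top>"
    using fin by (simp add: nn_integral_completion)
  have "AE \<omega> in M. W \<omega> \<noteq> \<infinity>"
    using fin by (intro nn_integral_PInf_AE) auto
  with eq show "AE \<omega> in M. Z \<omega> < \<top>"
    by eventually_elim (simp add: less_top)
qed

end

theorem theorem3:
  fixes M :: "'a measure"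
    and X :: "real \<Rightarrow> 'a \<Rightarrow> real"
    and \<pi> :: "real measure"
    and U Ustar :: "(real \<times> real) measure"
    and \<kappa> \<kappa>star :: real
  assumes levy: "levy_process M X"
    and levy_measure: "is_levy_measure M X \<pi>"
    and ascending: "ascending_ladder M X U \<kappa>"
    and descending: "ascending_ladder M (\<lambda>t \<omega>. - X t \<omega>) Ustar \<kappa>star"
    and normalization: "wiener_hopf_normalized M X U Ustar"
    and regular: "regular_for M X {..<0}"
    and drift: "drifts_to_minus_infinity M X"
    and sup_bound:
      "(SUP y\<in>{0<..}. emeasure Ustar ({0..} \<times> {0..y}) * emeasure \<pi> {..-y}) < ennreal \<kappa>"
  shows "\<forall>x\<ge>0.
      (\<lambda>\<omega>. absorption_time (\<lambda>t. x + X t \<omega>)) \<in> borel_measurable (completion M) \<and>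
      (\<integral>\<^sup>+\<omega>. absorption_time (\<lambda>t. x + X t \<omega>) \<partial>completion M) < \<top> \<and>
      (AE \<omega> in M. absorption_time (\<lambda>t. x + X t \<omega>) < \<top>)"
proof -
  interpret levy_to_minus_infinity M X
    using levy drift regular by unfold_locales
  let ?c = "SUP y\<in>{0<..}. emeasure Ustar ({0..} \<times> {0..y}) * emeasure \<pi> {..-y}"
  have \<kappa>: "0 < \<kappa>" using le_less_trans[OF zero_le sup_bound] by (simp add: ennreal_less_zero_iff)
  \<comment> \<open>The role of \<open>q\<close> is played by the supremum divided by
    \<open>\<kappa>\<close>.\<close>
  have "mean_hit a * emeasure \<pi> {..- a} \<le> ennreal (1 / \<kappa>) * ?c" if a: "0 < a" for a
  proof -
    have "mean_hit a \<le> ennreal (1 / \<kappa>) * emeasure Ustar ({0..} \<times> {0..a})"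
      using mean_hit_le_renewal[OF normalization _ _ a] sets_ascending_ladder[OF ascending]
        sets_ascending_ladder[OF descending] emeasure_ascending_ladder_UNIV[OF ascending \<kappa>] by simp
    then have "mean_hit a * emeasure \<pi> {..- a} \<le>
        ennreal (1 / \<kappa>) * emeasure Ustar ({0..} \<times> {0..a}) * emeasure \<pi> {..- a}"
      by (rule mult_right_mono) simp
    also have "\<dots> \<le> ennreal (1 / \<kappa>) * ?c"
      unfolding mult.assoc using a by (intro mult_left_mono SUP_upper) auto
    finally show ?thesis .
  qed
  moreover have "ennreal (1 / \<kappa>) * ?c < 1"
  proof -
    have "ennreal (1 / \<kappa>) * ?c < ennreal (1 / \<kappa>) * ennreal \<kappa>"
      using \<kappa> sup_bound by (intro ennreal_mult_strict_left_mono) auto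
    then show ?thesis using \<kappa> by (simp add: ennreal_mult[symmetric])
  qed
  ultimately show ?thesis
    using absorption_time_finite_mean[OF levy_measure] by blast
qed

end
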